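(* Let $A$ be a diagonal AH-algebra with canonical C$^*$-diagonal $C$, and let $\mathcal B$ be the Bratteli diagram of its AF-subsystem. Let $\mathcal G_{\mathcal B}\ltimes\widehat C$ be the transformation groupoid of the conjugation action of $\mathcal G_{\mathcal B}$ on $\widehat C$, given by $((x,y)\cdot\chi)(c)=\chi(1_{Z_{p,q}}^*c\,1_{Z_{p,q}})$, and let $\mathcal G_A$ be the Weyl groupoid of the Cartan inclusion $C\subseteq A$. There is an isomorphism $F\colon\mathcal G_{\mathcal B}\ltimes\widehat C\to\mathcal G_A$ of topological groupoids given by $$F((x,y),\chi)=[\alpha_{1_{Z_{p,q}}},\chi],$$ where $p$ and $q$ are initial segments of $x$ and $y$ of the same length such that $(x,y)\in Z_{p,q}$.
   Context: Diagonal AH-systems. $\mathbb N=\{1,2,\dots\}$. For $n\in\mathbb N$ let $A_n=\bigoplus_{i=1}^{N_n}C(X_{n,i})\otimes M_{k_{n,i}}$ with $X_{n,i}$ compact Hausdorff. A diagonal AH-system is an inductive system of such algebras whose connecting maps $\varphi_n\colon A_n\to A_{n+1}$ are unital injective diagonal maps: for all $i\le N_n$, $j\le N_{n+1}$ there are a finite (possibly empty) set $E_n(i,j)$ and continuous maps (eigenfunctions) $\lambda_e\colon X_{n+1,j}\to X_{n,i}$, $e\in E_n(i,j)$, such that the $j$-th component of $\varphi_n(f_1,\dots,f_{N_n})$ is block diagonal with blocks $f_i\circ\lambda_e$ ($1\le i\le N_n$, $e\in E_n(i,j)$), in some fixed order. The limit $A=\varinjlim_n(A_n,\varphi_n)$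 is a diagonal AH-algebra; $A_n$ is identified with its image in $A$. Subalgebras. $C_n=\bigoplus_i C(X_{n,i})\otimes D_{k_{n,i}}$ with $D_k\subseteq M_k$ the diagonal matrices, and $C=\varinjlim_n C_n\subseteq A$ (a C$^*$-diagonal, in particular a Cartan subalgebra, of $A$) with Gelfand spectrum $\widehat C$. $B_n=\bigoplus_i 1\otimes M_{k_{n,i}}\subseteq A_n$ and $B=\varinjlim_n B_n\subseteq A$ (the AF-subalgebra). Bratteli diagram $\mathcal B$ of the AF-subsystem. $V_0=\{v_0\}$ (root), $V_n=\{(n,1),\dots,(n,N_n)\}$ for $n\ge1$; $E_0$ consists of $k_{1,j}$ edges from $v_0$ to $(1,j)$ for each $j$; for $n\ge 1$ the edges from $(n,i)$ to $(n+1,j)$ are the elements of $E_n(i,j)$. The index set $\{1,\dots,k_{n,i}\}$ of $M_{k_{n,i}}$ is identified with the set of paths of length $n$ from $v_0$ to $(n,i)$: for $n=1$ via $E_0$, and inductively the diagonal position of index $p$ inside the block $f_i\circ\lambda_e$ of $\varphi_n(f)$ is labelled $pe$. $\mathcal P^\infty_{\mathcal B}$ is the set of infinite paths $x=x_1x_2\cdots$ starting at $v_0$, with base of open sets $Z_p=\{x: x_{[1,n]}=p\}$ ($p$ a path of length $n$ from $v_0$). $\mathcal G_{\mathcal B}$ is the groupoid of pairs $(x,y)$ of tail-equivalent paths ($x_{[m,\infty)}=y_{[m,\infty)}$ for some $m$), with $(x,y)(y,z)=(x,z)$, $r(x,y)=x$, $s(x,y)=y$, and base of open sets $Z_{p,q}=\{(x,y):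 x_{[1,n]}=p,\ y_{[1,n]}=q,\ x_{[n+1,\infty)}=y_{[n+1,\infty)}\}$ for paths $p,q$ from $v_0$ of equal length $n$ with the same terminal vertex. $C^*_{\mathrm r}(\mathcal G_{\mathcal B})$ is identified with $B$ so that $1_{Z_{p,q}}$ is the matrix unit $e_{p,q}\in B_n$; then $C(\mathcal P^\infty_{\mathcal B})=C\cap B$. Action. The anchor map $\rho\colon\widehat C\to\mathcal P^\infty_{\mathcal B}$ is the Gelfand dual of $C\cap B\subseteq C$, and $((x,y)\cdot\chi)(c)=\chi(1_{Z_{p,q}}^*c\,1_{Z_{p,q}})$ for $\rho(\chi)=y$, $c\in C$ and any $p,q$ with $(x,y)\in Z_{p,q}$. The transformation groupoid $\mathcal G_{\mathcal B}\ltimes\widehat C$ is $\{(\gamma,\chi):s(\gamma)=\rho(\chi)\}$ with the subspace topology, $r(\gamma,\chi)=(r(\gamma),\gamma\cdot\chi)$, $s(\gamma,\chi)=(s(\gamma),\chi)$, $(\eta,\gamma\cdot\chi)(\gamma,\chi)=(\eta\gamma,\chi)$. Weyl groupoid. A normaliser of $C$ in $A$ is $m\in A$ with $mCm^*\subseteq C$ and $m^*Cm\subseteq C$. Put $\mathrm{dom}(m)=\{\chi\in\widehat C:\chi(m^*m)\ne0\}$, $\mathrm{ran}(m)=\mathrm{dom}(m^* )$; there is a unique homeomorphism $\alpha_m\colon\mathrm{dom}(m)\to\mathrm{ran}(m)$ with $(m^*fm)(\chi)=(m^*m)(\chi)\,f(\alpha_m(\chi))$ for $f\in C\cong C(\widehat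 C)$, $\chi\in\mathrm{dom}(m)$. $\mathcal G_A$ is the groupoid of germs $[\alpha_m,\chi]$, $\chi\in\mathrm{dom}(m)$, where $[\alpha_{m_1},\chi_1]=[\alpha_{m_2},\chi_2]$ iff $\chi_1=\chi_2$ and $\alpha_{m_1},\alpha_{m_2}$ agree on an open neighbourhood of $\chi_1$ in $\mathrm{dom}(m_1)\cap\mathrm{dom}(m_2)$; source $\chi$, range $\alpha_m(\chi)$, product $[\alpha_{m},\alpha_{m'}(\chi)][\alpha_{m'},\chi]=[\alpha_{mm'},\chi]$; a base of its topology is given by the sets $\{[\alpha_m,\chi]:\chi\in\mathrm{dom}(m)\cap U\}$ with $m$ a normaliser and $U\subseteq\widehat C$ open. *)

theory Defs
  imports "HOL-Analysis.Analysis"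
begin

section \<open>C*-algebras and Gelfand spectra\<close>

text \<open>No unit is required: the algebras below are closed *-subalgebras of an ambient C*-algebra,
  and their unit need not be a unit of the ambient algebra.\<close>

class cstar_algebra = real_normed_algebra + banach +
  fixes scaleC :: "complex \<Rightarrow> 'a \<Rightarrow> 'a"
    and star :: "'a \<Rightarrow> 'a"
  assumes scaleC_add_right: "scaleC z (a + b) = scaleC z a + scaleC z b"
    and scaleC_add_left: "scaleC (z + w) a = scaleC z a + scaleC w a"
    and scaleC_scaleC: "scaleC z (scaleC w a) = scaleC (z * w) a"
    and scaleC_of_real: "scaleC (complex_of_real t) a = scaleR t a"
    and mult_scaleC_left: "scaleC z a * b = scaleC z (a * b)"
    and mult_scaleC_right: "a * scaleC z b = scaleC z (a * b)"
    and norm_scaleC: "norm (scaleC z a) = cmod z * norm a"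
    and star_add: "star (a + b) = star a + star b"
    and star_scaleC: "star (scaleC z a) = scaleC (cnj z) (star a)"
    and star_mult: "star (a * b) = star b * star a"
    and star_star: "star (star a) = a"
    and cstar_identity: "norm (star a * a) = (norm a)\<^sup>2"

text \<open>Characters are extensional (\<open>undefined\<close> off \<open>D\<close>), so that they are equal iff they
  agree on \<open>D\<close>.\<close>

definition spectrum :: "'a::cstar_algebra set \<Rightarrow> ('a \<Rightarrow> complex) set" where
  "spectrum D = {\<phi> \<in> extensional D.
     (\<exists>a\<in>D. \<phi> a \<noteq> 0) \<and>
     (\<forall>a\<in>D. \<forall>b\<in>D. \<phi> (a + b) = \<phi> a + \<phi> b \<and> \<phi> (a * b) = \<phi> a * \<phi> b) \<and>
     (\<forall>z. \<forall>a\<in>D. \<phi> (scaleC z a) = z * \<phi> a)}"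

definition spectrum_top :: "'a::cstar_algebra set \<Rightarrow> ('a \<Rightarrow> complex) topology" where
  "spectrum_top D = subtopology (product_topology (\<lambda>_. euclidean) D) (spectrum D)"


section \<open>Topological groupoids\<close>

text \<open>\<open>gcomp g h\<close> is meaningful for \<open>gsrc g = grng h\<close> only; the unit space may be
  presented by a type different from that of the arrows.\<close>

record ('g, 'u) top_groupoid =
  arrows :: "'g set"
  gsrc :: "'g \<Rightarrow> 'u"
  grng :: "'g \<Rightarrow> 'u"
  gcomp :: "'g \<Rightarrow> 'g \<Rightarrow> 'g"
  gtop :: "'g topology"

definition top_groupoid_iso ::
  "('g, 'u) top_groupoid \<Rightarrow> ('h, 'v) top_groupoid \<Rightarrow> ('g \<Rightarrow> 'h) \<Rightarrow> bool" where
  "top_groupoid_iso G H F \<longleftrightarrow>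
     bij_betw F (arrows G) (arrows H) \<and>
     homeomorphic_map (gtop G) (gtop H) F \<and>
     (\<forall>g\<in>arrows G. \<forall>h\<in>arrows G.
        (gsrc G g = grng G h \<longleftrightarrow> gsrc H (F g) = grng H (F h)) \<and>
        (gsrc G g = grng G h \<longrightarrow> F (gcomp G g h) = gcomp H (F g) (F h)))"


section \<open>Diagonal AH-systems\<close>

text \<open>Levels are \<open>n \<ge> 1\<close>; summands and matrix indices are counted from 1. All the spaces
  are topologies on subsets of one type. \<open>ah_ord S n j\<close> lists the pairs \<open>(i, e)\<close> with
  \<open>e \<in> ah_E S n i j\<close> in the order in which the blocks occur in the \<open>j\<close>-th component of the
  \<open>n\<close>-th connecting map.\<close>

record ('x, 'e) ah_system =
  ah_N :: "nat \<Rightarrow> nat"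
  ah_k :: "nat \<Rightarrow> nat \<Rightarrow> nat"
  ah_X :: "nat \<Rightarrow> nat \<Rightarrow> 'x topology"
  ah_E :: "nat \<Rightarrow> nat \<Rightarrow> nat \<Rightarrow> 'e set"
  ah_eig :: "nat \<Rightarrow> nat \<Rightarrow> nat \<Rightarrow> 'e \<Rightarrow> 'x \<Rightarrow> 'x"
  ah_ord :: "nat \<Rightarrow> nat \<Rightarrow> (nat \<times> 'e) list"

text \<open>\<open>f i x r c\<close> is the \<open>(r, c)\<close> entry at \<open>x\<close> of the \<open>i\<close>-th summand of \<open>f\<close>; it is
  required to vanish outside the meaningful range of the arguments.\<close>

type_synonym 'x elt = "nat \<Rightarrow> 'x \<Rightarrow> nat \<Rightarrow> nat \<Rightarrow> complex"

definition ah_alg :: "('x, 'e) ah_system \<Rightarrow> nat \<Rightarrow> 'x elt set" where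
  "ah_alg S n = {f.
     (\<forall>i\<in>{1..ah_N S n}. \<forall>r\<in>{1..ah_k S n i}. \<forall>c\<in>{1..ah_k S n i}.
        continuous_map (ah_X S n i) euclidean (\<lambda>x. f i x r c)) \<and>
     (\<forall>i x r c. f i x r c \<noteq> 0 \<longrightarrow>
        i \<in> {1..ah_N S n} \<and> x \<in> topspace (ah_X S n i) \<and> r \<in> {1..ah_k S n i} \<and> c \<in> {1..ah_k S n i})}"

definition elt_add :: "'x elt \<Rightarrow> 'x elt \<Rightarrow> 'x elt" where
  "elt_add f g = (\<lambda>i x r c. f i x r c + g i x r c)"

definition elt_scale :: "complex \<Rightarrow> 'x elt \<Rightarrow> 'x elt" where
  "elt_scale z f = (\<lambda>i x r c. z * f i x r c)"

definition elt_mult :: "('x, 'e) ah_system \<Rightarrow> nat \<Rightarrow> 'x elt \<Rightarrow> 'x elt \<Rightarrow> 'x elt" where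
  "elt_mult S n f g = (\<lambda>i x r c. \<Sum>s = 1..ah_k S n i. f i x r s * g i x s c)"

definition elt_star :: "'x elt \<Rightarrow> 'x elt" where
  "elt_star f = (\<lambda>i x r c. cnj (f i x c r))"

definition elt_unit :: "('x, 'e) ah_system \<Rightarrow> nat \<Rightarrow> 'x elt" where
  "elt_unit S n = (\<lambda>i x r c.
     if i \<in> {1..ah_N S n} \<and> x \<in> topspace (ah_X S n i) \<and> r \<in> {1..ah_k S n i} \<and> r = c then 1 else 0)"

definition diag_alg :: "('x, 'e) ah_system \<Rightarrow> nat \<Rightarrow> 'x elt set" where
  "diag_alg S n = {f \<in> ah_alg S n. \<forall>i x r c. r \<noteq> c \<longrightarrow> f i x r c = 0}"

definition const_alg :: "('x, 'e) ah_system \<Rightarrow> nat \<Rightarrow> 'x elt set" where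
  "const_alg S n = {f \<in> ah_alg S n. \<forall>i r c.
     \<forall>x\<in>topspace (ah_X S n i). \<forall>y\<in>topspace (ah_X S n i). f i x r c = f i y r c}"

text \<open>The block diagonal matrix with the given (size, matrix) blocks, all indices counted from 1.\<close>

fun block_diag :: "(nat \<times> (nat \<Rightarrow> nat \<Rightarrow> complex)) list \<Rightarrow> nat \<Rightarrow> nat \<Rightarrow> complex" where
  "block_diag [] r c = 0"
| "block_diag ((k, M) # bs) r c =
     (if r \<le> k \<and> c \<le> k then M r c
      else if k < r \<and> k < c then block_diag bs (r - k) (c - k)
      else 0)"

definition ah_map :: "('x, 'e) ah_system \<Rightarrow> nat \<Rightarrow> 'x elt \<Rightarrow> 'x elt" where
  "ah_map S n f = (\<lambda>j x.
     if j \<in> {1..ah_N S (Suc n)} \<and> x \<in> topspace (ah_X S (Suc n) j)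
     then block_diag (map (\<lambda>(i, e). (ah_k S n i, f i (ah_eig S n i j e x))) (ah_ord S n j))
     else (\<lambda>r c. 0))"

definition diagonal_ah_system :: "('x, 'e) ah_system \<Rightarrow> bool" where
  "diagonal_ah_system S \<longleftrightarrow> (\<forall>n\<ge>1.
     ah_N S n \<ge> 1 \<and>
     (\<forall>i\<in>{1..ah_N S n}.
        ah_k S n i \<ge> 1 \<and> compact_space (ah_X S n i) \<and> Hausdorff_space (ah_X S n i)) \<and>
     (\<forall>j\<in>{1..ah_N S (Suc n)}.
        (\<forall>i\<in>{1..ah_N S n}. finite (ah_E S n i j) \<and>
           (\<forall>e\<in>ah_E S n i j. continuous_map (ah_X S (Suc n) j) (ah_X S n i) (ah_eig S n i j e))) \<and>
        distinct (ah_ord S n j) \<and>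
        set (ah_ord S n j) = {(i, e). i \<in> {1..ah_N S n} \<and> e \<in> ah_E S n i j} \<and>
        (\<Sum>(i, e)\<leftarrow>ah_ord S n j. ah_k S n i) = ah_k S (Suc n) j) \<and>
     ah_map S n (elt_unit S n) = elt_unit S (Suc n) \<and>
     inj_on (ah_map S n) (ah_alg S n))"


section \<open>The inductive limit\<close>

definition star_hom ::
  "('x, 'e) ah_system \<Rightarrow> nat \<Rightarrow> ('x elt \<Rightarrow> 'a::cstar_algebra) \<Rightarrow> bool" where
  "star_hom S n h \<longleftrightarrow> (\<forall>f\<in>ah_alg S n.
     (\<forall>g\<in>ah_alg S n. h (elt_add f g) = h f + h g \<and> h (elt_mult S n f g) = h f * h g) \<and>
     (\<forall>z. h (elt_scale z f) = scaleC z (h f)) \<and>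
     h (elt_star f) = star (h f))"

text \<open>The limit is given by compatible embeddings \<open>\<psi> n\<close> of the algebras of the system into a
  C*-algebra. As injective *-homomorphisms of C*-algebras are isometric, the closure
  \<open>lim_alg S \<psi>\<close> of the union of the images is the completion of the algebraic direct limit,
  i.e. the inductive limit of the system; \<open>\<psi> n\<close> is the identification of the \<open>n\<close>-th algebra
  with its image in it.\<close>

definition ah_embedding ::
  "('x, 'e) ah_system \<Rightarrow> (nat \<Rightarrow> 'x elt \<Rightarrow> 'a::cstar_algebra) \<Rightarrow> bool" where
  "ah_embedding S \<psi> \<longleftrightarrow> (\<forall>n\<ge>1.
     star_hom S n (\<psi> n) \<and> inj_on (\<psi> n) (ah_alg S n) \<and>
     (\<forall>f\<in>ah_alg S n. \<psi> (Suc n) (ah_map S n f) = \<psi> n f))"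

definition lim_alg ::
  "('x, 'e) ah_system \<Rightarrow> (nat \<Rightarrow> 'x elt \<Rightarrow> 'a::cstar_algebra) \<Rightarrow> 'a set" where
  "lim_alg S \<psi> = closure (\<Union>n\<in>{1..}. \<psi> n ` ah_alg S n)"

definition lim_diag ::
  "('x, 'e) ah_system \<Rightarrow> (nat \<Rightarrow> 'x elt \<Rightarrow> 'a::cstar_algebra) \<Rightarrow> 'a set" where
  "lim_diag S \<psi> = closure (\<Union>n\<in>{1..}. \<psi> n ` diag_alg S n)"

definition lim_AF ::
  "('x, 'e) ah_system \<Rightarrow> (nat \<Rightarrow> 'x elt \<Rightarrow> 'a::cstar_algebra) \<Rightarrow> 'a set" where
  "lim_AF S \<psi> = closure (\<Union>n\<in>{1..}. \<psi> n ` const_alg S n)"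


section \<open>The Bratteli diagram and its tail groupoid\<close>

text \<open>\<open>Root j l\<close> is the \<open>l\<close>-th edge from the root to \<open>(1, j)\<close>; at level \<open>n \<ge> 1\<close>,
  \<open>Edge i j e\<close> is the edge \<open>e\<close> from \<open>(n, i)\<close> to \<open>(n + 1, j)\<close>. The level of an edge is
  its position in a path and is not part of its name. In lists and infinite paths the edge at
  position \<open>m\<close>, counted from 0, has level \<open>m\<close>.\<close>

datatype 'e edge = Root nat nat | Edge nat nat 'e

primrec edge_src :: "'e edge \<Rightarrow> nat" where
  "edge_src (Root j l) = 0"
| "edge_src (Edge i j e) = i"

primrec edge_tgt :: "'e edge \<Rightarrow> nat" where
  "edge_tgt (Root j l) = j"
| "edge_tgt (Edge i j e) = j"

definition edges :: "('x, 'e) ah_system \<Rightarrow> nat \<Rightarrow> 'e edge set" where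
  "edges S n =
     (if n = 0 then {Root j l | j l. j \<in> {1..ah_N S 1} \<and> l \<in> {1..ah_k S 1 j}}
      else {Edge i j e | i j e. i \<in> {1..ah_N S n} \<and> j \<in> {1..ah_N S (Suc n)} \<and> e \<in> ah_E S n i j})"

definition fin_paths :: "('x, 'e) ah_system \<Rightarrow> nat \<Rightarrow> 'e edge list set" where
  "fin_paths S n = {p. length p = n \<and> (\<forall>m<n. p ! m \<in> edges S m) \<and>
     (\<forall>m. Suc m < n \<longrightarrow> edge_tgt (p ! m) = edge_src (p ! Suc m))}"

definition inf_paths :: "('x, 'e) ah_system \<Rightarrow> (nat \<Rightarrow> 'e edge) set" where
  "inf_paths S = {x. \<forall>m. x m \<in> edges S m \<and> edge_tgt (x m) = edge_src (x (Suc m))}"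

definition initial :: "nat \<Rightarrow> (nat \<Rightarrow> 'e edge) \<Rightarrow> 'e edge list" where
  "initial n x = map x [0..<n]"

text \<open>Pairs of paths of the same length \<open>n \<ge> 1\<close> with the same terminal vertex.\<close>

definition path_pairs :: "('x, 'e) ah_system \<Rightarrow> ('e edge list \<times> 'e edge list) set" where
  "path_pairs S = {(p, q). \<exists>n\<ge>1. p \<in> fin_paths S n \<and> q \<in> fin_paths S n \<and>
     edge_tgt (last p) = edge_tgt (last q)}"

definition cyl ::
  "('x, 'e) ah_system \<Rightarrow> 'e edge list \<Rightarrow> 'e edge list \<Rightarrow> ((nat \<Rightarrow> 'e edge) \<times> (nat \<Rightarrow> 'e edge)) set" where
  "cyl S p q = {(x, y). x \<in> inf_paths S \<and> y \<in> inf_paths S \<and>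
     initial (length p) x = p \<and> initial (length q) y = q \<and> (\<forall>m\<ge>length p. x m = y m)}"

definition tail_groupoid ::
  "('x, 'e) ah_system \<Rightarrow> ((nat \<Rightarrow> 'e edge) \<times> (nat \<Rightarrow> 'e edge), nat \<Rightarrow> 'e edge) top_groupoid" where
  "tail_groupoid S =
     \<lparr>arrows = {(x, y). x \<in> inf_paths S \<and> y \<in> inf_paths S \<and> (\<exists>m. \<forall>l\<ge>m. x l = y l)},
      gsrc = snd,
      grng = fst,
      gcomp = (\<lambda>g h. (fst g, snd h)),
      gtop = topology_generated_by {cyl S p q | p q. (p, q) \<in> path_pairs S}\<rparr>"

text \<open>The index of a path ending in \<open>(n, i)\<close> among \<open>1, \<dots>, ah_k S n i\<close>, for a path listed
  with its last edge first: appending \<open>e\<close> shifts the index by the sizes of the blocks in front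
  of the block of \<open>e\<close>.\<close>

fun rev_path_index :: "('x, 'e) ah_system \<Rightarrow> 'e edge list \<Rightarrow> nat" where
  "rev_path_index S [] = 0"
| "rev_path_index S (Root j l # p) = l"
| "rev_path_index S (Edge i j e # p) =
     (\<Sum>(i', e')\<leftarrow>takeWhile (\<lambda>b. b \<noteq> (i, e)) (ah_ord S (length p) j). ah_k S (length p) i')
     + rev_path_index S p"

definition path_index :: "('x, 'e) ah_system \<Rightarrow> 'e edge list \<Rightarrow> nat" where
  "path_index S p = rev_path_index S (rev p)"

definition matrix_unit :: "('x, 'e) ah_system \<Rightarrow> 'e edge list \<Rightarrow> 'e edge list \<Rightarrow> 'x elt" where
  "matrix_unit S p q = (\<lambda>i x r c.
     if i = edge_tgt (last p) \<and> x \<in> topspace (ah_X S (length p) i)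
        \<and> r = path_index S p \<and> c = path_index S q
     then 1 else 0)"

text \<open>The characteristic function of \<open>cyl S p q\<close>, under the identification of the reduced
  C*-algebra of the tail groupoid with \<open>lim_AF S \<psi>\<close>.\<close>

definition ind_cyl ::
  "('x, 'e) ah_system \<Rightarrow> (nat \<Rightarrow> 'x elt \<Rightarrow> 'a::cstar_algebra) \<Rightarrow> 'e edge list \<Rightarrow> 'e edge list \<Rightarrow> 'a" where
  "ind_cyl S \<psi> p q = \<psi> (length p) (matrix_unit S p q)"


section \<open>The action and the transformation groupoid\<close>

text \<open>The algebra of continuous functions on the path space is identified with
  \<open>lim_diag S \<psi> \<inter> lim_AF S \<psi>\<close>, the characteristic function of the paths beginning with \<open>p\<close>
  being \<open>ind_cyl S \<psi> p p\<close>. The linear span of these functions is dense, so evaluation at \<open>x\<close>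
  is the character determined by their values at \<open>x\<close>.\<close>

definition is_path_eval ::
  "('x, 'e) ah_system \<Rightarrow> (nat \<Rightarrow> 'x elt \<Rightarrow> 'a::cstar_algebra) \<Rightarrow> (nat \<Rightarrow> 'e edge) \<Rightarrow> ('a \<Rightarrow> complex) \<Rightarrow> bool" where
  "is_path_eval S \<psi> x \<eta> \<longleftrightarrow> \<eta> \<in> spectrum (lim_diag S \<psi> \<inter> lim_AF S \<psi>) \<and>
     (\<forall>n\<ge>1. \<forall>p\<in>fin_paths S n. \<eta> (ind_cyl S \<psi> p p) = (if initial n x = p then 1 else 0))"

definition anchor ::
  "('x, 'e) ah_system \<Rightarrow> (nat \<Rightarrow> 'x elt \<Rightarrow> 'a::cstar_algebra) \<Rightarrow> ('a \<Rightarrow> complex) \<Rightarrow> (nat \<Rightarrow> 'e edge)" where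
  "anchor S \<psi> \<phi> = (THE x. x \<in> inf_paths S \<and>
     is_path_eval S \<psi> x (restrict \<phi> (lim_diag S \<psi> \<inter> lim_AF S \<psi>)))"

definition act ::
  "('x, 'e) ah_system \<Rightarrow> (nat \<Rightarrow> 'x elt \<Rightarrow> 'a::cstar_algebra) \<Rightarrow>
   (nat \<Rightarrow> 'e edge) \<times> (nat \<Rightarrow> 'e edge) \<Rightarrow> ('a \<Rightarrow> complex) \<Rightarrow> ('a \<Rightarrow> complex)" where
  "act S \<psi> g \<phi> = (THE \<omega>. \<exists>p q. (p, q) \<in> path_pairs S \<and> g \<in> cyl S p q \<and>
     \<omega> = (\<lambda>c\<in>lim_diag S \<psi>. \<phi> (star (ind_cyl S \<psi> p q) * c * ind_cyl S \<psi> p q)))"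

definition transformation_groupoid ::
  "('x, 'e) ah_system \<Rightarrow> (nat \<Rightarrow> 'x elt \<Rightarrow> 'a::cstar_algebra) \<Rightarrow>
   (((nat \<Rightarrow> 'e edge) \<times> (nat \<Rightarrow> 'e edge)) \<times> ('a \<Rightarrow> complex),
    (nat \<Rightarrow> 'e edge) \<times> ('a \<Rightarrow> complex)) top_groupoid" where
  "transformation_groupoid S \<psi> =
     (let G = tail_groupoid S;
          T = {(g, \<phi>). g \<in> arrows G \<and> \<phi> \<in> spectrum (lim_diag S \<psi>) \<and> gsrc G g = anchor S \<psi> \<phi>}
      in \<lparr>arrows = T,
          gsrc = (\<lambda>(g, \<phi>). (gsrc G g, \<phi>)),
          grng = (\<lambda>(g, \<phi>). (grng G g, act S \<psi> g \<phi>)),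
          gcomp = (\<lambda>(h, \<omega>) (g, \<phi>). (gcomp G h g, \<phi>)),
          gtop = subtopology (prod_topology (gtop G) (spectrum_top (lim_diag S \<psi>))) T\<rparr>)"


section \<open>The Weyl groupoid of an inclusion of C*-algebras\<close>

definition normalisers :: "'a::cstar_algebra set \<Rightarrow> 'a set \<Rightarrow> 'a set" where
  "normalisers A C = {m \<in> A. \<forall>c\<in>C. m * c * star m \<in> C \<and> star m * c * m \<in> C}"

definition ndom :: "'a::cstar_algebra set \<Rightarrow> 'a \<Rightarrow> ('a \<Rightarrow> complex) set" where
  "ndom C m = {\<phi> \<in> spectrum C. \<phi> (star m * m) \<noteq> 0}"

definition nran :: "'a::cstar_algebra set \<Rightarrow> 'a \<Rightarrow> ('a \<Rightarrow> complex) set" where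
  "nran C m = ndom C (star m)"

definition alpha :: "'a::cstar_algebra set \<Rightarrow> 'a \<Rightarrow> ('a \<Rightarrow> complex) \<Rightarrow> ('a \<Rightarrow> complex)" where
  "alpha C m = (THE \<alpha>. \<alpha> \<in> extensional (ndom C m) \<and>
     homeomorphic_map (subtopology (spectrum_top C) (ndom C m))
                      (subtopology (spectrum_top C) (nran C m)) \<alpha> \<and>
     (\<forall>f\<in>C. \<forall>\<phi>\<in>ndom C m. \<phi> (star m * f * m) = \<phi> (star m * m) * \<alpha> \<phi> f))"

definition germ_base :: "'a::cstar_algebra set \<Rightarrow> 'a set \<Rightarrow> ('a \<times> ('a \<Rightarrow> complex)) set" where
  "germ_base A C = {(m, \<phi>). m \<in> normalisers A C \<and> \<phi> \<in> ndom C m}"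

definition germ_rel ::
  "'a::cstar_algebra set \<Rightarrow> 'a set \<Rightarrow> (('a \<times> ('a \<Rightarrow> complex)) \<times> ('a \<times> ('a \<Rightarrow> complex))) set" where
  "germ_rel A C = {((m1, \<phi>1), (m2, \<phi>2)).
     (m1, \<phi>1) \<in> germ_base A C \<and> (m2, \<phi>2) \<in> germ_base A C \<and> \<phi>1 = \<phi>2 \<and>
     (\<exists>U. openin (spectrum_top C) U \<and> \<phi>1 \<in> U \<and> U \<subseteq> ndom C m1 \<inter> ndom C m2 \<and>
          (\<forall>\<omega>\<in>U. alpha C m1 \<omega> = alpha C m2 \<omega>))}"

definition germ ::
  "'a::cstar_algebra set \<Rightarrow> 'a set \<Rightarrow> 'a \<Rightarrow> ('a \<Rightarrow> complex) \<Rightarrow> ('a \<times> ('a \<Rightarrow> complex)) set" where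
  "germ A C m \<phi> = germ_rel A C `` {(m, \<phi>)}"

definition weyl_groupoid ::
  "'a::cstar_algebra set \<Rightarrow> 'a set \<Rightarrow> (('a \<times> ('a \<Rightarrow> complex)) set, 'a \<Rightarrow> complex) top_groupoid" where
  "weyl_groupoid A C =
     \<lparr>arrows = germ_base A C // germ_rel A C,
      gsrc = (\<lambda>g. THE \<phi>. \<exists>m. (m, \<phi>) \<in> germ_base A C \<and> g = germ A C m \<phi>),
      grng = (\<lambda>g. THE \<omega>. \<exists>m \<phi>. (m, \<phi>) \<in> germ_base A C \<and> g = germ A C m \<phi> \<and> \<omega> = alpha C m \<phi>),
      gcomp = (\<lambda>g h. THE k. \<exists>m m' \<phi>.
        (m', \<phi>) \<in> germ_base A C \<and> (m, alpha C m' \<phi>) \<in> germ_base A C \<and>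
        g = germ A C m (alpha C m' \<phi>) \<and> h = germ A C m' \<phi> \<and> k = germ A C (m * m') \<phi>),
      gtop = topology_generated_by
        {{germ A C m \<phi> | \<phi>. \<phi> \<in> ndom C m \<inter> U} | m U.
           m \<in> normalisers A C \<and> openin (spectrum_top C) U}\<rparr>"

end

theory Submission
  imports Defs
begin

text \<open>
A normaliser \<open>m\<close> acts on characters by \<open>\<phi> \<mapsto> \<phi> (star m * _ * m) / \<phi> (star m * m)\<close>, and this is
multiplicative because \<open>m * star m\<close> lies in the commutative algebra \<open>C\<close>. The action of a pair of
tail-equivalent paths is the partial homeomorphism of a matrix unit, so the map to the Weyl groupoid is
well defined, multiplicative and injective: the range path is recovered from the range character.
Everything else reduces to showing that near \<open>\<phi>\<close> every normaliser \<open>m\<close> induces the same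
homeomorphism as some matrix unit. Approximate \<open>m\<close> by an element of a finite stage and cut both down
to the corner of the two paths of that length read off from \<open>\<phi>\<close> and its image: the corner of the
approximant is a matrix unit times an element of \<open>C\<close>, so it intertwines the action of \<open>C\<close> exactly
as the matrix unit does, and \<open>m\<close> does so up to a small error. If the two induced homeomorphisms
differed at a nearby character, a unitary of \<open>C\<close> taking the values \<open>1\<close> and \<open>- 1\<close> at the two images
would make this error large.
\<close>

section \<open>Weyl groupoids of unital inclusions\<close>

text \<open>A member of \<open>spectrum\<close> is just a nonzero linear multiplicative functional.
  Boundedness has to be proved, because distinct characters must be told apart on a finite stage;
  compatibility with \<open>star\<close> is bypassed by recording the values of the separating
  unitary and of its adjoint separately. On a finite stage a character is evaluation at a point and
  a diagonal position. The position names a path, which gives the anchor, and the unitary can be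
  written down as a function on the stage. Matrix units are not stable under the connecting maps, so
  that they normalise all of \<open>C\<close> is derived from a larger stable class, the monomial
  elements. For a normaliser \<open>m\<close> the tolerance \<open>\<epsilon>\<close> must be fixed
  before the stage and the paths are known; this is possible because cutting to the corner does not
  change \<open>\<phi> (star m * m)\<close>. The defect \<open>D\<close> of intertwining has norm at
  most \<open>2 * \<epsilon>\<close>, while different images force
  \<open>\<phi> (star D * D) = 4 * \<phi> (star m * m)\<close>, so
  \<open>\<epsilon>\<^sup>2 < cmod (\<phi> (star m * m))\<close> is contradictory. This condition is
  open in \<open>\<phi>\<close> and the approximant is fixed, so one matrix unit serves a whole
  neighbourhood.\<close>

lemma scaleC_minus_one: "scaleC (- 1) (a::'a::cstar_algebra) = - a"
  using scaleC_of_real[of "- 1" a] by simp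

lemma continuous_map_char_eval:
  "c \<in> C \<Longrightarrow> continuous_map (spectrum_top C) euclidean (\<lambda>\<phi>. \<phi> c)"
  unfolding spectrum_top_def
  by (intro continuous_map_from_subtopology continuous_map_product_projection)

lemma topspace_spectrum_top [simp]: "topspace (spectrum_top C) = spectrum C"
  by (auto simp: spectrum_top_def spectrum_def PiE_def)

lemma continuous_map_into_spectrum_top:
  assumes "f \<in> topspace X \<rightarrow> spectrum C"
    and "\<And>c. c \<in> C \<Longrightarrow> continuous_map X euclidean (\<lambda>x. f x c)"
  shows "continuous_map X (spectrum_top C) f"
  unfolding spectrum_top_def continuous_map_in_subtopology continuous_map_componentwise
  using assms by (fastforce simp: spectrum_def)

lemma openin_char_neq_0:
  assumes "c \<in> C" shows "openin (spectrum_top C) {\<phi> \<in> spectrum C. \<phi> c \<noteq> 0}"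
proof -
  have "open (- {0::complex})" by auto
  from openin_continuous_map_preimage[OF continuous_map_char_eval[OF assms], of "- {0}"] this
  show ?thesis by simp
qed

lemma openin_char_norm_gt:
  assumes "c \<in> C" shows "openin (spectrum_top C) {\<phi> \<in> spectrum C. cmod (\<phi> c) > t}"
proof -
  have "open {z. t < cmod z}" by (intro open_Collect_less continuous_intros)
  from openin_continuous_map_preimage[OF continuous_map_char_eval[OF assms], of "{z. t < cmod z}"] this
  show ?thesis by simp
qed

text \<open>The ambient type has no unit, so the unit \<open>e\<close> of \<open>A\<close> is a
  parameter. Where the adjoint of a diagonal element matters, \<open>star c \<in> C\<close> is
  assumed explicitly.\<close>

locale unital_inclusion =
  fixes A C :: "'a::cstar_algebra set" and e :: 'a
  assumes A_mult: "a \<in> A \<Longrightarrow> b \<in> A \<Longrightarrow> a * b \<in> A"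
    and C_sub: "c \<in> C \<Longrightarrow> c \<in> A"
    and C_closed: "closed C"
    and C_add: "c \<in> C \<Longrightarrow> d \<in> C \<Longrightarrow> c + d \<in> C"
    and C_mult: "c \<in> C \<Longrightarrow> d \<in> C \<Longrightarrow> c * d \<in> C"
    and C_scale: "c \<in> C \<Longrightarrow> scaleC z c \<in> C"
    and C_comm: "c \<in> C \<Longrightarrow> d \<in> C \<Longrightarrow> c * d = d * c"
    and unit_in: "e \<in> C"
    and star_unit: "star e = e"
    and unit_left: "a \<in> A \<Longrightarrow> e * a = a"
    and unit_right: "a \<in> A \<Longrightarrow> a * e = a"
begin

lemma C_minus: "c \<in> C \<Longrightarrow> - c \<in> C"
  using C_scale[of c "- 1"] by (simp add: scaleC_minus_one)

lemma C_diff: "c \<in> C \<Longrightarrow> d \<in> C \<Longrightarrow> c - d \<in> C"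
  using C_add[of c "- d"] C_minus by simp

context
  fixes \<phi> assumes \<phi>: "\<phi> \<in> spectrum C"
begin

lemma char_add: "c \<in> C \<Longrightarrow> d \<in> C \<Longrightarrow> \<phi> (c + d) = \<phi> c + \<phi> d"
  and char_mult: "c \<in> C \<Longrightarrow> d \<in> C \<Longrightarrow> \<phi> (c * d) = \<phi> c * \<phi> d"
  and char_scale: "c \<in> C \<Longrightarrow> \<phi> (scaleC z c) = z * \<phi> c"
  and char_extensional: "\<phi> \<in> extensional C"
  using \<phi> by (auto simp: spectrum_def)

lemma char_minus: "c \<in> C \<Longrightarrow> \<phi> (- c) = - \<phi> c"
  using char_scale[of c "- 1"] by (simp add: scaleC_minus_one)

lemma char_diff: "c \<in> C \<Longrightarrow> d \<in> C \<Longrightarrow> \<phi> (c - d) = \<phi> c - \<phi> d"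
  using char_add[of c "- d"] char_minus[of d] C_minus[of d] by simp

lemma char_unit: "\<phi> e = 1"
proof -
  obtain a where "a \<in> C" "\<phi> a \<noteq> 0" using \<phi> by (auto simp: spectrum_def)
  then show ?thesis using char_mult[OF unit_in, of a] unit_left[of a] C_sub by simp
qed

text \<open>If \<open>\<phi> a = 1\<close> and \<open>\<parallel>a\<parallel> < 1\<close>, then \<open>b = a + a b\<close> has a solution \<open>b\<close>, but
  applying \<open>\<phi>\<close> to it gives \<open>0 = 1\<close>.\<close>

lemma char_norm_le:
  assumes "c \<in> C" shows "cmod (\<phi> c) \<le> norm c"
proof (rule ccontr)
  assume "\<not> ?thesis"
  then have lt: "norm c < cmod (\<phi> c)" by simp
  then have nz: "\<phi> c \<noteq> 0" by (metis norm_not_less_zero norm_zero)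
  define a where "a = scaleC (inverse (\<phi> c)) c"
  have a: "a \<in> C" and \<phi>a: "\<phi> a = 1"
    using assms nz by (simp_all add: a_def C_scale char_scale)
  have na: "norm a < 1"
    using lt nz by (simp add: a_def norm_scaleC norm_inverse norm_divide divide_simps)
  \<comment> \<open>The fixed point is the series of all powers of \<open>a\<close> from the first
    on, obtained by contraction on the complete set \<open>C\<close> instead of by
    summation.\<close>
  have "\<exists>!b. b \<in> C \<and> a + a * b = b"
  proof (rule Banach_fix[where c = "norm a"])
    show "complete C" using C_closed by (simp add: complete_eq_closed)
    show "dist (a + a * x) (a + a * y) \<le> norm a * dist x y" if "x \<in> C" "y \<in> C" for x y
      by (metis add_diff_cancel_left dist_norm norm_mult_ineq right_diff_distrib)
  qed (use a na C_add C_mult in auto)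
  then obtain b where "b \<in> C" "a + a * b = b" by blast
  then show False using char_add[of a "a * b"] char_mult[of a b] a \<phi>a C_mult by auto
qed

end

section \<open>Normalisers and their partial homeomorphisms\<close>

lemma normaliserD:
  assumes "m \<in> normalisers A C"
  shows "m \<in> A" "c \<in> C \<Longrightarrow> m * c * star m \<in> C" "c \<in> C \<Longrightarrow> star m * c * m \<in> C"
    "star m * m \<in> C" "m * star m \<in> C"
proof -
  show m: "m \<in> A" and "c \<in> C \<Longrightarrow> m * c * star m \<in> C" and "c \<in> C \<Longrightarrow> star m * c * m \<in> C"
    using assms by (auto simp: normalisers_def)
  have "star m * e * m \<in> C" "m * e * star m \<in> C"
    using assms unit_in by (auto simp: normalisers_def)
  then show "star m * m \<in> C" "m * star m \<in> C"
    using unit_left[OF m] unit_right[OF m] by (simp_all add: mult.assoc)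
qed

lemma normalisers_mult:
  assumes "m \<in> normalisers A C" "m' \<in> normalisers A C"
  shows "m * m' \<in> normalisers A C"
proof -
  have "m * m' * c * star (m * m') = m * (m' * c * star m') * star m"
    "star (m * m') * c * (m * m') = star m' * (star m * c * m) * m'" for c
    by (simp_all add: star_mult mult.assoc)
  then show ?thesis using normaliserD[OF assms(1)] normaliserD[OF assms(2)] A_mult
    by (auto simp: normalisers_def)
qed

text \<open>The equation that characterises \<open>alpha\<close>, solved for the image character. It
  has a meaning on \<open>ndom C m\<close> only, where the denominator is nonzero; hence the
  restriction in \<open>alpha_eq\<close>.\<close>

definition conj_char :: "'a \<Rightarrow> ('a \<Rightarrow> complex) \<Rightarrow> 'a \<Rightarrow> complex" where
  "conj_char m \<phi> = (\<lambda>c\<in>C. \<phi> (star m * c * m) / \<phi> (star m * m))"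

text \<open>Everything below holds for \<open>m\<close> and \<open>star m\<close> alike, although \<open>star m\<close> need not be known
  to lie in \<open>A\<close>.\<close>

definition weak_normaliser :: "'a \<Rightarrow> bool" where
  "weak_normaliser m \<longleftrightarrow> (\<forall>c\<in>C. m * c * star m \<in> C \<and> star m * c * m \<in> C) \<and>
     m * star m \<in> C \<and> star m * m \<in> C \<and> e * m = m \<and> m * e = m"

lemma weak_normaliser: "m \<in> normalisers A C \<Longrightarrow> weak_normaliser m"
  using normaliserD[of m] unit_left unit_right by (auto simp: weak_normaliser_def)

lemma weak_normaliser_star: "weak_normaliser m \<Longrightarrow> weak_normaliser (star m)"
  using star_mult[of e m] star_mult[of m e]
  by (auto simp: weak_normaliser_def star_star star_unit)

text \<open>Stated without division, so that it also speaks about characters outside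
  \<open>ndom C m\<close>.\<close>

lemma conj_char_multiplicative:
  assumes m: "weak_normaliser m" and \<phi>: "\<phi> \<in> spectrum C" and c: "c \<in> C" "d \<in> C"
  shows "\<phi> (star m * c * m) * \<phi> (star m * d * m) = \<phi> (star m * (c * d) * m) * \<phi> (star m * m)"
proof -
  have in_C: "star m * c * m \<in> C" "star m * d * m \<in> C" "star m * (c * d) * m \<in> C"
    "star m * m \<in> C" "m * star m \<in> C"
    using m c C_mult by (auto simp: weak_normaliser_def)
  have "star m * c * m * (star m * d * m) = star m * c * ((m * star m) * d) * m"
    by (simp add: mult.assoc)
  also have "\<dots> = star m * c * (d * (m * star m)) * m"
    using C_comm[of "m * star m" d] in_C c by simp
  also have "\<dots> = star m * (c * d) * m * (star m * m)"
    by (simp add: mult.assoc)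
  finally show ?thesis
    using char_mult[OF \<phi>] in_C by metis
qed

lemma conj_char_in_ndom:
  assumes m: "weak_normaliser m" and \<phi>: "\<phi> \<in> ndom C m"
  shows "conj_char m \<phi> \<in> nran C m"
proof -
  have sp: "\<phi> \<in> spectrum C" and nz: "\<phi> (star m * m) \<noteq> 0" using \<phi> by (auto simp: ndom_def)
  have in_C: "c \<in> C \<Longrightarrow> star m * c * m \<in> C" for c
    using m by (auto simp: weak_normaliser_def)
  have mm: "star m * m \<in> C" "m * star m \<in> C" and me: "star m * e * m = star m * m"
    using m by (auto simp: weak_normaliser_def mult.assoc)
  have "conj_char m \<phi> e = 1"
    using nz by (simp add: conj_char_def unit_in me)
  moreover have "conj_char m \<phi> (c + d) = conj_char m \<phi> c + conj_char m \<phi> d"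
    if "c \<in> C" "d \<in> C" for c d
    using that in_C
    by (simp add: conj_char_def C_add char_add[OF sp] distrib_left distrib_right add_divide_distrib)
  moreover have "conj_char m \<phi> (c * d) = conj_char m \<phi> c * conj_char m \<phi> d"
    if "c \<in> C" "d \<in> C" for c d
    using that nz conj_char_multiplicative[OF m sp that]
    by (simp add: conj_char_def C_mult field_simps)
  moreover have "conj_char m \<phi> (scaleC z c) = z * conj_char m \<phi> c" if "c \<in> C" for z c
    using that in_C char_scale[OF sp, of "star m * c * m" z]
    by (simp add: conj_char_def C_scale mult_scaleC_left mult_scaleC_right)
  moreover have "conj_char m \<phi> \<in> extensional C" by (simp add: conj_char_def)
  ultimately have "conj_char m \<phi> \<in> spectrum C"
    using unit_in by (force simp: spectrum_def)
  moreover have "conj_char m \<phi> (m * star m) \<noteq> 0"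
  proof -
    have "star m * (m * star m) * m = (star m * m) * (star m * m)" by (simp add: mult.assoc)
    then have "conj_char m \<phi> (m * star m) = \<phi> (star m * m)"
      using mm char_mult[OF sp mm(1) mm(1)] nz by (simp add: conj_char_def)
    then show ?thesis using nz by simp
  qed
  ultimately show ?thesis by (simp add: nran_def ndom_def star_star)
qed

text \<open>The inner denominators cancel, and \<open>\<phi>\<close> splits over
  \<open>(star m * m) * (c * (star m * m))\<close>, whose factors all lie in \<open>C\<close>; what
  remains is \<open>\<phi> c\<close>.\<close>

lemma conj_char_inverse:
  assumes m: "weak_normaliser m" and \<phi>: "\<phi> \<in> ndom C m"
  shows "conj_char (star m) (conj_char m \<phi>) = \<phi>"
proof
  fix c
  have sp: "\<phi> \<in> spectrum C" and nz: "\<phi> (star m * m) \<noteq> 0" using \<phi> by (auto simp: ndom_def)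
  have mm: "star m * m \<in> C" "m * star m \<in> C"
    using m by (auto simp: weak_normaliser_def)
  show "conj_char (star m) (conj_char m \<phi>) c = \<phi> c"
  proof (cases "c \<in> C")
    case True
    have "m * c * star m \<in> C" using m True by (auto simp: weak_normaliser_def)
    moreover have "star m * (m * c * star m) * m = (star m * m) * (c * (star m * m))"
      "star m * (m * star m) * m = (star m * m) * (star m * m)" by (simp_all add: mult.assoc)
    ultimately show ?thesis
      using True mm nz C_mult by (simp add: conj_char_def star_star char_mult[OF sp])
  next
    case False
    then show ?thesis using char_extensional[OF sp] by (simp add: conj_char_def extensional_def)
  qed
qed

lemma conj_char_continuous:
  assumes m: "weak_normaliser m"
  shows "continuous_map (subtopology (spectrum_top C) (ndom C m))
           (subtopology (spectrum_top C) (nran C m)) (conj_char m)"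
proof -
  let ?X = "subtopology (spectrum_top C) (ndom C m)"
  have top: "topspace ?X = ndom C m" by (auto simp: ndom_def)
  have ev: "continuous_map ?X euclidean (\<lambda>\<phi>. \<phi> c)" if "c \<in> C" for c
    by (intro continuous_map_from_subtopology continuous_map_char_eval that)
  have "continuous_map ?X (spectrum_top C) (conj_char m)"
  proof (rule continuous_map_into_spectrum_top)
    show "conj_char m \<in> topspace ?X \<rightarrow> spectrum C"
      using conj_char_in_ndom[OF m] unfolding top by (auto simp: nran_def ndom_def)
    fix c assume c: "c \<in> C"
    have "star m * c * m \<in> C" "star m * m \<in> C" using m c by (auto simp: weak_normaliser_def)
    from this[THEN ev] have "continuous_map ?X euclidean (\<lambda>\<phi>. \<phi> (star m * c * m) / \<phi> (star m * m))"
      unfolding continuous_map_atin by (auto simp: ndom_def intro!: tendsto_divide)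
    then show "continuous_map ?X euclidean (\<lambda>\<phi>. conj_char m \<phi> c)"
      using c by (simp add: conj_char_def)
  qed
  then show ?thesis
    unfolding continuous_map_in_subtopology top using conj_char_in_ndom[OF m] by auto
qed

lemma conj_char_homeomorphic:
  assumes m: "weak_normaliser m"
  shows "homeomorphic_map (subtopology (spectrum_top C) (ndom C m))
           (subtopology (spectrum_top C) (nran C m)) (conj_char m)"
proof -
  have inv: "conj_char (star m) (conj_char m \<phi>) = \<phi>" if "\<phi> \<in> ndom C m" for \<phi>
    using conj_char_inverse m that by blast
  have inv': "conj_char m (conj_char (star m) \<phi>) = \<phi>" if "\<phi> \<in> nran C m" for \<phi>
    using conj_char_inverse[OF weak_normaliser_star[OF m], of \<phi>] that by (simp add: nran_def star_star)
  show ?thesis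
    unfolding homeomorphic_map_maps homeomorphic_maps_def
    using conj_char_continuous[OF m] conj_char_continuous[OF weak_normaliser_star[OF m]] inv inv'
    by (intro exI[of _ "conj_char (star m)"]) (simp add: nran_def star_star)
qed

lemma alpha_eq:
  assumes "m \<in> normalisers A C"
  shows "alpha C m = restrict (conj_char m) (ndom C m)"
  unfolding alpha_def
proof (rule the_equality, intro conjI ballI)
  have m: "weak_normaliser m" using assms by (rule weak_normaliser)
  let ?X = "subtopology (spectrum_top C) (ndom C m)"
  let ?Y = "subtopology (spectrum_top C) (nran C m)"
  have top: "topspace ?X = ndom C m" "topspace ?Y = nran C m" by (auto simp: ndom_def nran_def)
  show "homeomorphic_map ?X ?Y (restrict (conj_char m) (ndom C m))"
    by (rule homeomorphic_map_eq[OF conj_char_homeomorphic[OF m]]) (auto simp: ndom_def)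
  show "\<phi> (star m * f * m) = \<phi> (star m * m) * restrict (conj_char m) (ndom C m) \<phi> f"
    if "f \<in> C" "\<phi> \<in> ndom C m" for f \<phi>
    using that by (simp add: conj_char_def ndom_def)
  fix \<alpha> assume \<alpha>: "\<alpha> \<in> extensional (ndom C m) \<and> homeomorphic_map ?X ?Y \<alpha> \<and>
    (\<forall>f\<in>C. \<forall>\<phi>\<in>ndom C m. \<phi> (star m * f * m) = \<phi> (star m * m) * \<alpha> \<phi> f)"
  \<comment> \<open>The equation fixes \<open>\<alpha> \<phi>\<close> on \<open>C\<close> only. That
    \<open>\<alpha>\<close> maps into \<open>nran C m\<close> makes \<open>\<alpha> \<phi>\<close> a
    character, hence extensional, which settles its values off \<open>C\<close>.\<close>
  have "\<alpha> ` ndom C m = nran C m"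
    using homeomorphic_imp_surjective_map[of ?X ?Y \<alpha>] \<alpha> by (simp only: top)
  then have ext: "\<alpha> \<phi> \<in> extensional C" if "\<phi> \<in> ndom C m" for \<phi>
    using that by (auto simp: nran_def ndom_def spectrum_def)
  have "\<alpha> \<phi> = conj_char m \<phi>" if "\<phi> \<in> ndom C m" for \<phi>
  proof (rule extensionalityI[OF ext[OF that], of "conj_char m \<phi>"])
    show "\<alpha> \<phi> c = conj_char m \<phi> c" if c: "c \<in> C" for c
    proof -
      have "\<phi> (star m * c * m) = \<phi> (star m * m) * \<alpha> \<phi> c"
        using \<alpha> c \<open>\<phi> \<in> ndom C m\<close> by blast
      then show ?thesis using c \<open>\<phi> \<in> ndom C m\<close> by (simp add: conj_char_def ndom_def)
    qed
  qed (simp add: conj_char_def)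
  then show "\<alpha> = restrict (conj_char m) (ndom C m)"
    using \<alpha> by (auto intro!: extensionalityI[of \<alpha> "ndom C m"])
qed simp

lemma alpha_apply:
  assumes "m \<in> normalisers A C" "\<phi> \<in> ndom C m" "c \<in> C"
  shows "alpha C m \<phi> c = \<phi> (star m * c * m) / \<phi> (star m * m)"
  using assms by (simp add: alpha_eq conj_char_def)

lemma alpha_in_nran:
  assumes "m \<in> normalisers A C" "\<phi> \<in> ndom C m"
  shows "alpha C m \<phi> \<in> nran C m" "alpha C m \<phi> \<in> spectrum C"
  using conj_char_in_ndom[OF weak_normaliser[OF assms(1)] assms(2)] assms
  by (auto simp: alpha_eq nran_def ndom_def)

lemma alpha_continuous:
  assumes "m \<in> normalisers A C"
  shows "continuous_map (subtopology (spectrum_top C) (ndom C m)) (spectrum_top C) (alpha C m)"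
proof -
  have "continuous_map (subtopology (spectrum_top C) (ndom C m)) (spectrum_top C) (conj_char m)"
    using conj_char_continuous[OF weak_normaliser[OF assms]] by (simp add: continuous_map_in_subtopology)
  then show ?thesis
    by (rule continuous_map_eq) (auto simp: alpha_eq[OF assms])
qed

lemma ndom_open: "m \<in> normalisers A C \<Longrightarrow> openin (spectrum_top C) (ndom C m)"
  unfolding ndom_def using normaliserD(4) openin_char_neq_0 by blast

lemma alpha_preimage_open:
  assumes "m \<in> normalisers A C" "openin (spectrum_top C) U"
  shows "openin (spectrum_top C) {\<phi> \<in> ndom C m. alpha C m \<phi> \<in> U}"
proof -
  have "ndom C m \<subseteq> spectrum C" by (auto simp: ndom_def)
  with openin_continuous_map_preimage[OF alpha_continuous[OF assms(1)] assms(2)]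
  show ?thesis using ndom_open[OF assms(1)]
    by (auto simp: openin_open_subtopology Int_absorb1)
qed

lemma spectrum_eqI:
  assumes "\<phi> \<in> spectrum C" "\<omega> \<in> spectrum C" "\<And>c. c \<in> C \<Longrightarrow> \<phi> c = \<omega> c"
  shows "\<phi> = \<omega>"
  using extensionalityI[of \<phi> C \<omega>] assms char_extensional by blast

lemma ndom_mult_iff:
  assumes "m \<in> normalisers A C" "m' \<in> normalisers A C"
  shows "\<phi> \<in> ndom C (m * m') \<longleftrightarrow> \<phi> \<in> ndom C m' \<and> alpha C m' \<phi> \<in> ndom C m"
proof -
  have in_C: "star m * m \<in> C" "star m' * m' \<in> C" "star m' * (star m * m) * m' \<in> C"
    using assms normaliserD by auto
  have eq: "star (m * m') * (m * m') = star m' * (star m * m) * m'"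
    by (simp add: star_mult mult.assoc)
  \<comment> \<open>If this value were zero, \<open>conj_char_multiplicative\<close> with both
    elements equal to \<open>star m * m\<close> would make the square of
    \<open>\<phi> (star m' * (star m * m) * m')\<close> vanish.\<close>
  have "\<phi> (star m' * m') \<noteq> 0" if "\<phi> \<in> spectrum C" "\<phi> (star m' * (star m * m) * m') \<noteq> 0"
    using conj_char_multiplicative[OF weak_normaliser[OF assms(2)] that(1) in_C(1) in_C(1)] that(2)
    by auto
  then show ?thesis
    using alpha_apply[OF assms(2) _ in_C(1), of \<phi>] alpha_in_nran(2)[OF assms(2), of \<phi>]
    unfolding ndom_def eq by auto
qed

lemma alpha_mult:
  assumes "m \<in> normalisers A C" "m' \<in> normalisers A C" "\<phi> \<in> ndom C (m * m')"
  shows "alpha C (m * m') \<phi> = alpha C m (alpha C m' \<phi>)"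
proof (rule spectrum_eqI)
  have dom: "\<phi> \<in> ndom C m'" "alpha C m' \<phi> \<in> ndom C m" using ndom_mult_iff assms by auto
  note mm = normalisers_mult[OF assms(1,2)]
  show "alpha C (m * m') \<phi> \<in> spectrum C" by (rule alpha_in_nran(2)[OF mm assms(3)])
  show "alpha C m (alpha C m' \<phi>) \<in> spectrum C" by (rule alpha_in_nran(2)[OF assms(1) dom(2)])
  fix c assume c: "c \<in> C"
  have in_C: "star m * m \<in> C" "star m * c * m \<in> C" using normaliserD[OF assms(1)] c by auto
  have eq: "star (m * m') * c * (m * m') = star m' * (star m * c * m) * m'"
    "star (m * m') * (m * m') = star m' * (star m * m) * m'"
    by (simp_all add: star_mult mult.assoc)
  have nz: "\<phi> (star m' * m') \<noteq> 0" using dom by (simp add: ndom_def)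
  show "alpha C (m * m') \<phi> c = alpha C m (alpha C m' \<phi>) c"
    by (simp add: alpha_apply[OF mm assms(3) c] alpha_apply[OF assms(1) dom(2) c]
        alpha_apply[OF assms(2) dom(1)] in_C eq nz)
qed

lemma diagonal_normaliser:
  assumes "c \<in> C" "star c \<in> C"
  shows "c \<in> normalisers A C"
  using assms C_sub C_mult by (auto simp: normalisers_def)

text \<open>By multiplicativity \<open>\<phi> (star c * f * c)\<close> is
  \<open>\<phi> (star c * c) * \<phi> f\<close>. So a factor from \<open>C\<close> only shrinks the
  domain of a normaliser and leaves its action alone.\<close>

lemma alpha_diagonal:
  assumes c: "c \<in> C" "star c \<in> C" and \<phi>: "\<phi> \<in> ndom C c"
  shows "alpha C c \<phi> = \<phi>"
proof (rule spectrum_eqI)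
  note cn = diagonal_normaliser[OF c]
  show sp: "\<phi> \<in> spectrum C" using \<phi> by (simp add: ndom_def)
  show "alpha C c \<phi> \<in> spectrum C" by (rule alpha_in_nran[OF cn \<phi>])
  show "alpha C c \<phi> f = \<phi> f" if "f \<in> C" for f
    using \<phi> c that C_mult by (simp add: alpha_apply[OF cn \<phi> that] char_mult[OF sp] ndom_def)
qed

section \<open>Germs and the operations of the Weyl groupoid\<close>

lemma equiv_germ_rel: "equiv (germ_base A C) (germ_rel A C)"
proof (rule equivI)
  show "germ_rel A C \<subseteq> germ_base A C \<times> germ_base A C" by (auto simp: germ_rel_def)
  show "refl_on (germ_base A C) (germ_rel A C)"
    using ndom_open unfolding refl_on_def germ_rel_def germ_base_def by fastforce
  show "sym (germ_rel A C)"
    unfolding sym_def germ_rel_def by (simp, metis inf_commute)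
  show "trans (germ_rel A C)"
  proof (rule transI)
    fix u v w assume "(u, v) \<in> germ_rel A C" "(v, w) \<in> germ_rel A C"
    moreover obtain m1 m2 m3 \<phi>1 \<phi>2 \<phi>3 where "u = (m1, \<phi>1)" "v = (m2, \<phi>2)" "w = (m3, \<phi>3)"
      by (metis surj_pair)
    ultimately show "(u, w) \<in> germ_rel A C"
      unfolding germ_rel_def
      by (clarsimp, rename_tac U V, rule_tac x = "U \<inter> V" in exI) auto
  qed
qed

lemma germ_in_arrows: "(m, \<phi>) \<in> germ_base A C \<Longrightarrow> germ A C m \<phi> \<in> arrows (weyl_groupoid A C)"
  by (simp add: weyl_groupoid_def germ_def quotientI)

lemma weyl_arrowE:
  assumes "g \<in> arrows (weyl_groupoid A C)"
  obtains m \<phi> where "(m, \<phi>) \<in> germ_base A C" "g = germ A C m \<phi>"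
  using assms by (auto simp: weyl_groupoid_def germ_def elim!: quotientE)

lemma germ_eq_iff:
  assumes "(m1, \<phi>1) \<in> germ_base A C" "(m2, \<phi>2) \<in> germ_base A C"
  shows "germ A C m1 \<phi>1 = germ A C m2 \<phi>2 \<longleftrightarrow> \<phi>1 = \<phi>2 \<and>
    (\<exists>U. openin (spectrum_top C) U \<and> \<phi>1 \<in> U \<and> U \<subseteq> ndom C m1 \<inter> ndom C m2 \<and>
      (\<forall>\<omega>\<in>U. alpha C m1 \<omega> = alpha C m2 \<omega>))"
  unfolding germ_def eq_equiv_class_iff[OF equiv_germ_rel assms]
  using assms by (simp add: germ_rel_def)

lemma germ_eqD:
  assumes "(m1, \<phi>1) \<in> germ_base A C" "(m2, \<phi>2) \<in> germ_base A C" "germ A C m1 \<phi>1 = germ A C m2 \<phi>2"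
  shows "\<phi>1 = \<phi>2" "alpha C m1 \<phi>1 = alpha C m2 \<phi>2"
  using assms germ_eq_iff by auto

lemma weyl_src:
  assumes "(m, \<phi>) \<in> germ_base A C"
  shows "gsrc (weyl_groupoid A C) (germ A C m \<phi>) = \<phi>"
  unfolding weyl_groupoid_def top_groupoid.simps
  by (rule the_equality) (use assms in \<open>blast dest: germ_eqD\<close>)+

lemma weyl_rng:
  assumes "(m, \<phi>) \<in> germ_base A C"
  shows "grng (weyl_groupoid A C) (germ A C m \<phi>) = alpha C m \<phi>"
  unfolding weyl_groupoid_def top_groupoid.simps
  by (rule the_equality) (use assms in \<open>blast dest: germ_eqD\<close>)+

lemma germ_base_mult:
  assumes "(m', \<phi>) \<in> germ_base A C" "(m, alpha C m' \<phi>) \<in> germ_base A C"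
  shows "(m * m', \<phi>) \<in> germ_base A C"
  using assms by (auto simp: germ_base_def normalisers_mult ndom_mult_iff)

text \<open>The description in \<open>gcomp\<close> ranges over all representatives of both germs,
  so the content is that the germ of the product does not depend on them.\<close>

lemma weyl_comp:
  assumes "(m', \<phi>) \<in> germ_base A C" "(m, alpha C m' \<phi>) \<in> germ_base A C"
  shows "gcomp (weyl_groupoid A C) (germ A C m (alpha C m' \<phi>)) (germ A C m' \<phi>) = germ A C (m * m') \<phi>"
proof -
  have "germ A C (m * m') \<phi> = germ A C (n * n') \<omega>"
    if n: "(n', \<omega>) \<in> germ_base A C" "(n, alpha C n' \<omega>) \<in> germ_base A C"
      and eq: "germ A C m (alpha C m' \<phi>) = germ A C n (alpha C n' \<omega>)" "germ A C m' \<phi> = germ A C n' \<omega>"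
    for n n' \<omega>
  proof -
    have [simp]: "\<omega> = \<phi>" using germ_eqD(1)[OF assms(1) n(1) eq(2)] by simp
    have nm: "m \<in> normalisers A C" "m' \<in> normalisers A C" "n \<in> normalisers A C" "n' \<in> normalisers A C"
      using assms n by (auto simp: germ_base_def)
    obtain U where U: "openin (spectrum_top C) U" "\<phi> \<in> U" "U \<subseteq> ndom C m' \<inter> ndom C n'"
      "\<forall>\<omega>\<in>U. alpha C m' \<omega> = alpha C n' \<omega>"
      using eq(2) germ_eq_iff[OF assms(1) n(1)] by auto
    obtain V where V: "openin (spectrum_top C) V" "alpha C m' \<phi> \<in> V" "V \<subseteq> ndom C m \<inter> ndom C n"
      "\<forall>\<omega>\<in>V. alpha C m \<omega> = alpha C n \<omega>"
      using eq(1) germ_eq_iff[OF assms(2) n(2)] by auto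
    \<comment> \<open>The representatives of the left germ agree only around the image of
      \<open>\<phi>\<close>, so that neighbourhood is pulled back along
      \<open>alpha C m'\<close>.\<close>
    let ?W = "U \<inter> {\<theta> \<in> ndom C m'. alpha C m' \<theta> \<in> V}"
    have W: "openin (spectrum_top C) ?W" using U V nm alpha_preimage_open by blast
    have "\<phi> \<in> ?W" using U V by auto
    moreover have "?W \<subseteq> ndom C (m * m') \<inter> ndom C (n * n')"
      using U V nm by (auto simp: ndom_mult_iff)
    moreover have "alpha C (m * m') \<theta> = alpha C (n * n') \<theta>" if "\<theta> \<in> ?W" for \<theta>
    proof -
      have "\<theta> \<in> ndom C (m * m')" "\<theta> \<in> ndom C (n * n')" using calculation(2) that by auto
      then show ?thesis using that U V by (auto simp: alpha_mult nm)
    qed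
    ultimately show ?thesis
      using W germ_eq_iff[OF germ_base_mult[OF assms] germ_base_mult[OF n]] by auto
  qed
  then show ?thesis
    using assms unfolding weyl_groupoid_def top_groupoid.simps
    by (intro the_equality) blast+
qed

text \<open>The factor \<open>c\<close> fixes every character of its domain, so the two
  homeomorphisms agree on all of \<open>ndom C (m * c)\<close>, which is open and serves as the
  neighbourhood.\<close>

lemma germ_mult_diagonal:
  assumes m: "m \<in> normalisers A C" and c: "c \<in> C" "star c \<in> C" and \<phi>: "\<phi> \<in> ndom C (m * c)"
  shows "germ A C (m * c) \<phi> = germ A C m \<phi>" "\<phi> \<in> ndom C m"
proof -
  note cn = diagonal_normaliser[OF c] and mc = normalisers_mult[OF m diagonal_normaliser[OF c]]
  have dom: "\<omega> \<in> ndom C m" if "\<omega> \<in> ndom C (m * c)" for \<omega>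
    using ndom_mult_iff[OF m cn, of \<omega>] alpha_diagonal[OF c, of \<omega>] that by auto
  then show "\<phi> \<in> ndom C m" using \<phi> .
  show "germ A C (m * c) \<phi> = germ A C m \<phi>"
  proof (subst germ_eq_iff)
    show "\<phi> = \<phi> \<and> (\<exists>U. openin (spectrum_top C) U \<and> \<phi> \<in> U \<and> U \<subseteq> ndom C (m * c) \<inter> ndom C m \<and>
        (\<forall>\<omega>\<in>U. alpha C (m * c) \<omega> = alpha C m \<omega>))"
    proof (intro conjI exI[of _ "ndom C (m * c)"] ballI)
      show "alpha C (m * c) \<omega> = alpha C m \<omega>" if "\<omega> \<in> ndom C (m * c)" for \<omega>
        using alpha_mult[OF m cn that] alpha_diagonal[OF c] ndom_mult_iff[OF m cn] that by simp
    qed (use ndom_open[OF mc] \<phi> dom in auto)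
  qed (use \<phi> m mc dom in \<open>auto simp: germ_base_def\<close>)
qed

lemma germ_diagonal_mult:
  assumes m: "m \<in> normalisers A C" and c: "c \<in> C" "star c \<in> C" and \<phi>: "\<phi> \<in> ndom C (c * m)"
  shows "germ A C (c * m) \<phi> = germ A C m \<phi>" "\<phi> \<in> ndom C m"
proof -
  note cn = diagonal_normaliser[OF c] and cm = normalisers_mult[OF diagonal_normaliser[OF c] m]
  show "\<phi> \<in> ndom C m" using ndom_mult_iff[OF cn m, of \<phi>] \<phi> by auto
  show "germ A C (c * m) \<phi> = germ A C m \<phi>"
  proof (subst germ_eq_iff)
    show "\<phi> = \<phi> \<and> (\<exists>U. openin (spectrum_top C) U \<and> \<phi> \<in> U \<and> U \<subseteq> ndom C (c * m) \<inter> ndom C m \<and>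
        (\<forall>\<omega>\<in>U. alpha C (c * m) \<omega> = alpha C m \<omega>))"
    proof (intro conjI exI[of _ "ndom C (c * m)"] ballI)
      show "alpha C (c * m) \<omega> = alpha C m \<omega>" if "\<omega> \<in> ndom C (c * m)" for \<omega>
        using alpha_mult[OF cn m that] alpha_diagonal[OF c] ndom_mult_iff[OF cn m] that by simp
    qed (use ndom_open[OF cm] \<phi> ndom_mult_iff[OF cn m] in auto)
  qed (use \<phi> m cm \<open>\<phi> \<in> ndom C m\<close> in \<open>auto simp: germ_base_def\<close>)
qed

text \<open>With \<open>d = m (star w u w) - u m\<close> one finds
  \<open>\<phi> (star d * d) = \<phi> (star m * m) (\<beta> (star u) - \<alpha> (star u)) (\<beta> u - \<alpha> u)\<close>, where \<open>\<alpha>\<close> and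
  \<open>\<beta>\<close> are the images of \<open>\<phi>\<close> under \<open>m\<close> and \<open>w\<close>.\<close>

lemma almost_intertwiner_bound:
  assumes m: "m \<in> normalisers A C" "\<phi> \<in> ndom C m"
    and w: "w \<in> normalisers A C" "\<phi> (star w * w) = 1"
    and u: "u \<in> C" "star u \<in> C" "u * star u = e" "star u * u = e"
    and \<alpha>: "alpha C m \<phi> u = 1" "alpha C m \<phi> (star u) = 1"
    and \<beta>: "alpha C w \<phi> u = - 1" "alpha C w \<phi> (star u) = - 1"
    and d: "norm (m * (star w * u * w) - u * m) \<le> 2 * \<epsilon>"
  shows "cmod (\<phi> (star m * m)) \<le> \<epsilon>\<^sup>2"
proof -
  have sp: "\<phi> \<in> spectrum C" using m by (simp add: ndom_def)
  have nz: "\<phi> (star m * m) \<noteq> 0" using m by (simp add: ndom_def)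
  have wdom: "\<phi> \<in> ndom C w" using sp w by (simp add: ndom_def)
  define h where "h = star w * u * w"
  define k where "k = star w * star u * w"
  have star_h: "star h = k" by (simp add: h_def k_def star_mult star_star mult.assoc)
  have hC: "h \<in> C" and kC: "k \<in> C" using normaliserD[OF w(1)] u by (auto simp: h_def k_def)
  have \<phi>h: "\<phi> h = - 1" and \<phi>k: "\<phi> k = - 1"
    using alpha_apply[OF w(1) wdom u(1)] alpha_apply[OF w(1) wdom u(2)] \<beta> w(2)
    by (simp_all add: h_def k_def)
  have mu: "\<phi> (star m * u * m) = \<phi> (star m * m)" "\<phi> (star m * star u * m) = \<phi> (star m * m)"
    using alpha_apply[OF m u(1)] alpha_apply[OF m u(2)] \<alpha> nz by auto
  define D where "D = m * h - u * m"
  have sD: "star D * D = k * (star m * m) * h - k * (star m * u * m) - (star m * star u * m) * h + star m * m"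
  proof -
    have star_diff: "star (a - b) = star a - star b" for a b :: 'a
      by (metis add_diff_cancel diff_add_cancel star_add)
    have "star m * star u * (u * m) = star m * m"
      using u(4) unit_left[OF normaliserD(1)[OF m(1)]] by (metis mult.assoc)
    then show ?thesis
      unfolding D_def star_diff star_mult star_h by (simp add: algebra_simps)
  qed
  have in_C: "star m * m \<in> C" "star m * u * m \<in> C" "star m * star u * m \<in> C"
    using normaliserD[OF m(1)] u by auto
  have "star D * D \<in> C" unfolding sD
    by (intro C_add C_diff C_mult in_C hC kC)
  \<comment> \<open>Each of the four terms contributes \<open>\<phi> (star m * m)\<close>, since the
    values \<open>- 1\<close> at \<open>h\<close> and \<open>k\<close> cancel all minus signs. The
    resulting 4 is the square of the 2 in the bound on \<open>norm D\<close>.\<close>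
  moreover have "\<phi> (star D * D) = 4 * \<phi> (star m * m)"
    unfolding sD using in_C hC kC
    by (simp add: char_add[OF sp] char_diff[OF sp] char_mult[OF sp] C_mult C_diff \<phi>h \<phi>k mu)
  ultimately have "4 * cmod (\<phi> (star m * m)) \<le> norm (star D * D)"
    using char_norm_le[OF sp, of "star D * D"] by (simp add: norm_mult)
  also have "\<dots> = (norm D)\<^sup>2" by (rule cstar_identity)
  also have "\<dots> \<le> (2 * \<epsilon>)\<^sup>2" using d by (intro power_mono) (simp_all add: D_def h_def)
  finally show ?thesis by (simp add: power_mult_distrib)
qed

end

section \<open>Passing from dense subsets to closures\<close>

lemma closure_binary:
  fixes f :: "'a::topological_space \<Rightarrow> 'b::topological_space \<Rightarrow> 'c::topological_space"
  assumes "continuous_on UNIV (\<lambda>(a, b). f a b)"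
    and "\<And>a b. a \<in> U \<Longrightarrow> b \<in> V \<Longrightarrow> f a b \<in> W"
    and "a \<in> closure U" "b \<in> closure V"
  shows "f a b \<in> closure W"
proof -
  have "(\<lambda>(a, b). f a b) ` closure (U \<times> V) \<subseteq> closure W"
    using assms(2) closure_subset
    by (intro image_closure_subset continuous_on_subset[OF assms(1)]) fastforce+
  moreover have "(a, b) \<in> closure (U \<times> V)" using assms(3,4) by (simp add: closure_Times)
  ultimately show ?thesis by force
qed

lemma closure_unary:
  fixes f :: "'a::topological_space \<Rightarrow> 'b::topological_space"
  assumes "continuous_on UNIV f" "\<And>a. a \<in> U \<Longrightarrow> f a \<in> W" "a \<in> closure U"
  shows "f a \<in> closure W"
proof -
  have "f ` closure U \<subseteq> closure W"
    using assms(2) closure_subset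
    by (intro image_closure_subset continuous_on_subset[OF assms(1)]) fastforce+
  then show ?thesis using assms(3) by blast
qed

lemma closure_eq:
  fixes f g :: "'a::topological_space \<Rightarrow> 'b::t2_space"
  assumes "continuous_on UNIV f" "continuous_on UNIV g" "\<And>a. a \<in> U \<Longrightarrow> f a = g a" "a \<in> closure U"
  shows "f a = g a"
proof -
  have "closure U \<subseteq> {a. f a = g a}"
    using assms by (intro closure_minimal closed_Collect_eq) auto
  then show ?thesis using assms(4) by auto
qed

lemma continuous_on_scaleC: "continuous_on U (scaleC z :: 'a::cstar_algebra \<Rightarrow> 'a)"
proof -
  have "bounded_linear (scaleC z :: 'a \<Rightarrow> 'a)"
  proof (rule bounded_linear_intro)
    show "scaleC z (t *\<^sub>R a) = t *\<^sub>R scaleC z a" for t and a :: 'a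
      by (simp add: scaleC_of_real[symmetric] scaleC_scaleC mult.commute)
    show "norm (scaleC z a) \<le> norm a * cmod z" for a :: 'a
      by (simp add: norm_scaleC mult.commute)
  qed (rule scaleC_add_right)
  then show ?thesis by (rule linear_continuous_on)
qed

section \<open>Block diagonal matrices and path indices\<close>

text \<open>The \<open>takeWhile\<close> sum of \<open>rev_path_index\<close>, made generic: for
  \<open>b\<close> in \<open>L\<close> it counts the rows in front of the block of
  \<open>b\<close>.\<close>

definition offset :: "('b \<Rightarrow> nat) \<Rightarrow> 'b list \<Rightarrow> 'b \<Rightarrow> nat" where
  "offset k L b = (\<Sum>b'\<leftarrow>takeWhile (\<lambda>b'. b' \<noteq> b) L. k b')"

lemma offset_Cons: "offset k (a # L) b = (if b = a then 0 else k a + offset k L b)"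
  by (simp add: offset_def)

lemma offset_add_le: "b \<in> set L \<Longrightarrow> offset k L b + k b \<le> sum_list (map k L)"
  by (induction L) (auto simp: offset_Cons)

lemma offset_decomp:
  "\<lbrakk>distinct L; 1 \<le> r; r \<le> sum_list (map k L)\<rbrakk> \<Longrightarrow>
     \<exists>b\<in>set L. \<exists>s\<in>{1..k b}. r = offset k L b + s"
proof (induction L arbitrary: r)
  case (Cons a L)
  show ?case
  proof (cases "r \<le> k a")
    case True
    then show ?thesis using Cons.prems by (intro bexI[of _ a] bexI[of _ r]) (auto simp: offset_Cons)
  next
    case False
    then have "1 \<le> r - k a" "r - k a \<le> sum_list (map k L)" "distinct L"
      using Cons.prems by auto
    then obtain b s where "b \<in> set L" "s \<in> {1..k b}" "r - k a = offset k L b + s"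
      using Cons.IH[of "r - k a"] by blast
    then show ?thesis using False Cons.prems
      by (intro bexI[of _ b] bexI[of _ s]) (auto simp: offset_Cons)
  qed
qed simp

text \<open>The blocks occupy pairwise disjoint intervals of indices, so an index determines its
  block and its position there.\<close>

lemma offset_unique:
  "\<lbrakk>offset k L b + s = offset k L b' + s'; b \<in> set L; b' \<in> set L; s \<in> {1..k b}; s' \<in> {1..k b'}\<rbrakk>
     \<Longrightarrow> b = b' \<and> s = s'"
  by (induction L) (auto simp: offset_Cons split: if_splits)

text \<open>Turns the recursion into a finite sum over blocks. The summands carry no upper bound on
  the indices, and the first clause of \<open>block_diag\<close> no lower one; the support
  hypothesis on \<open>M\<close> makes up for both.\<close>

lemma block_diag_sum:
  assumes "distinct L"
    and "\<And>b r c. b \<in> set L \<Longrightarrow> M b r c \<noteq> 0 \<Longrightarrow> r \<in> {1..k b} \<and> c \<in> {1..k b}"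
  shows "block_diag (map (\<lambda>b. (k b, M b)) L) r c =
    (\<Sum>b\<in>set L. if offset k L b < r \<and> offset k L b < c then M b (r - offset k L b) (c - offset k L b) else 0)"
  using assms
proof (induction L arbitrary: r c)
  case (Cons a L)
  let ?t = "\<lambda>L r c b. if offset k L b < r \<and> offset k L b < c
    then M b (r - offset k L b) (c - offset k L b) else 0"
  have IH: "block_diag (map (\<lambda>b. (k b, M b)) L) r c = (\<Sum>b\<in>set L. ?t L r c b)" for r c
    using Cons.prems by (intro Cons.IH) auto
  have a: "M a r c \<noteq> 0 \<Longrightarrow> r \<in> {1..k a} \<and> c \<in> {1..k a}" for r c
    using Cons.prems by auto
  have "(\<Sum>b\<in>set (a # L). ?t (a # L) r c b) = ?t (a # L) r c a + (\<Sum>b\<in>set L. ?t (a # L) r c b)"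
    using Cons.prems(1) by simp
  also have "?t (a # L) r c a = M a r c"
    using a[of r c] by (auto simp: offset_Cons)
  also have "(\<Sum>b\<in>set L. ?t (a # L) r c b) =
      (if k a < r \<and> k a < c then (\<Sum>b\<in>set L. ?t L (r - k a) (c - k a) b) else 0)"
  proof (cases "k a < r \<and> k a < c")
    case True
    have "b \<in> set L \<Longrightarrow> b \<noteq> a" for b using Cons.prems(1) by auto
    with True show ?thesis
      by (auto simp: offset_Cons less_diff_conv add.commute intro!: sum.cong)
  next
    case False
    have "b \<in> set L \<Longrightarrow> b \<noteq> a" for b using Cons.prems(1) by auto
    with False show ?thesis by (auto simp: offset_Cons intro!: sum.neutral)
  qed
  finally show ?case
    using a[of r c] by (cases "M a r c = 0") (auto simp: IH)
qed simp

text \<open>Only the summand of \<open>b\<close> survives in \<open>block_diag_sum\<close>: a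
  nonzero summand of another block would place the same row in two blocks.\<close>

lemma block_diag_entry:
  assumes "distinct L"
    and M: "\<And>b r c. b \<in> set L \<Longrightarrow> M b r c \<noteq> 0 \<Longrightarrow> r \<in> {1..k b} \<and> c \<in> {1..k b}"
    and b: "b \<in> set L" "s \<in> {1..k b}" "t \<in> {1..k b}"
  shows "block_diag (map (\<lambda>b. (k b, M b)) L) (offset k L b + s) (offset k L b + t) = M b s t"
proof -
  let ?t = "\<lambda>b'. if offset k L b' < offset k L b + s \<and> offset k L b' < offset k L b + t
    then M b' (offset k L b + s - offset k L b') (offset k L b + t - offset k L b') else 0"
  have "?t b' = 0" if "b' \<in> set L - {b}" for b'
  proof (rule ccontr)
    assume nz: "?t b' \<noteq> 0"
    then have lt: "offset k L b' < offset k L b + s" by presburger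
    from nz have "M b' (offset k L b + s - offset k L b') (offset k L b + t - offset k L b') \<noteq> 0"
      by presburger
    with M[of b'] that have "offset k L b + s - offset k L b' \<in> {1..k b'}" by blast
    with offset_unique[of k L b s b' "offset k L b + s - offset k L b'"] b that lt
    show False by auto
  qed
  then have "(\<Sum>b'\<in>set L. ?t b') = ?t b"
    using b by (intro sum.remove[THEN trans]) (auto intro!: sum.neutral)
  then show ?thesis using b by (subst block_diag_sum[OF assms(1) M]) auto
qed

lemma block_diag_nonzeroE:
  assumes "distinct L"
    and M: "\<And>b r c. b \<in> set L \<Longrightarrow> M b r c \<noteq> 0 \<Longrightarrow> r \<in> {1..k b} \<and> c \<in> {1..k b}"
    and nz: "block_diag (map (\<lambda>b. (k b, M b)) L) r c \<noteq> 0"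
  obtains b s t where "b \<in> set L" "s \<in> {1..k b}" "t \<in> {1..k b}"
    "r = offset k L b + s" "c = offset k L b + t"
proof -
  have "(\<Sum>b\<in>set L. if offset k L b < r \<and> offset k L b < c
      then M b (r - offset k L b) (c - offset k L b) else 0) \<noteq> 0"
    using nz block_diag_sum[OF assms(1) M, where r = r and c = c] by simp
  then obtain b where "b \<in> set L" "(if offset k L b < r \<and> offset k L b < c
      then M b (r - offset k L b) (c - offset k L b) else 0) \<noteq> 0"
    by (rule sum.not_neutral_contains_not_neutral)
  then have b: "b \<in> set L" "offset k L b < r" "offset k L b < c"
    "M b (r - offset k L b) (c - offset k L b) \<noteq> 0"
    by (auto split: if_splits)
  show thesis
    using that[of b "r - offset k L b" "c - offset k L b"] M[OF b(1,4)] b by simp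
qed

section \<open>The finite stages of a diagonal AH-system\<close>

locale ah_sys =
  fixes S :: "('x, 'e) ah_system"
  assumes diagonal: "diagonal_ah_system S"
begin

abbreviation "N \<equiv> ah_N S"
abbreviation "k \<equiv> ah_k S"
abbreviation "X \<equiv> ah_X S"
abbreviation "alg \<equiv> ah_alg S"
abbreviation "dalg \<equiv> diag_alg S"
abbreviation "tgt p \<equiv> edge_tgt (last p)"
abbreviation "size_of n \<equiv> (\<lambda>(i, e). k n i)"
abbreviation "off n j \<equiv> offset (size_of n) (ah_ord S n j)"

lemma spaces:
  assumes "n \<ge> 1" "i \<in> {1..N n}"
  shows "compact_space (X n i)" "Hausdorff_space (X n i)"
  using diagonal assms unfolding diagonal_ah_system_def by blast+

lemma ah_ord:
  assumes "n \<ge> 1" "j \<in> {1..N (Suc n)}"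
  shows "distinct (ah_ord S n j)"
    "set (ah_ord S n j) = {(i, e). i \<in> {1..N n} \<and> e \<in> ah_E S n i j}"
    "sum_list (map (size_of n) (ah_ord S n j)) = k (Suc n) j"
  using diagonal assms unfolding diagonal_ah_system_def by blast+

lemma eig_continuous:
  assumes "n \<ge> 1" "j \<in> {1..N (Suc n)}" "(i, e) \<in> set (ah_ord S n j)"
  shows "continuous_map (X (Suc n) j) (X n i) (ah_eig S n i j e)"
  using diagonal assms ah_ord(2)[OF assms(1,2)] unfolding diagonal_ah_system_def by blast

lemma ah_map_unit: "n \<ge> 1 \<Longrightarrow> ah_map S n (elt_unit S n) = elt_unit S (Suc n)"
  using diagonal unfolding diagonal_ah_system_def by blast

lemma algD:
  assumes "f \<in> alg n" "f i x r c \<noteq> 0"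
  shows "i \<in> {1..N n}" "x \<in> topspace (X n i)" "r \<in> {1..k n i}" "c \<in> {1..k n i}"
  using assms unfolding ah_alg_def by blast+

lemma alg_continuous:
  assumes "f \<in> alg n" "i \<in> {1..N n}"
  shows "continuous_map (X n i) euclidean (\<lambda>x. f i x r c)"
proof (cases "r \<in> {1..k n i} \<and> c \<in> {1..k n i}")
  case True
  then show ?thesis using assms unfolding ah_alg_def by blast
next
  case False
  then have "f i x r c = 0" for x using algD[OF assms(1)] by blast
  then show ?thesis by simp
qed

lemma algI:
  assumes "\<And>i r c. \<lbrakk>i \<in> {1..N n}; r \<in> {1..k n i}; c \<in> {1..k n i}\<rbrakk> \<Longrightarrow>
      continuous_map (X n i) euclidean (\<lambda>x. f i x r c)"
    and "\<And>i x r c. f i x r c \<noteq> 0 \<Longrightarrow>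
      i \<in> {1..N n} \<and> x \<in> topspace (X n i) \<and> r \<in> {1..k n i} \<and> c \<in> {1..k n i}"
  shows "f \<in> alg n"
  using assms unfolding ah_alg_def by blast

lemma ah_map_block_diag:
  assumes "j \<in> {1..N (Suc n)}" "x \<in> topspace (X (Suc n) j)"
  shows "ah_map S n f j x = block_diag
    (map (\<lambda>b. (size_of n b, f (fst b) (ah_eig S n (fst b) j (snd b) x))) (ah_ord S n j))"
  using assms by (simp add: ah_map_def case_prod_unfold)

lemma block_supp:
  assumes "f \<in> alg n" "f (fst b) y r c \<noteq> 0"
  shows "r \<in> {1..size_of n b} \<and> c \<in> {1..size_of n b}"
  using algD[OF assms] by (simp add: case_prod_beta)

lemma ah_map_entry:
  assumes "n \<ge> 1" "f \<in> alg n" "j \<in> {1..N (Suc n)}" "x \<in> topspace (X (Suc n) j)"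
    and "(i, e) \<in> set (ah_ord S n j)" "s \<in> {1..k n i}" "t \<in> {1..k n i}"
  shows "ah_map S n f j x (off n j (i, e) + s) (off n j (i, e) + t) = f i (ah_eig S n i j e x) s t"
  using block_diag_entry[OF ah_ord(1)[OF assms(1,3)],
      of "\<lambda>b. f (fst b) (ah_eig S n (fst b) j (snd b) x)" "size_of n" "(i, e)" s t]
    block_supp[OF assms(2)] assms(5-7)
  unfolding ah_map_block_diag[OF assms(3,4)] by auto

text \<open>Entries outside the blocks vanish. Through this rule support, diagonality and
  monomiality are carried to the next stage entry by entry.\<close>

lemma ah_map_nonzeroE:
  assumes "n \<ge> 1" "f \<in> alg n" "ah_map S n f j x r c \<noteq> 0"
  obtains i e s t where "j \<in> {1..N (Suc n)}" "x \<in> topspace (X (Suc n) j)"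
    "(i, e) \<in> set (ah_ord S n j)" "s \<in> {1..k n i}" "t \<in> {1..k n i}"
    "r = off n j (i, e) + s" "c = off n j (i, e) + t"
    "ah_map S n f j x r c = f i (ah_eig S n i j e x) s t"
proof -
  have j: "j \<in> {1..N (Suc n)}" "x \<in> topspace (X (Suc n) j)"
    using assms(3) by (auto simp: ah_map_def split: if_splits)
  have supp: "b \<in> set (ah_ord S n j) \<Longrightarrow> f (fst b) (ah_eig S n (fst b) j (snd b) x) r c \<noteq> 0 \<Longrightarrow>
      r \<in> {1..size_of n b} \<and> c \<in> {1..size_of n b}" for b r c
    using block_supp[OF assms(2)] by blast
  obtain b s t where "b \<in> set (ah_ord S n j)"
    "s \<in> {1..size_of n b}" "t \<in> {1..size_of n b}" "r = off n j b + s" "c = off n j b + t"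
    using block_diag_nonzeroE[OF ah_ord(1)[OF assms(1) j(1)] supp assms(3)[unfolded ah_map_block_diag[OF j]]]
    by blast
  moreover obtain i e where "b = (i, e)" by (cases b)
  ultimately show thesis
    using that[of i e s t] j ah_map_entry[OF assms(1,2) j, of i e s t] by simp
qed

lemma off_range:
  assumes "n \<ge> 1" "j \<in> {1..N (Suc n)}" "(i, e) \<in> set (ah_ord S n j)" "s \<in> {1..k n i}"
  shows "off n j (i, e) + s \<in> {1..k (Suc n) j}"
  using offset_add_le[OF assms(3), of "size_of n"] ah_ord(3)[OF assms(1,2)] assms(4) by simp

lemma off_unique:
  assumes "off n j (i, e) + s = off n j (i', e') + s'"
    "(i, e) \<in> set (ah_ord S n j)" "(i', e') \<in> set (ah_ord S n j)"
    "s \<in> {1..k n i}" "s' \<in> {1..k n i'}"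
  shows "i = i'" "e = e'" "s = s'"
  using offset_unique[OF assms(1-3)] assms(4,5) by auto

lemma ah_map_alg:
  assumes "n \<ge> 1" "f \<in> alg n"
  shows "ah_map S n f \<in> alg (Suc n)"
proof (rule algI)
  fix j x r c assume "ah_map S n f j x r c \<noteq> 0"
  then show "j \<in> {1..N (Suc n)} \<and> x \<in> topspace (X (Suc n) j) \<and>
      r \<in> {1..k (Suc n) j} \<and> c \<in> {1..k (Suc n) j}"
    using ah_map_nonzeroE[OF assms] off_range[OF assms(1)] by metis
next
  fix j r c assume j: "j \<in> {1..N (Suc n)}"
  \<comment> \<open>For fixed \<open>r\<close> and \<open>c\<close> the case distinctions of the
    block sum do not depend on \<open>x\<close>, so continuity can be checked block by
    block.\<close>
  let ?g = "\<lambda>x. \<Sum>b\<in>set (ah_ord S n j). if off n j b < r \<and> off n j b < c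
    then f (fst b) (ah_eig S n (fst b) j (snd b) x) (r - off n j b) (c - off n j b) else 0"
  have "continuous_map (X (Suc n) j) euclidean ?g"
  proof (intro continuous_map_sum)
    fix b assume b: "b \<in> set (ah_ord S n j)"
    then have "fst b \<in> {1..N n}" using ah_ord(2)[OF assms(1) j] by auto
    then have "continuous_map (X (Suc n) j) euclidean
        (\<lambda>x. f (fst b) (ah_eig S n (fst b) j (snd b) x) s t)" for s t
      using continuous_map_compose[OF eig_continuous[OF assms(1) j, of "fst b" "snd b"]
          alg_continuous[OF assms(2), of "fst b" s t]] b
      by (simp add: o_def)
    then show "continuous_map (X (Suc n) j) euclidean (\<lambda>x. if off n j b < r \<and> off n j b < c
        then f (fst b) (ah_eig S n (fst b) j (snd b) x) (r - off n j b) (c - off n j b) else 0)"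
      by simp
  qed simp
  then show "continuous_map (X (Suc n) j) euclidean (\<lambda>x. ah_map S n f j x r c)"
    by (rule continuous_map_eq)
      (simp add: ah_map_block_diag[OF j] block_diag_sum[OF ah_ord(1)[OF assms(1) j] block_supp[OF assms(2)]])
qed

lemma ah_map_diag:
  assumes "n \<ge> 1" "f \<in> dalg n"
  shows "ah_map S n f \<in> dalg (Suc n)"
proof -
  have f: "f \<in> alg n" "\<And>i x r c. r \<noteq> c \<Longrightarrow> f i x r c = 0" using assms by (auto simp: diag_alg_def)
  have "ah_map S n f j x r c = 0" if "r \<noteq> c" for j x r c
  proof (rule ccontr)
    assume "ah_map S n f j x r c \<noteq> 0"
    then obtain i e s t where "r = off n j (i, e) + s" "c = off n j (i, e) + t"
      "f i (ah_eig S n i j e x) s t \<noteq> 0"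
      by (metis ah_map_nonzeroE[OF assms(1) f(1)])
    then show False using that f(2) by auto
  qed
  then show ?thesis using ah_map_alg[OF assms(1) f(1)] by (simp add: diag_alg_def)
qed

lemma ah_map_const:
  assumes "n \<ge> 1" "f \<in> const_alg S n"
  shows "ah_map S n f \<in> const_alg S (Suc n)"
proof -
  have f: "f \<in> alg n" using assms by (simp add: const_alg_def)
  have const: "f i x = f i y" if "x \<in> topspace (X n i)" "y \<in> topspace (X n i)" for i x y
    using assms that unfolding const_alg_def by (intro ext) blast
  have eq: "ah_map S n f j x = ah_map S n f j y"
    if xy: "x \<in> topspace (X (Suc n) j)" "y \<in> topspace (X (Suc n) j)" for j x y
  proof (cases "j \<in> {1..N (Suc n)}")
    case True
    have "f (fst b) (ah_eig S n (fst b) j (snd b) x) = f (fst b) (ah_eig S n (fst b) j (snd b) y)"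
      if "b \<in> set (ah_ord S n j)" for b
      using eig_continuous[OF assms(1) True, of "fst b" "snd b"] that xy
      by (intro const) (auto simp: continuous_map_def)
    then show ?thesis
      by (simp add: ah_map_block_diag[OF True xy(1)] ah_map_block_diag[OF True xy(2)] cong: map_cong)
  qed (auto simp: ah_map_def)
  show ?thesis
    unfolding const_alg_def using eq
    by (intro CollectI conjI allI ballI ah_map_alg[OF assms(1) f]) metis
qed

text \<open>At each point every row and every column has at most one nonzero entry. The connecting
  maps send a matrix unit to a sum of matrix units; this class contains the matrix units, is stable
  under the maps, and still normalises the diagonal at every stage.\<close>

definition monomial_alg :: "nat \<Rightarrow> 'x elt set" where
  "monomial_alg n = {f \<in> alg n. \<forall>i x r c r' c'. f i x r c \<noteq> 0 \<longrightarrow> f i x r' c' \<noteq> 0 \<longrightarrow> (r = r' \<longleftrightarrow> c = c')}"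

lemma ah_map_monomial:
  assumes "n \<ge> 1" "f \<in> monomial_alg n"
  shows "ah_map S n f \<in> monomial_alg (Suc n)"
proof -
  have f: "f \<in> alg n"
    and mono: "\<And>i x r c r' c'. f i x r c \<noteq> 0 \<Longrightarrow> f i x r' c' \<noteq> 0 \<Longrightarrow> (r = r' \<longleftrightarrow> c = c')"
    using assms by (auto simp: monomial_alg_def)
  have "r = r' \<longleftrightarrow> c = c'" if nz: "ah_map S n f j x r c \<noteq> 0" "ah_map S n f j x r' c' \<noteq> 0"
    for j x r c r' c'
  proof -
    obtain i e s t where 1: "(i, e) \<in> set (ah_ord S n j)" "s \<in> {1..k n i}" "t \<in> {1..k n i}"
      "r = off n j (i, e) + s" "c = off n j (i, e) + t" "f i (ah_eig S n i j e x) s t \<noteq> 0"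
      using ah_map_nonzeroE[OF assms(1) f nz(1)] nz(1) by metis
    obtain i' e' s' t' where 2: "(i', e') \<in> set (ah_ord S n j)" "s' \<in> {1..k n i'}" "t' \<in> {1..k n i'}"
      "r' = off n j (i', e') + s'" "c' = off n j (i', e') + t'" "f i' (ah_eig S n i' j e' x) s' t' \<noteq> 0"
      using ah_map_nonzeroE[OF assms(1) f nz(2)] nz(2) by metis
    \<comment> \<open>Different blocks share neither rows nor columns, so only one block is
      concerned, and there monomiality of \<open>f\<close> at the eigenfunction value
      decides.\<close>
    have "(i, e) = (i', e')" if "r = r' \<or> c = c'"
      using that off_unique[of n j i e s i' e' s'] off_unique[of n j i e t i' e' t'] 1 2 by auto
    then show ?thesis
      using mono[OF 1(6), of s' t'] 1 2 by fastforce
  qed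
  then show ?thesis using ah_map_alg[OF assms(1) f] unfolding monomial_alg_def by blast
qed

section \<open>Paths of the Bratteli diagram as matrix indices\<close>

lemma fin_paths_snoc:
  "p @ [d] \<in> fin_paths S (Suc n) \<longleftrightarrow>
     p \<in> fin_paths S n \<and> d \<in> edges S n \<and> (n \<noteq> 0 \<longrightarrow> tgt p = edge_src d)"
proof (cases "length p = n")
  case True
  have "(\<forall>m<Suc n. (p @ [d]) ! m \<in> edges S m) \<longleftrightarrow> (\<forall>m<n. p ! m \<in> edges S m) \<and> d \<in> edges S n"
    using True by (auto simp: less_Suc_eq nth_append)
  moreover have "(\<forall>m. Suc m < Suc n \<longrightarrow> edge_tgt ((p @ [d]) ! m) = edge_src ((p @ [d]) ! Suc m)) \<longleftrightarrow>
      (\<forall>m. Suc m < n \<longrightarrow> edge_tgt (p ! m) = edge_src (p ! Suc m)) \<and> (n \<noteq> 0 \<longrightarrow> tgt p = edge_src d)"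
    (is "?L = ?R")
  proof
    assume L: ?L
    then have "edge_tgt ((p @ [d]) ! (n - 1)) = edge_src ((p @ [d]) ! Suc (n - 1))" if "n \<noteq> 0"
      using that by simp
    then have "n \<noteq> 0 \<longrightarrow> tgt p = edge_src d"
      using True by (cases "n = 0") (auto simp: nth_append last_conv_nth)
    moreover have "edge_tgt (p ! m) = edge_src (p ! Suc m)" if "Suc m < n" for m
      using L[rule_format, of m] that True by (simp add: nth_append)
    ultimately show ?R by blast
  next
    assume R: ?R
    show ?L
    proof (intro allI impI)
      fix m assume "Suc m < Suc n"
      then consider "Suc m < n" | "Suc m = n" by linarith
      then show "edge_tgt ((p @ [d]) ! m) = edge_src ((p @ [d]) ! Suc m)"
      proof cases
        case 2
        then have "last p = p ! m" using True by (metis diff_Suc_1 last_conv_nth list.size(3) nat.distinct(1))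
        then show ?thesis using 2 R True by (auto simp: nth_append)
      qed (use R True in \<open>simp add: nth_append\<close>)
    qed
  qed
  ultimately show ?thesis using True unfolding fin_paths_def by auto
qed (simp add: fin_paths_def)

lemma fin_pathsE:
  assumes "p \<in> fin_paths S (Suc n)"
  obtains q d where "p = q @ [d]" "q \<in> fin_paths S n" "d \<in> edges S n"
proof -
  have "length p = Suc n" using assms by (simp add: fin_paths_def)
  then obtain q d where "p = q @ [d]" by (metis append_butlast_last_id list.size(3) nat.distinct(1))
  then show thesis using that fin_paths_snoc assms by blast
qed

lemma fin_paths_1: "fin_paths S (Suc 0) = {[Root j l] | j l. j \<in> {1..N 1} \<and> l \<in> {1..k 1 j}}"
  unfolding fin_paths_def edges_def by (auto simp: length_Suc_conv)

lemma edges_pos: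
  "n \<ge> 1 \<Longrightarrow> edges S n = {Edge i j e | i j e. j \<in> {1..N (Suc n)} \<and> (i, e) \<in> set (ah_ord S n j)}"
  unfolding edges_def using ah_ord(2)[of n] by auto

lemma path_index_Root: "path_index S [Root j l] = l"
  by (simp add: path_index_def)

lemma path_index_snoc:
  "length p = n \<Longrightarrow> path_index S (p @ [Edge i j e]) = off n j (i, e) + path_index S p"
  by (simp add: path_index_def offset_def)

lemma path_index_range:
  assumes "n \<ge> 1" "p \<in> fin_paths S n"
  shows "tgt p \<in> {1..N n} \<and> path_index S p \<in> {1..k n (tgt p)}"
  using assms
proof (induction n arbitrary: p rule: nat_induct_at_least)
  case base
  then show ?case by (auto simp: fin_paths_1 path_index_Root)
next
  case (Suc n)
  obtain q d where p: "p = q @ [d]" and q: "q \<in> fin_paths S n" and d: "d \<in> edges S n"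
    using fin_pathsE[OF Suc.prems] .
  obtain i j e where d': "d = Edge i j e" "j \<in> {1..N (Suc n)}" "(i, e) \<in> set (ah_ord S n j)"
    using d edges_pos[OF Suc.hyps] by auto
  have "tgt q = i" using Suc.prems Suc.hyps unfolding p fin_paths_snoc by (simp add: d')
  then show ?case
    using Suc.IH[OF q] off_range[OF Suc.hyps d'(2,3)] q d'
    by (simp add: p path_index_snoc fin_paths_def)
qed

lemma path_index_inj:
  assumes "n \<ge> 1" "p \<in> fin_paths S n" "q \<in> fin_paths S n" "tgt p = tgt q" "path_index S p = path_index S q"
  shows "p = q"
  using assms
proof (induction n arbitrary: p q rule: nat_induct_at_least)
  case base
  then show ?case by (auto simp: fin_paths_1 path_index_Root)
next
  case (Suc n)
  obtain p' d where p: "p = p' @ [d]" and p': "p' \<in> fin_paths S n" and d: "d \<in> edges S n"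
    using fin_pathsE[OF Suc.prems(1)] .
  obtain q' d' where q: "q = q' @ [d']" and q': "q' \<in> fin_paths S n" and d': "d' \<in> edges S n"
    using fin_pathsE[OF Suc.prems(2)] .
  obtain i j e where e: "d = Edge i j e" "j \<in> {1..N (Suc n)}" "(i, e) \<in> set (ah_ord S n j)"
    using d edges_pos[OF Suc.hyps] by auto
  obtain i' j' e' where e': "d' = Edge i' j' e'" "j' \<in> {1..N (Suc n)}" "(i', e') \<in> set (ah_ord S n j')"
    using d' edges_pos[OF Suc.hyps] by auto
  have tgts: "tgt p' = i" "tgt q' = i'"
    using Suc.prems Suc.hyps unfolding p q fin_paths_snoc by (simp_all add: e e')
  have len: "length p' = n" "length q' = n" using p' q' by (simp_all add: fin_paths_def)
  have j: "j = j'" using Suc.prems(3) by (simp add: p q e e')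
  have rng: "path_index S p' \<in> {1..k n i}" "path_index S q' \<in> {1..k n i'}"
    using path_index_range[OF Suc.hyps] p' q' tgts by auto
  have "off n j (i, e) + path_index S p' = off n j (i', e') + path_index S q'"
    using Suc.prems(4) len by (simp add: p q e e' path_index_snoc j)
  note u = off_unique[OF this e(3) _ rng]
  have "i = i'" "e = e'" "path_index S p' = path_index S q'" using u e'(3) j by auto
  then show ?case using Suc.IH[OF p' q'] tgts by (simp add: p q e e' j)
qed

text \<open>With \<open>path_index_range\<close> and \<open>path_index_inj\<close> this makes
  \<open>path_index\<close> a bijection from the paths ending in a vertex to the matrix indices
  there. An index of the next stage lies in one block, that is, determines the last edge; its
  position in the block is the index of the shorter path.\<close>

lemma path_index_surj:
  assumes "n \<ge> 1" "i \<in> {1..N n}" "r \<in> {1..k n i}"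
  shows "\<exists>p\<in>fin_paths S n. tgt p = i \<and> path_index S p = r"
  using assms
proof (induction n arbitrary: i r rule: nat_induct_at_least)
  case base
  then show ?case by (intro bexI[of _ "[Root i r]"]) (auto simp: fin_paths_1 path_index_Root)
next
  case (Suc n)
  obtain b s where b: "b \<in> set (ah_ord S n i)" "s \<in> {1..size_of n b}" "r = off n i b + s"
    using offset_decomp[OF ah_ord(1)[OF Suc.hyps Suc.prems(1)], of r "size_of n"]
      ah_ord(3)[OF Suc.hyps Suc.prems(1)] Suc.prems(2) by auto
  obtain i' e where ie: "b = (i', e)" by (cases b)
  have "i' \<in> {1..N n}" using b ah_ord(2)[OF Suc.hyps Suc.prems(1)] by (auto simp: ie)
  then obtain p where p: "p \<in> fin_paths S n" "tgt p = i'" "path_index S p = s"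
    using Suc.IH[of i' s] b by (auto simp: ie)
  have "p @ [Edge i' i e] \<in> fin_paths S (Suc n)"
    unfolding fin_paths_snoc edges_pos[OF Suc.hyps] using p b Suc.prems by (auto simp: ie)
  moreover have "path_index S (p @ [Edge i' i e]) = r"
    using p b by (simp add: path_index_snoc fin_paths_def ie)
  ultimately show ?case by (intro bexI[of _ "p @ [Edge i' i e]"]) auto
qed

section \<open>Algebraic operations on a stage\<close>

lemma continuous_map_complex_mult:
  fixes f g :: "'b \<Rightarrow> complex"
  shows "continuous_map Y euclidean f \<Longrightarrow> continuous_map Y euclidean g \<Longrightarrow>
    continuous_map Y euclidean (\<lambda>x. f x * g x)"
  by (simp add: continuous_map_atin tendsto_mult)

lemma elt_add_alg:
  assumes "f \<in> alg n" "g \<in> alg n" shows "elt_add f g \<in> alg n"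
proof (rule algI)
  show "continuous_map (X n i) euclidean (\<lambda>x. elt_add f g i x r c)" if "i \<in> {1..N n}" for i r c
    unfolding elt_add_def using that by (intro continuous_map_add alg_continuous assms)
  fix i x r c assume "elt_add f g i x r c \<noteq> 0"
  then have "f i x r c \<noteq> 0 \<or> g i x r c \<noteq> 0" by (auto simp: elt_add_def)
  then show "i \<in> {1..N n} \<and> x \<in> topspace (X n i) \<and> r \<in> {1..k n i} \<and> c \<in> {1..k n i}"
    using algD[OF assms(1), of i x r c] algD[OF assms(2), of i x r c] by blast
qed

lemma elt_scale_alg:
  assumes "f \<in> alg n" shows "elt_scale z f \<in> alg n"
proof (rule algI)
  show "continuous_map (X n i) euclidean (\<lambda>x. elt_scale z f i x r c)" if "i \<in> {1..N n}" for i r c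
    unfolding elt_scale_def
    using that by (intro continuous_map_complex_mult continuous_map_const[THEN iffD2] alg_continuous assms) auto
  show "i \<in> {1..N n} \<and> x \<in> topspace (X n i) \<and> r \<in> {1..k n i} \<and> c \<in> {1..k n i}"
    if "elt_scale z f i x r c \<noteq> 0" for i x r c
    using that algD[OF assms, of i x r c] by (auto simp: elt_scale_def)
qed

lemma elt_star_alg:
  assumes "f \<in> alg n" shows "elt_star f \<in> alg n"
proof (rule algI)
  show "continuous_map (X n i) euclidean (\<lambda>x. elt_star f i x r c)" if "i \<in> {1..N n}" for i r c
    using alg_continuous[OF assms that, of c r]
    unfolding elt_star_def continuous_map_atin by (auto intro!: tendsto_cnj)
qed (use algD[OF assms] in \<open>simp add: elt_star_def\<close>)

lemma elt_mult_alg: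
  assumes "f \<in> alg n" "g \<in> alg n" shows "elt_mult S n f g \<in> alg n"
proof (rule algI)
  show "continuous_map (X n i) euclidean (\<lambda>x. elt_mult S n f g i x r c)" if "i \<in> {1..N n}" for i r c
    unfolding elt_mult_def
    using that by (intro continuous_map_sum continuous_map_complex_mult alg_continuous assms) auto
  fix i x r c assume "elt_mult S n f g i x r c \<noteq> 0"
  then obtain s where "f i x r s * g i x s c \<noteq> 0"
    unfolding elt_mult_def using sum.not_neutral_contains_not_neutral by blast
  then have "f i x r s \<noteq> 0" "g i x s c \<noteq> 0" by auto
  then show "i \<in> {1..N n} \<and> x \<in> topspace (X n i) \<and> r \<in> {1..k n i} \<and> c \<in> {1..k n i}"
    using algD(1-3)[OF assms(1), of i x r s] algD(4)[OF assms(2), of i x s c] by blast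
qed

lemma dalgD: "f \<in> dalg n \<Longrightarrow> f \<in> alg n" "f \<in> dalg n \<Longrightarrow> r \<noteq> c \<Longrightarrow> f i x r c = 0"
  by (auto simp: diag_alg_def)

lemma dalgI: "f \<in> alg n \<Longrightarrow> (\<And>i x r c. r \<noteq> c \<Longrightarrow> f i x r c = 0) \<Longrightarrow> f \<in> dalg n"
  by (auto simp: diag_alg_def)

text \<open>Makes \<open>dalg n\<close> an algebra of functions with entrywise product;
  commutativity of \<open>C\<close> and the inverses and unitaries constructed below rest on
  this.\<close>

lemma elt_mult_dalg:
  assumes "f \<in> dalg n" "g \<in> dalg n"
  shows "elt_mult S n f g = (\<lambda>i x r c. f i x r c * g i x r c)"
proof (intro ext)
  fix i x r c
  have "elt_mult S n f g i x r c = (\<Sum>s = 1..k n i. if s = r then f i x r r * g i x r c else 0)"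
    unfolding elt_mult_def by (intro sum.cong) (auto simp: dalgD(2)[OF assms(1)])
  also have "\<dots> = f i x r r * g i x r c"
    using algD(3)[OF dalgD(1)[OF assms(1)], of i x r r] by auto
  also have "\<dots> = f i x r c * g i x r c" using dalgD(2)[OF assms(2)] by (cases "r = c") auto
  finally show "elt_mult S n f g i x r c = f i x r c * g i x r c" .
qed

lemma dalg_closed:
  assumes "f \<in> dalg n" "g \<in> dalg n"
  shows "elt_add f g \<in> dalg n" "elt_mult S n f g \<in> dalg n" "elt_scale z f \<in> dalg n" "elt_star f \<in> dalg n"
proof -
  note fg = dalgD(1)[OF assms(1)] dalgD(1)[OF assms(2)]
  show "elt_add f g \<in> dalg n" "elt_scale z f \<in> dalg n" "elt_star f \<in> dalg n"
    by (intro dalgI elt_add_alg elt_scale_alg elt_star_alg fg;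
        simp add: elt_add_def elt_scale_def elt_star_def dalgD(2)[OF assms(1)] dalgD(2)[OF assms(2)])+
  show "elt_mult S n f g \<in> dalg n"
    by (intro dalgI elt_mult_alg fg) (simp add: elt_mult_dalg[OF assms] dalgD(2)[OF assms(1)])
qed

lemma const_algI:
  "f \<in> alg n \<Longrightarrow> (\<And>i x y r c. x \<in> topspace (X n i) \<Longrightarrow> y \<in> topspace (X n i) \<Longrightarrow> f i x r c = f i y r c)
    \<Longrightarrow> f \<in> const_alg S n"
  unfolding const_alg_def by blast

lemma const_algD:
  "f \<in> const_alg S n \<Longrightarrow> f \<in> alg n"
  "f \<in> const_alg S n \<Longrightarrow> x \<in> topspace (X n i) \<Longrightarrow> y \<in> topspace (X n i) \<Longrightarrow> f i x r c = f i y r c"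
  unfolding const_alg_def by blast+

lemma const_alg_closed:
  assumes "f \<in> const_alg S n" "g \<in> const_alg S n"
  shows "elt_add f g \<in> const_alg S n" "elt_mult S n f g \<in> const_alg S n" "elt_scale z f \<in> const_alg S n"
proof -
  note fg = const_algD(1)[OF assms(1)] const_algD(1)[OF assms(2)]
  have eq: "f i x r c = f i y r c" "g i x r c = g i y r c"
    if "x \<in> topspace (X n i)" "y \<in> topspace (X n i)" for i x y r c
    using const_algD(2)[OF assms(1) that] const_algD(2)[OF assms(2) that] by blast+
  show "elt_add f g \<in> const_alg S n" unfolding elt_add_def
    by (rule const_algI, rule elt_add_alg[OF fg, unfolded elt_add_def]) (metis eq)
  show "elt_scale z f \<in> const_alg S n" unfolding elt_scale_def
    by (rule const_algI, rule elt_scale_alg[OF fg(1), unfolded elt_scale_def]) (metis eq)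
  show "elt_mult S n f g \<in> const_alg S n" unfolding elt_mult_def
    by (rule const_algI, rule elt_mult_alg[OF fg, unfolded elt_mult_def], rule sum.cong) (auto intro: arg_cong2[OF eq(1) eq(2), of _ _ _ _ _ _ "(*)"])
qed

lemma elt_unit_alg: "elt_unit S n \<in> alg n"
proof (rule algI)
  show "continuous_map (X n i) euclidean (\<lambda>x. elt_unit S n i x r c)" if "i \<in> {1..N n}" for i r c
    by (rule continuous_map_eq[where f = "\<lambda>_. if r \<in> {1..k n i} \<and> r = c then 1 else 0"])
      (use that in \<open>auto simp: elt_unit_def\<close>)
qed (auto simp: elt_unit_def split: if_splits)

lemma elt_unit_dalg: "elt_unit S n \<in> dalg n"
  by (rule dalgI[OF elt_unit_alg]) (simp add: elt_unit_def)

lemma elt_unit_const: "elt_unit S n \<in> const_alg S n"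
  by (rule const_algI[OF elt_unit_alg]) (simp add: elt_unit_def)

lemma elt_mult_unit:
  assumes "f \<in> alg n"
  shows "elt_mult S n (elt_unit S n) f = f" "elt_mult S n f (elt_unit S n) = f"
proof -
  show "elt_mult S n (elt_unit S n) f = f"
  proof (intro ext)
    fix i x r c
    have "elt_mult S n (elt_unit S n) f i x r c = (\<Sum>s = 1..k n i. if s = r then f i x r c else 0)"
      unfolding elt_mult_def elt_unit_def using algD[OF assms, of i x]
      by (intro sum.cong) auto
    then show "elt_mult S n (elt_unit S n) f i x r c = f i x r c"
      using algD[OF assms, of i x r c] by auto
  qed
  show "elt_mult S n f (elt_unit S n) = f"
  proof (intro ext)
    fix i x r c
    have "elt_mult S n f (elt_unit S n) i x r c = (\<Sum>s = 1..k n i. if s = c then f i x r c else 0)"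
      unfolding elt_mult_def elt_unit_def using algD[OF assms, of i x]
      by (intro sum.cong) auto
    then show "elt_mult S n f (elt_unit S n) i x r c = f i x r c"
      using algD[OF assms, of i x r c] by auto
  qed
qed

lemma elt_star_unit: "elt_star (elt_unit S n) = elt_unit S n"
  by (auto simp: elt_star_def elt_unit_def fun_eq_iff)

text \<open>An entry of the first product is a sum of
  \<open>f i x r s * d i x s t * cnj (f i x c t)\<close>. Diagonality forces \<open>s = t\<close>,
  and monomiality forbids two nonzero entries in one column \<open>s\<close> when
  \<open>r \<noteq> c\<close>. The second product is the same with rows in place of columns.\<close>

lemma monomial_conj_diag:
  assumes "f \<in> monomial_alg n" "d \<in> dalg n"
  shows "elt_mult S n (elt_mult S n f d) (elt_star f) \<in> dalg n"
    "elt_mult S n (elt_mult S n (elt_star f) d) f \<in> dalg n"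
proof -
  have f: "f \<in> alg n"
    and mono: "\<And>i x r c r' c'. f i x r c \<noteq> 0 \<Longrightarrow> f i x r' c' \<noteq> 0 \<Longrightarrow> (r = r' \<longleftrightarrow> c = c')"
    using assms(1) by (auto simp: monomial_alg_def)
  note d = dalgD(1)[OF assms(2)]
  show "elt_mult S n (elt_mult S n f d) (elt_star f) \<in> dalg n"
  proof (intro dalgI elt_mult_alg elt_star_alg f d)
    fix i x r c assume "(r::nat) \<noteq> c"
    have zero: "f i x r s * d i x s t * cnj (f i x c t) = 0" for s t
      using mono[of i x r s c s] dalgD(2)[OF assms(2), of s t i x] \<open>r \<noteq> c\<close> by (cases "s = t") auto
    then show "elt_mult S n (elt_mult S n f d) (elt_star f) i x r c = 0"
      unfolding elt_mult_def elt_star_def sum_distrib_right by (simp only: zero sum.neutral_const)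
  qed
  show "elt_mult S n (elt_mult S n (elt_star f) d) f \<in> dalg n"
  proof (intro dalgI elt_mult_alg elt_star_alg f d)
    fix i x r c assume "(r::nat) \<noteq> c"
    have zero: "cnj (f i x s r) * d i x s t * f i x t c = 0" for s t
      using mono[of i x s r s c] dalgD(2)[OF assms(2), of s t i x] \<open>r \<noteq> c\<close> by (cases "s = t") auto
    then show "elt_mult S n (elt_mult S n (elt_star f) d) f i x r c = 0"
      unfolding elt_mult_def elt_star_def sum_distrib_right by (simp only: zero sum.neutral_const)
  qed
qed

section \<open>Matrix units of a stage\<close>

lemma matrix_unit_nonzero:
  "matrix_unit S p q i x r c \<noteq> 0 \<Longrightarrow>
     i = tgt p \<and> x \<in> topspace (X (length p) i) \<and> r = path_index S p \<and> c = path_index S q"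
  by (simp add: matrix_unit_def split: if_splits)

context
  fixes n p q
  assumes n: "n \<ge> 1" and p: "p \<in> fin_paths S n" and q: "q \<in> fin_paths S n" and pq: "tgt p = tgt q"
begin

lemma matrix_unit_alg: "matrix_unit S p q \<in> alg n"
proof (rule algI)
  have len: "length p = n" using p by (simp add: fin_paths_def)
  show "continuous_map (X n i) euclidean (\<lambda>x. matrix_unit S p q i x r c)" for i r c
    by (rule continuous_map_eq[where
          f = "\<lambda>_. if i = tgt p \<and> r = path_index S p \<and> c = path_index S q then 1 else 0"])
      (auto simp: matrix_unit_def len)
  show "i \<in> {1..N n} \<and> x \<in> topspace (X n i) \<and> r \<in> {1..k n i} \<and> c \<in> {1..k n i}"
    if "matrix_unit S p q i x r c \<noteq> 0" for i x r c
    using matrix_unit_nonzero[OF that] path_index_range[OF n p] path_index_range[OF n q] pq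
    by (auto simp: len)
qed

lemma matrix_unit_monomial: "matrix_unit S p q \<in> monomial_alg n"
  using matrix_unit_alg matrix_unit_nonzero unfolding monomial_alg_def by blast

lemma matrix_unit_const: "matrix_unit S p q \<in> const_alg S n"
  using p by (intro const_algI matrix_unit_alg) (simp add: matrix_unit_def fin_paths_def)

lemma elt_star_matrix_unit: "elt_star (matrix_unit S p q) = matrix_unit S q p"
  using p q pq by (auto simp: elt_star_def matrix_unit_def fin_paths_def fun_eq_iff)

lemma matrix_unit_mult_left:
  "elt_mult S n (matrix_unit S p q) f = (\<lambda>i x r c.
     if i = tgt p \<and> x \<in> topspace (X n i) \<and> r = path_index S p then f i x (path_index S q) c else 0)"
proof (intro ext)
  fix i x r c
  have len: "length p = n" using p by (simp add: fin_paths_def)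
  have "elt_mult S n (matrix_unit S p q) f i x r c = (\<Sum>s = 1..k n i. if s = path_index S q
      then (if i = tgt p \<and> x \<in> topspace (X n i) \<and> r = path_index S p then f i x (path_index S q) c else 0)
      else 0)"
    unfolding elt_mult_def matrix_unit_def len by (intro sum.cong) auto
  then show "elt_mult S n (matrix_unit S p q) f i x r c =
      (if i = tgt p \<and> x \<in> topspace (X n i) \<and> r = path_index S p then f i x (path_index S q) c else 0)"
    using path_index_range[OF n q] pq by auto
qed

lemma matrix_unit_mult_right:
  "elt_mult S n f (matrix_unit S p q) = (\<lambda>i x r c.
     if i = tgt p \<and> x \<in> topspace (X n i) \<and> c = path_index S q then f i x r (path_index S p) else 0)"
proof (intro ext)
  fix i x r c
  have len: "length p = n" using p by (simp add: fin_paths_def)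
  have "elt_mult S n f (matrix_unit S p q) i x r c = (\<Sum>s = 1..k n i. if s = path_index S p
      then (if i = tgt p \<and> x \<in> topspace (X n i) \<and> c = path_index S q then f i x r (path_index S p) else 0)
      else 0)"
    unfolding elt_mult_def matrix_unit_def len by (intro sum.cong) auto
  then show "elt_mult S n f (matrix_unit S p q) i x r c =
      (if i = tgt p \<and> x \<in> topspace (X n i) \<and> c = path_index S q then f i x r (path_index S p) else 0)"
    using path_index_range[OF n p] pq by auto
qed

text \<open>The image of a matrix unit in the next stage is the sum of the matrix units of
  \<open>p @ [d]\<close> and \<open>q @ [d]\<close> over the edges \<open>d\<close> leaving the
  common end vertex. Multiplying by the diagonal unit of \<open>q @ [d]\<close> picks out one
  summand.\<close>

lemma matrix_unit_snoc:
  assumes "p @ [d] \<in> fin_paths S (Suc n)" "q @ [d] \<in> fin_paths S (Suc n)"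
  shows "elt_mult S (Suc n) (ah_map S n (matrix_unit S p q)) (matrix_unit S (q @ [d]) (q @ [d])) =
    matrix_unit S (p @ [d]) (q @ [d])"
proof (intro ext)
  fix j x r c
  obtain i j' e where d: "d = Edge i j' e" "j' \<in> {1..N (Suc n)}" "(i, e) \<in> set (ah_ord S n j')"
    using assms(1) n unfolding fin_paths_snoc edges_pos[OF n] by auto
  have i: "tgt p = i" "tgt q = i" using assms n unfolding fin_paths_snoc d by auto
  have len: "length p = n" "length q = n" using p q by (simp_all add: fin_paths_def)
  have rng: "path_index S p \<in> {1..k n i}" "path_index S q \<in> {1..k n i}"
    using path_index_range[OF n p] path_index_range[OF n q] i by auto
  let ?a = "ah_map S n (matrix_unit S p q)"
  have idx: "path_index S (p @ [d]) = off n j' (i, e) + path_index S p"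
    "path_index S (q @ [d]) = off n j' (i, e) + path_index S q"
    using len by (simp_all add: d path_index_snoc)
  have L: "elt_mult S (Suc n) ?a (matrix_unit S (q @ [d]) (q @ [d])) j x r c =
      (if j = j' \<and> x \<in> topspace (X (Suc n) j) \<and> c = path_index S (q @ [d])
       then ?a j x r (path_index S (q @ [d])) else 0)"
    by (subst ah_sys.matrix_unit_mult_right[OF ah_sys_axioms, of "Suc n"]) (use assms(2) in \<open>auto simp: d\<close>)
  have a: "?a j' x r (path_index S (q @ [d])) = (if r = path_index S (p @ [d]) then 1 else 0)"
    if x: "x \<in> topspace (X (Suc n) j')"
  proof (cases "r = path_index S (p @ [d])")
    case True
    have "ah_eig S n i j' e x \<in> topspace (X n i)"
      using eig_continuous[OF n d(2,3)] x by (auto simp: continuous_map_def)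
    then have "matrix_unit S p q i (ah_eig S n i j' e x) (path_index S p) (path_index S q) = 1"
      using len i by (simp add: matrix_unit_def)
    with True show ?thesis
      using ah_map_entry[OF n matrix_unit_alg d(2) x d(3) rng] by (simp add: idx)
  next
    case False
    \<comment> \<open>The column index determines the block of \<open>d\<close>, and inside that
      block only the row of \<open>p @ [d]\<close> is nonzero.\<close>
    have "?a j' x r (path_index S (q @ [d])) = 0"
    proof (rule ccontr)
      assume nz: "?a j' x r (path_index S (q @ [d])) \<noteq> 0"
      obtain i' e' s t where o: "(i', e') \<in> set (ah_ord S n j')" "s \<in> {1..k n i'}" "t \<in> {1..k n i'}"
        "r = off n j' (i', e') + s" "path_index S (q @ [d]) = off n j' (i', e') + t"
        "matrix_unit S p q i' (ah_eig S n i' j' e' x) s t \<noteq> 0"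
        using ah_map_nonzeroE[OF n matrix_unit_alg nz] nz by metis
      have "off n j' (i, e) + path_index S q = off n j' (i', e') + t" using o(5) idx by simp
      from off_unique[OF this d(3) o(1) rng(2) o(3)] have "i = i'" "e = e'" by auto
      then show False using matrix_unit_nonzero[OF o(6)] o(4) False idx by simp
    qed
    then show ?thesis using False by simp
  qed
  show "elt_mult S (Suc n) ?a (matrix_unit S (q @ [d]) (q @ [d])) j x r c =
      matrix_unit S (p @ [d]) (q @ [d]) j x r c"
    unfolding L using a by (auto simp: matrix_unit_def d len)
qed

text \<open>The corner has a single entry function, at row \<open>p\<close> and column
  \<open>q\<close>. Placed at the diagonal position of \<open>p\<close> instead, this function is
  \<open>g\<close>.\<close>

lemma matrix_unit_corner:
  assumes f: "f \<in> alg n"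
  obtains g where "g \<in> dalg n"
    "elt_mult S n (elt_mult S n (matrix_unit S p p) f) (matrix_unit S q q) = elt_mult S n g (matrix_unit S p q)"
proof
  let ?g = "\<lambda>i x r c. if i = tgt p \<and> r = path_index S p \<and> c = path_index S p
    then f i x (path_index S p) (path_index S q) else 0"
  show "?g \<in> dalg n"
  proof (intro dalgI algI)
    show "continuous_map (X n i) euclidean (\<lambda>x. ?g i x r c)" if "i \<in> {1..N n}" for i r c
      using alg_continuous[OF f that, of "path_index S p" "path_index S q"]
      by (cases "i = tgt p \<and> r = path_index S p \<and> c = path_index S p") auto
    show "i \<in> {1..N n} \<and> x \<in> topspace (X n i) \<and> r \<in> {1..k n i} \<and> c \<in> {1..k n i}"
      if "?g i x r c \<noteq> 0" for i x r c
      using algD[OF f, of i x "path_index S p" "path_index S q"] that by (auto split: if_splits)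
  qed auto
  show "elt_mult S n (elt_mult S n (matrix_unit S p p) f) (matrix_unit S q q) =
      elt_mult S n ?g (matrix_unit S p q)"
    unfolding matrix_unit_mult_right
      ah_sys.matrix_unit_mult_right[OF ah_sys_axioms n q q refl]
      ah_sys.matrix_unit_mult_left[OF ah_sys_axioms n p p refl]
    by (auto simp: pq fun_eq_iff)
qed

end

lemma matrix_unit_dalg:
  assumes "n \<ge> 1" "p \<in> fin_paths S n"
  shows "matrix_unit S p p \<in> dalg n"
  using matrix_unit_nonzero by (blast intro: dalgI matrix_unit_alg[OF assms assms(2) refl])

lemma matrix_unit_corner_zero:
  assumes n: "n \<ge> 1" and p: "p \<in> fin_paths S n" and q: "q \<in> fin_paths S n" and pq: "tgt p \<noteq> tgt q"
  shows "elt_mult S n (elt_mult S n (matrix_unit S p p) f) (matrix_unit S q q) = (\<lambda>i x r c. 0)"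
  unfolding matrix_unit_mult_right[OF n q q refl] matrix_unit_mult_left[OF n p p refl]
  using pq by (auto simp: fun_eq_iff)

end

section \<open>Characters of the limit diagonal\<close>

lemma norm_mult3_le: "norm (a * b * c) \<le> norm a * norm b * norm (c::'a::real_normed_algebra)"
  by (rule order_trans[OF norm_mult_ineq mult_right_mono[OF norm_mult_ineq norm_ge_zero]])

section \<open>The limit algebras and their common unit\<close>

locale ah_embed = ah_sys S for S :: "('x, 'e) ah_system" +
  fixes \<psi> :: "nat \<Rightarrow> 'x elt \<Rightarrow> 'a::cstar_algebra"
  assumes embedding: "ah_embedding S \<psi>"
begin

abbreviation "A \<equiv> lim_alg S \<psi>"
abbreviation "C \<equiv> lim_diag S \<psi>"
abbreviation "B \<equiv> lim_AF S \<psi>"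
abbreviation "E \<equiv> ind_cyl S \<psi>"
abbreviation "PP \<equiv> path_pairs S"

definition un :: 'a where "un = \<psi> 1 (elt_unit S 1)"

lemma hom:
  assumes "n \<ge> 1" "f \<in> alg n"
  shows "g \<in> alg n \<Longrightarrow> \<psi> n (elt_add f g) = \<psi> n f + \<psi> n g"
    "g \<in> alg n \<Longrightarrow> \<psi> n (elt_mult S n f g) = \<psi> n f * \<psi> n g"
    "\<psi> n (elt_scale z f) = scaleC z (\<psi> n f)"
    "\<psi> n (elt_star f) = star (\<psi> n f)"
    "\<psi> (Suc n) (ah_map S n f) = \<psi> n f"
  using embedding assms unfolding ah_embedding_def star_hom_def by blast+

lemma hom_unit: "n \<ge> 1 \<Longrightarrow> \<psi> n (elt_unit S n) = un"
proof (induction n rule: nat_induct_at_least)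
  case (Suc n)
  then show ?case using hom(5)[OF Suc.hyps elt_unit_alg] ah_map_unit[OF Suc.hyps] by simp
qed (simp add: un_def)

lemma lift_level:
  assumes "n \<ge> 1" "n \<le> m" "f \<in> P n"
    and P: "\<And>n f. n \<ge> 1 \<Longrightarrow> f \<in> P n \<Longrightarrow> f \<in> alg n \<and> ah_map S n f \<in> P (Suc n)"
  shows "\<exists>g\<in>P m. \<psi> m g = \<psi> n f"
  using assms(2)
proof (induction m rule: dec_induct)
  case (step m)
  then obtain g where g: "g \<in> P m" "\<psi> m g = \<psi> n f" by blast
  have "m \<ge> 1" using assms(1) step.hyps by simp
  with P[OF this g(1)] hom(5)[of m g] g show ?case by (intro bexI[of _ "ah_map S m g"]) auto
qed (use assms in blast)

definition level_union :: "(nat \<Rightarrow> 'x elt set) \<Rightarrow> 'a set" where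
  "level_union P = (\<Union>n\<in>{1..}. \<psi> n ` P n)"

text \<open>Elements of different stages can be computed with only after they are moved to a common
  stage; stability says that they keep their kind when this is done.\<close>

definition stable :: "(nat \<Rightarrow> 'x elt set) \<Rightarrow> bool" where
  "stable P \<longleftrightarrow> (\<forall>n\<ge>1. \<forall>f\<in>P n. f \<in> alg n \<and> ah_map S n f \<in> P (Suc n))"

lemma stable: "stable alg" "stable dalg" "stable (const_alg S)" "stable monomial_alg"
  by (auto simp: stable_def dalgD const_algD(1) ah_map_alg ah_map_diag ah_map_const ah_map_monomial)
    (simp add: monomial_alg_def)

lemma lim_eq: "A = closure (level_union alg)" "C = closure (level_union dalg)"
  "B = closure (level_union (const_alg S))"
  by (simp_all add: lim_alg_def lim_diag_def lim_AF_def level_union_def)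

lemma common_level:
  assumes "stable P" "stable Q" "a \<in> level_union P" "b \<in> level_union Q"
  obtains n f g where "n \<ge> 1" "f \<in> P n" "g \<in> Q n" "f \<in> alg n" "g \<in> alg n" "a = \<psi> n f" "b = \<psi> n g"
proof -
  obtain n f where f: "n \<ge> 1" "f \<in> P n" "a = \<psi> n f" using assms(3) by (auto simp: level_union_def)
  obtain m g where g: "m \<ge> 1" "g \<in> Q m" "b = \<psi> m g" using assms(4) by (auto simp: level_union_def)
  obtain f' where "f' \<in> P (max n m)" "\<psi> (max n m) f' = a"
    using lift_level[of n "max n m" f P] f assms(1) by (auto simp: stable_def)
  moreover obtain g' where "g' \<in> Q (max n m)" "\<psi> (max n m) g' = b"
    using lift_level[of m "max n m" g Q] g assms(2) by (auto simp: stable_def)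
  ultimately show thesis
    using that[of "max n m" f' g'] f g assms(1,2) by (auto simp: stable_def)
qed

lemma level_unionI: "n \<ge> 1 \<Longrightarrow> f \<in> P n \<Longrightarrow> \<psi> n f \<in> level_union P"
  by (auto simp: level_union_def)

lemma lim_closed:
  assumes "stable P"
  shows "(\<And>n f g. f \<in> P n \<Longrightarrow> g \<in> P n \<Longrightarrow> elt_add f g \<in> P n) \<Longrightarrow>
      a \<in> closure (level_union P) \<Longrightarrow> b \<in> closure (level_union P) \<Longrightarrow> a + b \<in> closure (level_union P)"
    "(\<And>n f g. f \<in> P n \<Longrightarrow> g \<in> P n \<Longrightarrow> elt_mult S n f g \<in> P n) \<Longrightarrow>
      a \<in> closure (level_union P) \<Longrightarrow> b \<in> closure (level_union P) \<Longrightarrow> a * b \<in> closure (level_union P)"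
    "(\<And>n f. f \<in> P n \<Longrightarrow> elt_scale z f \<in> P n) \<Longrightarrow>
      a \<in> closure (level_union P) \<Longrightarrow> scaleC z a \<in> closure (level_union P)"
proof -
  assume P: "\<And>n f g. f \<in> P n \<Longrightarrow> g \<in> P n \<Longrightarrow> elt_add f g \<in> P n"
  have cl: "a + b \<in> level_union P" if "a \<in> level_union P" "b \<in> level_union P" for a b
    using common_level[OF assms assms that] hom(1) level_unionI[of _ _ P] P by metis
  show "a \<in> closure (level_union P) \<Longrightarrow> b \<in> closure (level_union P) \<Longrightarrow> a + b \<in> closure (level_union P)"
    by (rule closure_binary[OF _ cl]) (auto simp: case_prod_unfold intro!: continuous_intros)
next
  assume P: "\<And>n f g. f \<in> P n \<Longrightarrow> g \<in> P n \<Longrightarrow> elt_mult S n f g \<in> P n"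
  have cl: "a * b \<in> level_union P" if "a \<in> level_union P" "b \<in> level_union P" for a b
    using common_level[OF assms assms that] hom(2) level_unionI[of _ _ P] P by metis
  show "a \<in> closure (level_union P) \<Longrightarrow> b \<in> closure (level_union P) \<Longrightarrow> a * b \<in> closure (level_union P)"
    by (rule closure_binary[OF _ cl]) (auto simp: case_prod_unfold intro!: continuous_intros)
next
  assume P: "\<And>n f. f \<in> P n \<Longrightarrow> elt_scale z f \<in> P n"
  have cl: "scaleC z a \<in> level_union P" if "a \<in> level_union P" for a
    using common_level[OF assms assms that that] hom(3) level_unionI[of _ _ P] P by metis
  show "a \<in> closure (level_union P) \<Longrightarrow> scaleC z a \<in> closure (level_union P)"
    by (rule closure_unary[OF continuous_on_scaleC cl])
qed

sublocale unital_inclusion A C un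
proof
  show "closed C" by (simp add: lim_eq)
  show "a * b \<in> A" if "a \<in> A" "b \<in> A" for a b
    using lim_closed(2)[OF stable(1)] elt_mult_alg that unfolding lim_eq by blast
  show "c \<in> A" if "c \<in> C" for c
  proof -
    have "level_union dalg \<subseteq> level_union alg" by (auto simp: level_union_def dalgD)
    then show ?thesis using that closure_mono unfolding lim_eq by blast
  qed
  show "c + d \<in> C" "c * d \<in> C" if "c \<in> C" "d \<in> C" for c d
    using lim_closed(1,2)[OF stable(2)] dalg_closed that unfolding lim_eq by blast+
  show "scaleC z c \<in> C" if "c \<in> C" for z c
    using lim_closed(3)[OF stable(2)] dalg_closed(3) that unfolding lim_eq by blast
  show "c * d = d * c" if "c \<in> C" "d \<in> C" for c d
  proof -
    have eq: "a * b = b * a" if ab: "a \<in> level_union dalg" "b \<in> level_union dalg" for a b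
    proof -
      obtain n f g where "n \<ge> 1" "f \<in> dalg n" "g \<in> dalg n" "f \<in> alg n" "g \<in> alg n" "a = \<psi> n f" "b = \<psi> n g"
        using common_level[OF stable(2) stable(2) ab] .
      moreover have "elt_mult S n f g = elt_mult S n g f"
        using calculation by (simp add: elt_mult_dalg mult.commute)
      ultimately show ?thesis using hom(2) by metis
    qed
    \<comment> \<open>Commutativity is extended to the closure one variable at a time.\<close>
    have "c * b = b * c" if "b \<in> level_union dalg" for b
      by (rule closure_eq[OF _ _ eq[OF _ that]])
        (use \<open>c \<in> C\<close> in \<open>auto simp: lim_eq intro!: continuous_intros\<close>)
    then show ?thesis
      by (rule closure_eq[rotated 2]) (use \<open>d \<in> C\<close> in \<open>auto simp: lim_eq intro!: continuous_intros\<close>)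
  qed
  show "un \<in> C"
    using level_unionI[of 1 "elt_unit S 1" dalg] elt_unit_dalg closure_subset
    unfolding lim_eq un_def by blast
  show "star un = un"
    using hom(4)[of 1 "elt_unit S 1"] elt_unit_alg elt_star_unit by (simp add: un_def)
  have lu: "un * a = a \<and> a * un = a" if a: "a \<in> level_union alg" for a
  proof -
    obtain n f where f: "n \<ge> 1" "f \<in> alg n" "a = \<psi> n f" using a by (auto simp: level_union_def)
    show ?thesis
      using hom(2)[OF f(1) f(2) elt_unit_alg] hom(2)[OF f(1) elt_unit_alg f(2)]
        elt_mult_unit[OF f(2)] hom_unit[OF f(1)] f(3) by simp
  qed
  show "un * a = a" "a * un = a" if "a \<in> A" for a
    by (rule closure_eq[of _ _ "level_union alg"];
        use lu that in \<open>auto simp: lim_eq intro!: continuous_intros\<close>)+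
qed

lemma in_C: "n \<ge> 1 \<Longrightarrow> f \<in> dalg n \<Longrightarrow> \<psi> n f \<in> C"
  using level_unionI[of n f dalg] closure_subset unfolding lim_eq by blast

lemma in_A: "n \<ge> 1 \<Longrightarrow> f \<in> alg n \<Longrightarrow> \<psi> n f \<in> A"
  using level_unionI[of n f alg] closure_subset unfolding lim_eq by blast

lemma in_B: "n \<ge> 1 \<Longrightarrow> f \<in> const_alg S n \<Longrightarrow> \<psi> n f \<in> B"
  using level_unionI[of n f "const_alg S"] closure_subset unfolding lim_eq by blast

text \<open>For \<open>c\<close> from a stage, \<open>c\<close> and \<open>f\<close> are lifted to a
  common stage, where \<open>f\<close> is still monomial and \<open>monomial_conj_diag\<close>
  applies. Conjugation is continuous, which covers the closure.\<close>

lemma monomial_normaliser: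
  assumes "n \<ge> 1" "f \<in> monomial_alg n"
  shows "\<psi> n f \<in> normalisers A C"
proof -
  let ?v = "\<psi> n f"
  have v: "?v \<in> level_union monomial_alg" using assms level_unionI by blast
  have cl: "?v * c * star ?v \<in> level_union dalg \<and> star ?v * c * ?v \<in> level_union dalg"
    if c: "c \<in> level_union dalg" for c
  proof -
    obtain l g d where g: "l \<ge> 1" "g \<in> monomial_alg l" "d \<in> dalg l" "g \<in> alg l" "d \<in> alg l"
      "?v = \<psi> l g" "c = \<psi> l d"
      using common_level[OF stable(4) stable(2) v c] .
    show ?thesis unfolding g(6,7)
      using monomial_conj_diag[OF g(2,3), THEN level_unionI[OF g(1), of _ dalg]]
        hom(2,4)[OF g(1)] g elt_mult_alg elt_star_alg by simp
  qed
  have "?v * c * star ?v \<in> C \<and> star ?v * c * ?v \<in> C" if "c \<in> C" for c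
    using closure_unary[of "\<lambda>c. ?v * c * star ?v" "level_union dalg" "level_union dalg" c]
      closure_unary[of "\<lambda>c. star ?v * c * ?v" "level_union dalg" "level_union dalg" c] cl that
    by (simp add: lim_eq continuous_intros)
  moreover have "?v \<in> A" using assms in_A by (simp add: monomial_alg_def)
  ultimately show ?thesis by (simp add: normalisers_def)
qed

section \<open>Matrix units in the limit\<close>

lemma path_pairsD:
  assumes "(p, q) \<in> PP"
  shows "length p \<ge> 1" "p \<in> fin_paths S (length p)" "q \<in> fin_paths S (length p)" "tgt p = tgt q"
    "length q = length p"
  using assms by (auto simp: path_pairs_def fin_paths_def)

lemma path_pairsI:
  "n \<ge> 1 \<Longrightarrow> p \<in> fin_paths S n \<Longrightarrow> q \<in> fin_paths S n \<Longrightarrow> tgt p = tgt q \<Longrightarrow> (p, q) \<in> PP"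
  by (auto simp: path_pairs_def)

lemma path_pairs_refl: "n \<ge> 1 \<Longrightarrow> p \<in> fin_paths S n \<Longrightarrow> (p, p) \<in> PP"
  by (rule path_pairsI) auto

lemma path_pairs_sym: "(p, q) \<in> PP \<Longrightarrow> (q, p) \<in> PP"
  by (auto simp: path_pairs_def)

lemma path_pairs_diag: "(p, q) \<in> PP \<Longrightarrow> (p, p) \<in> PP" "(p, q) \<in> PP \<Longrightarrow> (q, q) \<in> PP"
  by (auto simp: path_pairs_def)

lemma E_eq: "p \<in> fin_paths S n \<Longrightarrow> E p q = \<psi> n (matrix_unit S p q)"
  by (simp add: ind_cyl_def fin_paths_def)

lemma E_normaliser: "(p, q) \<in> PP \<Longrightarrow> E p q \<in> normalisers A C"
  using path_pairsD[of p q] monomial_normaliser matrix_unit_monomial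
  by (simp add: ind_cyl_def)

lemma E_star: "(p, q) \<in> PP \<Longrightarrow> star (E p q) = E q p"
  using path_pairsD[of p q] hom(4)[of "length p" "matrix_unit S p q"]
    matrix_unit_alg[of "length p" p q] elt_star_matrix_unit[of "length p" p q]
  by (simp add: ind_cyl_def)

lemma E_mult:
  assumes "(p, q) \<in> PP" "(q, r) \<in> PP"
  shows "E p q * E q r = E p r"
proof -
  note p = path_pairsD[OF assms(1)] and q = path_pairsD[OF assms(2)]
  let ?n = "length p"
  have r: "r \<in> fin_paths S ?n" "q \<in> fin_paths S ?n" "tgt p = tgt r" using p q by auto
  have "elt_mult S ?n (matrix_unit S p q) (matrix_unit S q r) = matrix_unit S p r"
    unfolding matrix_unit_mult_left[OF p(1-4)]
    using p q by (auto simp: fun_eq_iff matrix_unit_def)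
  then show ?thesis
    using hom(2)[OF p(1) matrix_unit_alg[OF p(1-4)] matrix_unit_alg[OF p(1) r(2,1) q(4)]]
    by (simp add: E_eq[OF p(2)] E_eq[OF p(3)])
qed

lemma E_diag:
  assumes "(p, p) \<in> PP"
  shows "E p p \<in> C" "E p p \<in> B" "star (E p p) = E p p" "star (E p p) \<in> C"
proof -
  note p = path_pairsD[OF assms]
  show "E p p \<in> C" "E p p \<in> B" "star (E p p) = E p p"
    using in_C[OF p(1) matrix_unit_dalg[OF p(1,2)]] in_B[OF p(1) matrix_unit_const[OF p(1,2,2) refl]]
      E_star[OF assms]
    by (simp_all add: ind_cyl_def)
  then show "star (E p p) \<in> C" by simp
qed

lemma E_source: "(p, q) \<in> PP \<Longrightarrow> star (E p q) * E p q = E q q"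
  using E_mult[of q p q] E_star path_pairs_sym by simp

text \<open>\<open>E q q\<close> is a projection, so by the C*-identity its norm equals its own
  square; the norm of \<open>E p q\<close> is then controlled by its source projection.\<close>

lemma norm_E_le_1:
  assumes "(p, q) \<in> PP" shows "norm (E p q) \<le> 1"
proof -
  have qq: "(q, q) \<in> PP" using assms by (rule path_pairs_diag)
  have "(norm (E q q))\<^sup>2 = norm (E q q)"
    using cstar_identity[of "E q q"] E_source[OF qq] by simp
  then have "norm (E q q) \<le> 1"
    by (cases "norm (E q q) = 0") (simp_all add: power2_eq_square)
  then have "(norm (E p q))\<^sup>2 \<le> 1"
    using cstar_identity[of "E p q"] E_source[OF assms] by simp
  then show ?thesis using power2_le_imp_le[of "norm (E p q)" 1] by simp
qed

lemma E_snoc: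
  assumes "(p, q) \<in> PP" "(p @ [d], q @ [d]) \<in> PP"
  shows "E p q * E (q @ [d]) (q @ [d]) = E (p @ [d]) (q @ [d])"
proof -
  note p = path_pairsD[OF assms(1)] and pd = path_pairsD[OF assms(2)]
  let ?n = "length p"
  have pd': "p @ [d] \<in> fin_paths S (Suc ?n)" "q @ [d] \<in> fin_paths S (Suc ?n)"
    using pd by simp_all
  have "matrix_unit S p q \<in> alg ?n" by (rule matrix_unit_alg[OF p(1-4)])
  moreover have "matrix_unit S (q @ [d]) (q @ [d]) \<in> alg (Suc ?n)"
    by (rule matrix_unit_alg) (use pd' in auto)
  ultimately have "E p q * E (q @ [d]) (q @ [d]) = \<psi> (Suc ?n)
      (elt_mult S (Suc ?n) (ah_map S ?n (matrix_unit S p q)) (matrix_unit S (q @ [d]) (q @ [d])))"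
    using hom(2)[of "Suc ?n"] hom(5)[OF p(1)] ah_map_alg[OF p(1)] p(5)
    by (simp add: ind_cyl_def)
  then show ?thesis
    using matrix_unit_snoc[OF p(1-4) pd'] by (simp add: ind_cyl_def)
qed

section \<open>Characters, paths and the anchor map\<close>

lemma char_kernel_sum:
  assumes \<theta>: "\<theta> \<in> spectrum C" and n: "n \<ge> 1"
    and "finite F" "F \<subseteq> {f \<in> dalg n. \<theta> (\<psi> n f) = 0}"
  shows "\<exists>G\<in>dalg n. \<theta> (\<psi> n G) = 0 \<and>
    (\<forall>i x r. Re (G i x r r) \<ge> 0 \<and> (\<forall>f\<in>F. f i x r r \<noteq> 0 \<longrightarrow> Re (G i x r r) > 0))"
  using assms(3,4)
proof (induction F rule: finite_induct)
  case empty
  have "elt_scale 0 (elt_unit S n) \<in> dalg n" using dalg_closed(3) elt_unit_dalg by blast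
  moreover have "\<theta> (\<psi> n (elt_scale 0 (elt_unit S n))) = 0"
    using hom(3)[OF n elt_unit_alg] char_scale[OF \<theta> unit_in] hom_unit[OF n] by simp
  ultimately show ?case by (intro bexI[of _ "elt_scale 0 (elt_unit S n)"]) (simp_all add: elt_scale_def)
next
  case (insert f F)
  then obtain G where G: "G \<in> dalg n" "\<theta> (\<psi> n G) = 0" and
    "\<forall>i x r. Re (G i x r r) \<ge> 0 \<and> (\<forall>f\<in>F. f i x r r \<noteq> 0 \<longrightarrow> Re (G i x r r) > 0)"
    by blast
  then have pos: "Re (G i x r r) \<ge> 0" "g \<in> F \<Longrightarrow> g i x r r \<noteq> 0 \<Longrightarrow> Re (G i x r r) > 0" for i x r g
    by blast+
  have f: "f \<in> dalg n" "\<theta> (\<psi> n f) = 0" using insert.prems by auto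
  \<comment> \<open>The kernel is an ideal, so it contains this product whatever
    \<open>\<theta>\<close> does to adjoints. Its diagonal entries are the squared moduli of those
    of \<open>f\<close>, so nothing cancels in the sum.\<close>
  let ?H = "elt_mult S n (elt_star f) f"
  have sf: "elt_star f \<in> dalg n" using dalg_closed(4) f(1) by blast
  have H: "?H \<in> dalg n" using dalg_closed(2) f(1) sf by blast
  have "\<theta> (\<psi> n ?H) = 0"
    using hom(2)[OF n dalgD(1)[OF sf] dalgD(1)[OF f(1)]] char_mult[OF \<theta>] in_C[OF n] sf f by simp
  moreover have "\<psi> n (elt_add G ?H) = \<psi> n G + \<psi> n ?H"
    using hom(1)[OF n] dalgD(1) G(1) H by blast
  ultimately have "\<theta> (\<psi> n (elt_add G ?H)) = 0"
    using char_add[OF \<theta> in_C[OF n G(1)] in_C[OF n H]] G(2) by simp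
  moreover have "elt_add G ?H i x r r = G i x r r + of_real ((cmod (f i x r r))\<^sup>2)" for i x r
    unfolding elt_add_def elt_mult_dalg[OF sf f(1)]
    unfolding elt_star_def complex_norm_square by (simp add: mult.commute)
  moreover have "elt_add G ?H \<in> dalg n" using dalg_closed(1) G(1) H by blast
  ultimately show ?case
    using pos by (intro bexI[of _ "elt_add G ?H"]) (auto intro: add_nonneg_pos add_pos_nonneg)
qed

text \<open>Otherwise, by compactness, finitely many elements of the kernel have no common zero, and the
  sum of their squared absolute values is an invertible element of the kernel.\<close>

lemma char_is_evaluation:
  assumes \<theta>: "\<theta> \<in> spectrum C" and n: "n \<ge> 1"
  obtains i x r where "i \<in> {1..N n}" "x \<in> topspace (X n i)" "r \<in> {1..k n i}"
    "\<And>f. f \<in> dalg n \<Longrightarrow> \<theta> (\<psi> n f) = f i x r r"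
proof (rule ccontr)
  assume "\<not> thesis"
  note neg = this and this_that = that
  let ?K = "{f \<in> dalg n. \<theta> (\<psi> n f) = 0}"
  have ex: "\<exists>g\<in>?K. g i x r r \<noteq> 0" if pt: "i \<in> {1..N n}" "x \<in> topspace (X n i)" "r \<in> {1..k n i}" for i x r
  proof -
    obtain f where f: "f \<in> dalg n" "\<theta> (\<psi> n f) \<noteq> f i x r r"
      using neg this_that[OF pt] by blast
    \<comment> \<open>Subtracting the constant \<open>\<theta> (\<psi> n f)\<close> moves
      \<open>f\<close> into the kernel and keeps it nonzero at the given point.\<close>
    let ?u = "elt_scale (- \<theta> (\<psi> n f)) (elt_unit S n)"
    have u: "?u \<in> dalg n" using dalg_closed(3) elt_unit_dalg by blast
    have "\<theta> (\<psi> n ?u) = - \<theta> (\<psi> n f)"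
      using hom(3)[OF n elt_unit_alg] char_scale[OF \<theta> unit_in] hom_unit[OF n] char_unit[OF \<theta>] by simp
    then have "\<theta> (\<psi> n (elt_add f ?u)) = 0"
      using hom(1)[OF n dalgD(1)[OF f(1)] dalgD(1)[OF u]] char_add[OF \<theta> in_C[OF n f(1)] in_C[OF n u]]
      by simp
    moreover have "elt_add f ?u i x r r \<noteq> 0"
      using f(2) pt by (simp add: elt_add_def elt_scale_def elt_unit_def)
    moreover have "elt_add f ?u \<in> dalg n" using dalg_closed(1) f(1) u by blast
    ultimately show ?thesis by blast
  qed
  have "\<exists>F. finite F \<and> F \<subseteq> ?K \<and> (\<forall>x\<in>topspace (X n i). \<exists>g\<in>F. g i x r r \<noteq> 0)"
    if ir: "i \<in> {1..N n}" "r \<in> {1..k n i}" for i r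
  proof -
    let ?O = "\<lambda>g::'x elt. {x \<in> topspace (X n i). g i x r r \<noteq> 0}"
    have op: "openin (X n i) (?O g)" if "g \<in> ?K" for g
    proof -
      have "g \<in> alg n" using that dalgD(1) by blast
      from openin_continuous_map_preimage[OF alg_continuous[OF this ir(1), of r r], of "- {0}"]
      show ?thesis by auto
    qed
    have "topspace (X n i) \<subseteq> \<Union> (?O ` ?K)" using ex[OF ir(1) _ ir(2)] by auto
    moreover have "\<forall>U\<in>?O ` ?K. openin (X n i) U" using op by blast
    ultimately obtain \<F> where \<F>: "finite \<F>" "\<F> \<subseteq> ?O ` ?K" "topspace (X n i) \<subseteq> \<Union> \<F>"
      using spaces(1)[OF n ir(1), unfolded compact_space_alt, rule_format, of "?O ` ?K"] by blast
    obtain F where F: "F \<subseteq> ?K" "finite F" "\<F> = ?O ` F"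
      using finite_subset_image[OF \<F>(1,2)] by blast
    have "\<exists>g\<in>F. g i x r r \<noteq> 0" if "x \<in> topspace (X n i)" for x
      using \<F>(3) that unfolding F(3) by blast
    then show ?thesis using F(1,2) by blast
  qed
  note sel = this
  define F where "F b = (SOME F. finite F \<and> F \<subseteq> ?K \<and>
      (\<forall>x\<in>topspace (X n (fst b)). \<exists>g\<in>F. g (fst b) x (snd b) (snd b) \<noteq> 0))" for b
  have F: "finite (F (i, r)) \<and> F (i, r) \<subseteq> ?K \<and> (\<forall>x\<in>topspace (X n i). \<exists>g\<in>F (i, r). g i x r r \<noteq> 0)"
    if "i \<in> {1..N n}" "r \<in> {1..k n i}" for i r
    using someI_ex[OF sel[OF that]] by (simp add: F_def)
  let ?F = "\<Union>b\<in>(SIGMA i:{1..N n}. {1..k n i}). F b"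
  have "finite (F b) \<and> F b \<subseteq> ?K" if b: "b \<in> (SIGMA i:{1..N n}. {1..k n i})" for b
  proof -
    obtain i r where "b = (i, r)" "i \<in> {1..N n}" "r \<in> {1..k n i}" using b by auto
    then show ?thesis using F[of i r] by simp
  qed
  then have "finite ?F" "?F \<subseteq> ?K" by (intro finite_UN_I finite_SigmaI UN_least; simp)+
  from char_kernel_sum[OF \<theta> n this] obtain G where G: "G \<in> dalg n" "\<theta> (\<psi> n G) = 0"
    "\<forall>i x r. Re (G i x r r) \<ge> 0 \<and> (\<forall>g\<in>?F. g i x r r \<noteq> 0 \<longrightarrow> Re (G i x r r) > 0)"
    by (elim bexE conjE) metis
  have pos: "G i x r r \<noteq> 0" if pt: "i \<in> {1..N n}" "x \<in> topspace (X n i)" "r \<in> {1..k n i}" for i x r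
  proof -
    obtain g where g: "g \<in> F (i, r)" "g i x r r \<noteq> 0" using F[OF pt(1,3)] pt(2) by blast
    moreover have "g \<in> ?F" using g(1) pt by blast
    ultimately have "Re (G i x r r) > 0" using G(3) by blast
    then show ?thesis by auto
  qed
  \<comment> \<open>Since \<open>inverse 0 = 0\<close>, the entrywise inverse vanishes off the
    diagonal and outside the spaces, as membership in \<open>dalg n\<close> demands.\<close>
  let ?H = "\<lambda>i x r c. inverse (G i x r c)"
  have H: "?H \<in> dalg n"
  proof (intro dalgI algI)
    fix i r c assume ir: "i \<in> {1..N n}" "r \<in> {1..k n i}" "c \<in> {1..k n i}"
    show "continuous_map (X n i) euclidean (\<lambda>x. ?H i x r c)"
    proof (cases "r = c")
      case True
      then show ?thesis
        using alg_continuous[OF dalgD(1)[OF G(1)] ir(1), of r r] pos[OF ir(1) _ ir(2)]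
        unfolding continuous_map_atin by (auto intro!: tendsto_inverse)
    qed (simp add: dalgD(2)[OF G(1)])
  next
    show "i \<in> {1..N n} \<and> x \<in> topspace (X n i) \<and> r \<in> {1..k n i} \<and> c \<in> {1..k n i}"
      if "?H i x r c \<noteq> 0" for i x r c
      using that algD[OF dalgD(1)[OF G(1)], of i x r c] by auto
  qed (simp add: dalgD(2)[OF G(1)])
  have "elt_mult S n G ?H = elt_unit S n"
    unfolding elt_mult_dalg[OF G(1) H]
  proof (intro ext)
    fix i x r c
    show "G i x r c * inverse (G i x r c) = elt_unit S n i x r c"
      using pos[of i x r] algD[OF dalgD(1)[OF G(1)], of i x r c] dalgD(2)[OF G(1), of r c i x]
      by (cases "G i x r c = 0") (auto simp: elt_unit_def)
  qed
  then have "\<psi> n G * \<psi> n ?H = un"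
    using hom(2)[OF n dalgD(1)[OF G(1)] dalgD(1)[OF H]] hom_unit[OF n] by simp
  then show False
    using char_mult[OF \<theta> in_C[OF n G(1)] in_C[OF n H]] G(2) char_unit[OF \<theta>] by simp
qed

text \<open>The character is evaluation at some diagonal position; the path with that index is the
  only one whose diagonal unit is nonzero there.\<close>

lemma char_level_path:
  assumes \<theta>: "\<theta> \<in> spectrum C" and n: "n \<ge> 1"
  shows "\<exists>p\<in>fin_paths S n. \<forall>q\<in>fin_paths S n. \<theta> (E q q) = (if p = q then 1 else 0)"
proof -
  obtain i x r where pt: "i \<in> {1..N n}" "x \<in> topspace (X n i)" "r \<in> {1..k n i}"
    "\<And>f. f \<in> dalg n \<Longrightarrow> \<theta> (\<psi> n f) = f i x r r"
    using char_is_evaluation[OF \<theta> n] by blast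
  obtain p where p: "p \<in> fin_paths S n" "tgt p = i" "path_index S p = r"
    using path_index_surj[OF n pt(1,3)] by blast
  have "\<theta> (E q q) = (if p = q then 1 else 0)" if q: "q \<in> fin_paths S n" for q
  proof -
    have "\<theta> (E q q) = matrix_unit S q q i x r r"
      using pt(4)[OF matrix_unit_dalg[OF n q]] by (simp add: E_eq[OF q])
    also have "\<dots> = (if p = q then 1 else 0)"
      using q p pt(2) path_index_inj[OF n p(1) q]
      by (auto simp: matrix_unit_def fin_paths_def)
    finally show ?thesis .
  qed
  then show ?thesis using p(1) by blast
qed

lemma initial_Suc: "initial (Suc n) x = initial n x @ [x n]"
  by (simp add: initial_def)

lemma length_initial [simp]: "length (initial n x) = n"
  by (simp add: initial_def)

lemma initial_nth: "m < n \<Longrightarrow> initial n x ! m = x m"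
  by (simp add: initial_def)

lemma inf_paths_iff: "x \<in> inf_paths S \<longleftrightarrow> (\<forall>n\<ge>1. initial n x \<in> fin_paths S n)"
proof
  assume R: "\<forall>n\<ge>1. initial n x \<in> fin_paths S n"
  have "x m \<in> edges S m \<and> edge_tgt (x m) = edge_src (x (Suc m))" for m
  proof -
    have "initial (Suc (Suc m)) x \<in> fin_paths S (Suc (Suc m))" using R by simp
    then have "initial (Suc (Suc m)) x ! m \<in> edges S m"
      "edge_tgt (initial (Suc (Suc m)) x ! m) = edge_src (initial (Suc (Suc m)) x ! Suc m)"
      by (simp_all add: fin_paths_def)
    then show ?thesis by (simp add: initial_nth)
  qed
  then show "x \<in> inf_paths S" by (simp add: inf_paths_def)
qed (auto simp: inf_paths_def fin_paths_def initial_nth)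

lemma char_inf_path:
  assumes \<theta>: "\<theta> \<in> spectrum C"
  shows "\<exists>x\<in>inf_paths S. \<forall>n\<ge>1. \<forall>q\<in>fin_paths S n. \<theta> (E q q) = (if initial n x = q then 1 else 0)"
proof -
  have "\<forall>n\<in>{1..}. \<exists>p. p \<in> fin_paths S n \<and> (\<forall>q\<in>fin_paths S n. \<theta> (E q q) = (if p = q then 1 else 0))"
  proof
    fix n :: nat assume "n \<in> {1..}"
    then have "n \<ge> 1" by simp
    from char_level_path[OF \<theta> this] show "\<exists>p. p \<in> fin_paths S n \<and>
        (\<forall>q\<in>fin_paths S n. \<theta> (E q q) = (if p = q then 1 else 0))" by blast
  qed
  from bchoice[OF this] obtain P where P: "\<And>n. n \<ge> 1 \<Longrightarrow> P n \<in> fin_paths S n"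
    "\<And>n q. n \<ge> 1 \<Longrightarrow> q \<in> fin_paths S n \<Longrightarrow> \<theta> (E q q) = (if P n = q then 1 else 0)" by auto
  have snoc: "P (Suc n) = P n @ [last (P (Suc n))]" if n: "n \<ge> 1" for n
  proof -
    have "P (Suc n) \<in> fin_paths S (Suc n)" by (rule P) simp
    then obtain q d where q: "P (Suc n) = q @ [d]" "q \<in> fin_paths S n" by (rule fin_pathsE)
    have qq: "(q, q) \<in> PP" "(q @ [d], q @ [d]) \<in> PP"
      using path_pairs_refl n q P(1)[of "Suc n"] by (auto intro: path_pairs_refl[of "Suc n"])
    \<comment> \<open>\<open>E (q @ [d]) (q @ [d])\<close> is a subprojection of
      \<open>E q q\<close>. As \<open>\<theta>\<close> is 1 on the former it cannot vanish on the
      latter, so the paths found at consecutive levels extend each other.\<close>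
    have "\<theta> (E q q) * \<theta> (E (q @ [d]) (q @ [d])) = \<theta> (E (q @ [d]) (q @ [d]))"
      using E_snoc[OF qq] char_mult[OF \<theta>] E_diag(1) qq by metis
    moreover have "\<theta> (E (q @ [d]) (q @ [d])) = 1" using P[of "Suc n"] q by simp
    ultimately have "P n = q" using P(2)[OF n q(2)] by (auto split: if_splits)
    then show ?thesis using q by simp
  qed
  define x where "x m = last (P (Suc m))" for m
  have init: "initial n x = P n" if "n \<ge> 1" for n
    using that
  proof (induction n rule: nat_induct_at_least)
    case base
    have "length (P 1) = 1" using P(1)[of 1] by (simp add: fin_paths_def)
    then show ?case by (auto simp: initial_def x_def length_Suc_conv)
  next
    case (Suc n)
    then show ?case using snoc[of n] by (simp add: initial_Suc x_def)
  qed
  then show ?thesis using P by (intro bexI[of _ x]) (simp_all add: inf_paths_iff)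
qed

lemma inf_path_eqI:
  assumes "\<And>n. n \<ge> n0 \<Longrightarrow> initial n x = initial n y"
  shows "x = y"
proof
  fix m
  have "initial (max n0 (Suc m)) x ! m = initial (max n0 (Suc m)) y ! m" using assms by simp
  then show "x m = y m" by (simp add: initial_nth)
qed

lemma restrict_char:
  assumes \<theta>: "\<theta> \<in> spectrum C"
  shows "restrict \<theta> (C \<inter> B) \<in> spectrum (C \<inter> B)"
proof -
  have B: "a + b \<in> B" "a * b \<in> B" if "a \<in> B" "b \<in> B" for a b
    using lim_closed(1,2)[OF stable(3)] const_alg_closed(1,2) that unfolding lim_eq by blast+
  have B': "scaleC z a \<in> B" if "a \<in> B" for a z
    using lim_closed(3)[OF stable(3)] const_alg_closed(3) that unfolding lim_eq by blast
  have "un \<in> C \<inter> B"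
    using in_B[of 1, OF _ elt_unit_const] unit_in by (simp add: un_def)
  then have "\<exists>a\<in>C \<inter> B. restrict \<theta> (C \<inter> B) a \<noteq> 0"
    using char_unit[OF \<theta>] by (intro bexI[of _ un]) simp_all
  then show ?thesis
    by (simp add: spectrum_def B B' C_add C_mult C_scale char_add[OF \<theta>] char_mult[OF \<theta>] char_scale[OF \<theta>])
qed

text \<open>Resolves the description in \<open>anchor\<close>: the values on the diagonal units
  determine every initial segment. Later arguments use the anchor only through these two
  facts.\<close>

lemma anchor:
  assumes \<theta>: "\<theta> \<in> spectrum C"
  shows "anchor S \<psi> \<theta> \<in> inf_paths S"
    "n \<ge> 1 \<Longrightarrow> q \<in> fin_paths S n \<Longrightarrow> \<theta> (E q q) = (if initial n (anchor S \<psi> \<theta>) = q then 1 else 0)"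
proof -
  let ?P = "\<lambda>x. x \<in> inf_paths S \<and> is_path_eval S \<psi> x (restrict \<theta> (C \<inter> B))"
  have E: "E q q \<in> C \<inter> B" if "n \<ge> 1" "q \<in> fin_paths S n" for n q
    using E_diag path_pairs_refl that by blast
  have iff: "?P x \<longleftrightarrow> x \<in> inf_paths S \<and>
      (\<forall>n\<ge>1. \<forall>q\<in>fin_paths S n. \<theta> (E q q) = (if initial n x = q then 1 else 0))" for x
    using restrict_char[OF \<theta>] E by (auto simp: is_path_eval_def)
  have "\<exists>!x. ?P x"
  proof (rule ex_ex1I)
    show "\<exists>x. ?P x" unfolding iff using char_inf_path[OF \<theta>] by blast
    fix x y assume xP: "?P x" and yP: "?P y"
    note x = xP[unfolded iff] and y = yP[unfolded iff]
    have xy: "initial n x \<in> fin_paths S n" "\<theta> (E q q) = (if initial n x = q then 1 else 0)"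
      "\<theta> (E q q) = (if initial n y = q then 1 else 0)" if "n \<ge> 1" "q \<in> fin_paths S n" for n q
      using conjunct1[OF x] conjunct2[OF x, rule_format, OF that] conjunct2[OF y, rule_format, OF that] that(1)
      by (simp_all add: inf_paths_iff)
    show "x = y"
    proof (rule inf_path_eqI)
      show "initial n x = initial n y" if "n \<ge> 1" for n
        using xy(2,3)[OF that, of "initial n x"] conjunct1[OF x] that
        by (auto simp: inf_paths_iff split: if_splits)
    qed
  qed
  from theI'[OF this] have "?P (anchor S \<psi> \<theta>)" by (simp add: anchor_def)
  then show "anchor S \<psi> \<theta> \<in> inf_paths S"
    "n \<ge> 1 \<Longrightarrow> q \<in> fin_paths S n \<Longrightarrow> \<theta> (E q q) = (if initial n (anchor S \<psi> \<theta>) = q then 1 else 0)"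
    unfolding iff by simp_all
qed

lemma anchor_eqI:
  assumes \<theta>: "\<theta> \<in> spectrum C" and x: "x \<in> inf_paths S"
    and "\<And>n. n \<ge> n0 \<Longrightarrow> \<theta> (E (initial n x) (initial n x)) \<noteq> 0"
  shows "anchor S \<psi> \<theta> = x"
proof (rule inf_path_eqI)
  fix n assume "n \<ge> max 1 n0"
  then show "initial n (anchor S \<psi> \<theta>) = initial n x"
    using anchor(2)[OF \<theta>, of n "initial n x"] x assms(3)[of n] by (auto simp: inf_paths_iff split: if_splits)
qed

lemma ndom_E_iff:
  assumes "(p, q) \<in> PP"
  shows "\<theta> \<in> ndom C (E p q) \<longleftrightarrow> \<theta> \<in> spectrum C \<and> initial (length q) (anchor S \<psi> \<theta>) = q"
proof -
  have "length q \<ge> 1" "q \<in> fin_paths S (length q)" using path_pairsD[OF assms] by auto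
  then show ?thesis using anchor(2)[of \<theta>, of "length q" q] by (auto simp: ndom_def E_source[OF assms] split: if_splits)
qed

lemma char_E_eq_1:
  assumes "(p, q) \<in> PP" "\<theta> \<in> ndom C (E p q)"
  shows "\<theta> (E q q) = 1"
proof -
  have "length q \<ge> 1" "q \<in> fin_paths S (length q)" using path_pairsD[OF assms(1)] by auto
  then show ?thesis using anchor(2)[of \<theta>, of "length q" q] assms by (simp add: ndom_E_iff)
qed

lemma germ_base_E:
  "(p, q) \<in> PP \<Longrightarrow> (E p q, \<theta>) \<in> germ_base A C \<longleftrightarrow> \<theta> \<in> ndom C (E p q)"
  by (simp add: germ_base_def E_normaliser)

text \<open>The denominator is \<open>\<theta> (E q q)\<close>, which equals 1 on the domain, so the
  homeomorphism is literally the formula in \<open>act\<close>.\<close>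

lemma alpha_E:
  assumes "(p, q) \<in> PP" "\<theta> \<in> ndom C (E p q)"
  shows "alpha C (E p q) \<theta> = (\<lambda>c\<in>C. \<theta> (star (E p q) * c * E p q))"
proof
  fix c
  show "alpha C (E p q) \<theta> c = (\<lambda>c\<in>C. \<theta> (star (E p q) * c * E p q)) c"
  proof (cases "c \<in> C")
    case True
    then show ?thesis
      using alpha_apply[OF E_normaliser[OF assms(1)] assms(2)] char_E_eq_1[OF assms]
      by (simp add: E_source[OF assms(1)])
  next
    case False
    then show ?thesis
      using char_extensional[OF alpha_in_nran(2)[OF E_normaliser[OF assms(1)] assms(2)]]
      by (simp add: extensional_def)
  qed
qed

section \<open>Cylinders and the germs of matrix units\<close>

lemma cylD:
  assumes "(x, y) \<in> cyl S p q"
  shows "x \<in> inf_paths S" "y \<in> inf_paths S" "initial (length p) x = p" "initial (length q) y = q"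
    "m \<ge> length p \<Longrightarrow> x m = y m"
  using assms by (auto simp: cyl_def)

lemma initial_path_pair:
  assumes "x \<in> inf_paths S" "y \<in> inf_paths S" "n \<ge> 1" "x n = y n"
  shows "(initial n x, initial n y) \<in> PP"
proof (rule path_pairsI[OF assms(3)])
  show "initial n x \<in> fin_paths S n" "initial n y \<in> fin_paths S n"
    using assms by (simp_all add: inf_paths_iff)
  obtain m where "n = Suc m" using assms(3) by (cases n) auto
  then show "tgt (initial n x) = tgt (initial n y)"
    using assms by (simp add: initial_Suc inf_paths_def)
qed

text \<open>Longer initial segments of a pair in a cylinder give smaller cylinders around the pair.
  Any two cylinders around it can thus be compared at the greater length.\<close>

lemma cyl_initial:
  assumes pq: "(p, q) \<in> PP" and xy: "(x, y) \<in> cyl S p q" and n: "n \<ge> length p"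
  shows "(initial n x, initial n y) \<in> PP" "(x, y) \<in> cyl S (initial n x) (initial n y)"
    "cyl S (initial n x) (initial n y) \<subseteq> cyl S p q"
proof -
  note p = path_pairsD[OF pq]
  show "(initial n x, initial n y) \<in> PP"
    using cylD[OF xy] n p by (intro initial_path_pair) auto
  show "(x, y) \<in> cyl S (initial n x) (initial n y)"
    using cylD[OF xy] n by (auto simp: cyl_def)
  have init: "initial l z = initial l w" if "initial n z = initial n w" "l \<le> n"
    for z w :: "nat \<Rightarrow> 'e edge" and l
    using that by (auto simp: initial_def)
  show "cyl S (initial n x) (initial n y) \<subseteq> cyl S p q"
  proof clarify
    fix z w assume zw: "(z, w) \<in> cyl S (initial n x) (initial n y)"
    note D = cylD[OF zw, simplified]
    have "z m = w m" if "m \<ge> length p" for m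
    proof (cases "m < n")
      case True
      then have "z m = x m" "w m = y m" using D(3,4) by (metis initial_nth)+
      then show ?thesis using cylD(5)[OF xy that] by simp
    qed (use D(5) in simp)
    then show "(z, w) \<in> cyl S p q"
      using D init[of z x "length p"] init[of w y "length q"] cylD[OF xy] n p(5) by (simp add: cyl_def)
  qed
qed

lemma cyl_ndom:
  assumes "(p, q) \<in> PP" "(x, y) \<in> cyl S p q" "\<theta> \<in> spectrum C" "y = anchor S \<psi> \<theta>"
  shows "\<theta> \<in> ndom C (E p q)"
  using assms cylD(4) by (simp add: ndom_E_iff)

text \<open>By \<open>E_snoc\<close>, going one edge further multiplies the matrix unit by a
  diagonal projection whose domain contains \<open>\<theta>\<close>, and this does not change the
  germ.\<close>

lemma germ_E_initial:
  assumes "(p, q) \<in> PP" "(x, y) \<in> cyl S p q" "\<theta> \<in> spectrum C" "y = anchor S \<psi> \<theta>" "n \<ge> length p"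
  shows "germ A C (E (initial n x) (initial n y)) \<theta> = germ A C (E p q) \<theta>"
  using assms(5)
proof (induction n rule: dec_induct)
  case base
  then show ?case using cylD(3,4)[OF assms(2)] path_pairsD(5)[OF assms(1)] by simp
next
  case (step n)
  let ?p = "initial n x" and ?q = "initial n y"
  have pq: "(?p, ?q) \<in> PP" using cyl_initial[OF assms(1,2)] step.hyps by simp
  have "x n = y n" using cylD(5)[OF assms(2)] step.hyps by simp
  then have d: "initial (Suc n) x = ?p @ [y n]" "initial (Suc n) y = ?q @ [y n]"
    by (simp_all add: initial_Suc)
  have le: "length p \<le> Suc n" using step.hyps by simp
  have pqd: "(?p @ [y n], ?q @ [y n]) \<in> PP" "(x, y) \<in> cyl S (?p @ [y n]) (?q @ [y n])"
    using cyl_initial(1,2)[OF assms(1,2) le] d by simp_all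
  have "\<theta> \<in> ndom C (E ?p ?q * E (?q @ [y n]) (?q @ [y n]))"
    unfolding E_snoc[OF pq pqd(1)] by (rule cyl_ndom[OF pqd assms(3,4)])
  from germ_mult_diagonal(1)[OF E_normaliser[OF pq] E_diag(1,4)[OF path_pairs_diag(2)[OF pqd(1)]] this]
  show ?case using step.IH unfolding E_snoc[OF pq pqd(1)] d by simp
qed

lemma germ_E_unique:
  assumes "(p, q) \<in> PP" "(x, y) \<in> cyl S p q" "(p', q') \<in> PP" "(x, y) \<in> cyl S p' q'"
    and "\<theta> \<in> spectrum C" "y = anchor S \<psi> \<theta>"
  shows "germ A C (E p q) \<theta> = germ A C (E p' q') \<theta>"
  using germ_E_initial[OF assms(1,2,5,6) max.cobounded1[of "length p" "length p'"]]
    germ_E_initial[OF assms(3,4,5,6) max.cobounded2[of "length p'" "length p"]] by (rule trans[OF sym])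

lemma anchor_alpha_E:
  assumes "(p, q) \<in> PP" "(x, y) \<in> cyl S p q" "\<theta> \<in> spectrum C" "y = anchor S \<psi> \<theta>"
  shows "anchor S \<psi> (alpha C (E p q) \<theta>) = x"
proof (rule anchor_eqI)
  note dom = cyl_ndom[OF assms]
  show "alpha C (E p q) \<theta> \<in> spectrum C"
    using alpha_in_nran(2)[OF E_normaliser[OF assms(1)] dom] .
  show "x \<in> inf_paths S" using cylD(1)[OF assms(2)] .
  fix n assume n: "n \<ge> length p"
  let ?p = "initial n x" and ?q = "initial n y"
  note pq = cyl_initial(1,2)[OF assms(1,2) n]
  have dom': "\<theta> \<in> ndom C (E ?p ?q)" using cyl_ndom[OF pq assms(3,4)] .
  have gb: "(E p q, \<theta>) \<in> germ_base A C" "(E ?p ?q, \<theta>) \<in> germ_base A C"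
    using germ_base_E[OF assms(1)] germ_base_E[OF pq(1)] dom dom' by blast+
  \<comment> \<open>The germ is the same at every greater length, so the image can be tested on
    \<open>E ?p ?p\<close> with a matrix unit of matching length.\<close>
  have eq: "alpha C (E ?p ?q) \<theta> = alpha C (E p q) \<theta>"
    by (rule germ_eqD(2)[OF gb(2,1) germ_E_initial[OF assms n]])
  \<comment> \<open>The range projection is conjugated to the source projection, where
    \<open>\<theta>\<close> is 1; so the image character does not vanish on any long initial segment
    of \<open>x\<close>.\<close>
  have "star (E ?p ?q) * E ?p ?p * E ?p ?q = E ?q ?q"
    using E_mult[OF path_pairs_diag(1)[OF pq(1)] pq(1)] E_source[OF pq(1)] by (simp add: mult.assoc)
  then show "alpha C (E p q) \<theta> (E ?p ?p) \<noteq> 0"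
    unfolding eq[symmetric] alpha_E[OF pq(1) dom']
    using char_E_eq_1[OF pq(1) dom'] E_diag(1)[OF path_pairs_diag(1)[OF pq(1)]] by simp
qed

text \<open>All admissible pairs of segments give one germ, hence one image of
  \<open>\<theta>\<close>, so the description in \<open>act\<close> is met by a single
  character.\<close>

lemma act_eq:
  assumes "(p, q) \<in> PP" "(x, y) \<in> cyl S p q" "\<theta> \<in> spectrum C" "y = anchor S \<psi> \<theta>"
  shows "act S \<psi> (x, y) \<theta> = alpha C (E p q) \<theta>"
proof -
  have \<alpha>: "alpha C (E p' q') \<theta> = (\<lambda>c\<in>C. \<theta> (star (E p' q') * c * E p' q'))"
    "alpha C (E p' q') \<theta> = alpha C (E p q) \<theta>" if "(p', q') \<in> PP" "(x, y) \<in> cyl S p' q'" for p' q'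
  proof -
    have dom: "\<theta> \<in> ndom C (E p' q')" "\<theta> \<in> ndom C (E p q)"
      using cyl_ndom assms that by blast+
    show "alpha C (E p' q') \<theta> = (\<lambda>c\<in>C. \<theta> (star (E p' q') * c * E p' q'))"
      by (rule alpha_E[OF that(1) dom(1)])
    have "(E p' q', \<theta>) \<in> germ_base A C" "(E p q, \<theta>) \<in> germ_base A C"
      using germ_base_E[OF assms(1)] germ_base_E[OF that(1)] dom by blast+
    then show "alpha C (E p' q') \<theta> = alpha C (E p q) \<theta>"
      using germ_eqD(2) germ_E_unique[OF that assms] by blast
  qed
  show ?thesis
    unfolding act_def
  proof (rule the_equality)
    show "\<exists>p' q'. (p', q') \<in> PP \<and> (x, y) \<in> cyl S p' q' \<and>
        alpha C (E p q) \<theta> = (\<lambda>c\<in>C. \<theta> (star (E p' q') * c * E p' q'))"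
      using assms(1,2) \<alpha>(1) by blast
    show "\<omega> = alpha C (E p q) \<theta>" if "\<exists>p' q'. (p', q') \<in> PP \<and> (x, y) \<in> cyl S p' q' \<and>
        \<omega> = (\<lambda>c\<in>C. \<theta> (star (E p' q') * c * E p' q'))" for \<omega>
      using that \<alpha> by (elim exE conjE) simp
  qed
qed

section \<open>Normalisers are locally matrix units\<close>

text \<open>If \<open>f\<close> separates the characters, take \<open>exp (i \<pi> g)\<close> with \<open>g\<close> proportional to the squared
  distance of \<open>f\<close> to its first value.\<close>

lemma separating_unitary:
  assumes \<phi>: "\<phi> \<in> spectrum C" and \<omega>: "\<omega> \<in> spectrum C" and "\<phi> \<noteq> \<omega>"
  obtains u where "u \<in> C" "star u \<in> C" "u * star u = un" "star u * u = un"
    "\<phi> u = 1" "\<phi> (star u) = 1" "\<omega> u = - 1" "\<omega> (star u) = - 1"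
proof -
  have cont: "continuous_on C \<theta>" if \<theta>: "\<theta> \<in> spectrum C" for \<theta>
  proof -
    have "dist (\<theta> a) (\<theta> b) \<le> dist a b" if "a \<in> C" "b \<in> C" for a b
      using char_norm_le[OF \<theta> C_diff[OF that]] char_diff[OF \<theta> that] by (simp add: dist_norm)
    then show ?thesis unfolding continuous_on_iff by (meson le_less_trans)
  qed
  \<comment> \<open>Characters are continuous, so if they agreed on the dense union of the stages
    they would agree on \<open>C\<close>. At a stage where they differ both are point
    evaluations.\<close>
  have "\<exists>a\<in>level_union dalg. \<phi> a \<noteq> \<omega> a"
  proof (rule ccontr)
    assume "\<not> ?thesis"
    then have "level_union dalg \<subseteq> {a \<in> C. \<phi> a = \<omega> a}"
      using closure_subset by (auto simp: lim_eq)
    moreover have "closed {a \<in> C. \<phi> a = \<omega> a}"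
    proof -
      have "closedin (top_of_set C) {a \<in> C. \<phi> a - \<omega> a \<in> {0}}"
        using continuous_closedin_preimage[OF continuous_on_diff[OF cont[OF \<phi>] cont[OF \<omega>]], of "{0}"]
        by (simp add: vimage_def Int_def)
      then show ?thesis using closedin_closed_trans[OF _ C_closed] by simp
    qed
    ultimately have "C \<subseteq> {a \<in> C. \<phi> a = \<omega> a}" using closure_minimal lim_eq(2) by metis
    then show False using spectrum_eqI[OF \<phi> \<omega>] \<open>\<phi> \<noteq> \<omega>\<close> by blast
  qed
  then obtain n f where n: "n \<ge> 1" and f: "f \<in> dalg n" "\<phi> (\<psi> n f) \<noteq> \<omega> (\<psi> n f)"
    by (auto simp: level_union_def)
  obtain i x r where pt: "i \<in> {1..N n}" "x \<in> topspace (X n i)" "r \<in> {1..k n i}"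
    and ev: "\<And>f. f \<in> dalg n \<Longrightarrow> \<phi> (\<psi> n f) = f i x r r"
    using char_is_evaluation[OF \<phi> n] by blast
  obtain i' x' r' where pt': "i' \<in> {1..N n}" "x' \<in> topspace (X n i')" "r' \<in> {1..k n i'}"
    and ev': "\<And>f. f \<in> dalg n \<Longrightarrow> \<omega> (\<psi> n f) = f i' x' r' r'"
    using char_is_evaluation[OF \<omega> n] by blast
  define z where "z = f i x r r"
  \<comment> \<open>Normalises the exponent, which becomes 0 at the first point and
    \<open>pi\<close> at the second. Both values of the unitary are real, so its adjoint takes the
    same ones.\<close>
  define t where "t = (cmod (f i' x' r' r' - z))\<^sup>2"
  have t: "t > 0" using f ev ev' by (simp add: t_def z_def)
  define v :: "'x elt" where "v = (\<lambda>j y s c. if j \<in> {1..N n} \<and> y \<in> topspace (X n j) \<and> s \<in> {1..k n j} \<and> s = c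
    then cis (pi * (cmod (f j y s s - z))\<^sup>2 / t) else 0)"
  have v: "v \<in> dalg n"
  proof (intro dalgI algI)
    fix j s c assume j: "j \<in> {1..N n}" "s \<in> {1..k n j}" "c \<in> {1..k n j}"
    show "continuous_map (X n j) euclidean (\<lambda>y. v j y s c)"
    proof (cases "s = c")
      case True
      have "continuous_map (X n j) euclidean (\<lambda>y. cis (pi * (cmod (f j y s s - z))\<^sup>2 / t))"
        using continuous_map_compose[OF alg_continuous[OF dalgD(1)[OF f(1)] j(1), of s s],
            of euclidean "\<lambda>w. cis (pi * (cmod (w - z))\<^sup>2 / t)"] t
        by (simp add: o_def continuous_intros)
      then show ?thesis by (rule continuous_map_eq) (use True j in \<open>simp add: v_def\<close>)
    qed (simp add: v_def)
  qed (auto simp: v_def split: if_splits)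
  have sv: "elt_star v \<in> dalg n" by (rule dalg_closed(4)[OF v v])
  have unit: "elt_mult S n v (elt_star v) = elt_unit S n" "elt_mult S n (elt_star v) v = elt_unit S n"
    unfolding elt_mult_dalg[OF v sv] elt_mult_dalg[OF sv v]
    by (auto simp: fun_eq_iff v_def elt_star_def elt_unit_def cis_cnj cis_mult)
  show thesis
  proof
    let ?u = "\<psi> n v"
    have su: "star ?u = \<psi> n (elt_star v)" using hom(4)[OF n dalgD(1)[OF v]] by simp
    show "?u \<in> C" "star ?u \<in> C" unfolding su using in_C[OF n] v sv by blast+
    show "?u * star ?u = un" "star ?u * ?u = un"
      unfolding su hom(2)[OF n dalgD(1)[OF v] dalgD(1)[OF sv], symmetric]
        hom(2)[OF n dalgD(1)[OF sv] dalgD(1)[OF v], symmetric] unit by (rule hom_unit[OF n])+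
    show "\<phi> ?u = 1" "\<phi> (star ?u) = 1" "\<omega> ?u = - 1" "\<omega> (star ?u) = - 1"
      unfolding su ev[OF v] ev[OF sv] ev'[OF v] ev'[OF sv]
      using pt pt' t by (simp_all add: v_def elt_star_def z_def[symmetric] t_def[symmetric])
  qed
qed

text \<open>\<open>m\<close> is close to \<open>\<psi> n f\<close>, and the corner of \<open>f\<close> at \<open>(p, q)\<close> is a diagonal multiple of
  the matrix unit, hence intertwines \<open>u\<close> and its conjugate exactly.\<close>

lemma normaliser_locally_E:
  assumes m: "m \<in> normalisers A C" and \<phi>: "\<phi> \<in> ndom C m"
  obtains p q where "(p, q) \<in> PP" "\<phi> \<in> ndom C (E p q)" "germ A C m \<phi> = germ A C (E p q) \<phi>"
proof -
  have sp: "\<phi> \<in> spectrum C" using \<phi> by (simp add: ndom_def)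
  \<comment> \<open>The factor one half only makes \<open>\<epsilon>\<^sup>2\<close> strictly
    smaller than the modulus. The stage and the paths are chosen afterwards and depend on
    \<open>\<epsilon>\<close>.\<close>
  define \<epsilon> where "\<epsilon> = sqrt (cmod (\<phi> (star m * m)) / 2)"
  have \<epsilon>: "\<epsilon> > 0" "\<epsilon>\<^sup>2 < cmod (\<phi> (star m * m))" using \<phi> by (auto simp: \<epsilon>_def ndom_def)
  have "m \<in> closure (level_union alg)" using normaliserD(1)[OF m] by (simp add: lim_eq)
  then obtain a where "a \<in> level_union alg" "dist a m < \<epsilon>" using \<epsilon>(1) closure_approachable by metis
  then obtain n f where n: "n \<ge> 1" and f: "f \<in> alg n" and close: "norm (m - \<psi> n f) < \<epsilon>"
    by (auto simp: level_union_def dist_norm norm_minus_commute)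
  define \<eta> where "\<eta> = alpha C m \<phi>"
  have \<eta>: "\<eta> \<in> spectrum C" using alpha_in_nran(2)[OF m \<phi>] by (simp add: \<eta>_def)
  define p where "p = initial n (anchor S \<psi> \<eta>)"
  define q where "q = initial n (anchor S \<psi> \<phi>)"
  have p: "p \<in> fin_paths S n" and q: "q \<in> fin_paths S n"
    using anchor(1)[OF \<eta>] anchor(1)[OF sp] n by (auto simp: p_def q_def inf_paths_iff)
  have len: "length p = n" "length q = n" by (simp_all add: p_def q_def)
  have pp: "(p, p) \<in> PP" and qq: "(q, q) \<in> PP" using path_pairs_refl n p q by auto
  note np = diagonal_normaliser[OF E_diag(1,4)[OF pp]] and nq = diagonal_normaliser[OF E_diag(1,4)[OF qq]]
  note nmq = normalisers_mult[OF m nq]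
  define m' where "m' = E p p * (m * E q q)"
  have m': "m' \<in> normalisers A C" unfolding m'_def by (rule normalisers_mult[OF np nmq])
  have dq: "\<phi> \<in> ndom C (E q q)" "\<eta> \<in> ndom C (E p p)"
    using pp qq sp \<eta> by (simp_all add: ndom_E_iff len) (simp_all add: p_def q_def)
  have dmq: "\<phi> \<in> ndom C (m * E q q)"
    using ndom_mult_iff[OF m nq] alpha_diagonal[OF E_diag(1,4)[OF qq] dq(1)] \<phi> dq by simp
  have "alpha C (m * E q q) \<phi> = \<eta>"
    using alpha_mult[OF m nq dmq] alpha_diagonal[OF E_diag(1,4)[OF qq] dq(1)] by (simp add: \<eta>_def)
  then have dm': "\<phi> \<in> ndom C m'"
    unfolding m'_def using ndom_mult_iff[OF np nmq] dmq dq by simp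
  have germ: "germ A C m' \<phi> = germ A C m \<phi>"
    using germ_diagonal_mult(1)[OF nmq E_diag(1,4)[OF pp]] germ_mult_diagonal(1)[OF m E_diag(1,4)[OF qq]]
      dmq dm' by (simp add: m'_def)
  \<comment> \<open>The corner was chosen so that nothing is lost at \<open>\<phi>\<close>:
    \<open>E q q\<close> has value 1 at \<open>\<phi>\<close>, and \<open>E p p\<close> has value 1
    at the image \<open>\<eta>\<close>.\<close>
  have "\<phi> (star m' * m') = \<phi> (star m * m)"
  proof -
    have "star m' * m' = E q q * (star m * E p p * m) * E q q"
    proof -
      have "E p p * (E p p * z) = E p p * z" for z
        using E_mult[OF pp pp] by (simp add: mult.assoc[symmetric])
      then show ?thesis
        using E_diag(3)[OF pp] E_diag(3)[OF qq] by (simp add: m'_def star_mult mult.assoc)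
    qed
    moreover have "star m * E p p * m \<in> C" using normaliserD(3)[OF m] E_diag(1)[OF pp] .
    ultimately have "\<phi> (star m' * m') = \<phi> (star m * E p p * m)"
      using char_mult[OF sp] char_E_eq_1[OF qq dq(1)] E_diag(1)[OF qq] C_mult by simp
    moreover have "\<eta> (E p p) = 1" by (rule char_E_eq_1[OF pp dq(2)])
    ultimately show ?thesis
      using alpha_apply[OF m \<phi> E_diag(1)[OF pp]] \<phi> by (simp add: \<eta>_def ndom_def)
  qed
  then have big: "\<epsilon>\<^sup>2 < cmod (\<phi> (star m' * m'))" using \<epsilon> by simp
  define a' where "a' = E p p * \<psi> n f * E q q"
  have near: "norm (m' - a') \<le> \<epsilon>"
  proof -
    have "m' - a' = E p p * (m - \<psi> n f) * E q q" by (simp add: m'_def a'_def algebra_simps)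
    then have "norm (m' - a') \<le> norm (E p p) * norm (m - \<psi> n f) * norm (E q q)"
      by (simp add: norm_mult3_le)
    also have "\<dots> \<le> 1 * norm (m - \<psi> n f) * 1"
      using norm_E_le_1[OF pp] norm_E_le_1[OF qq] by (intro mult_mono) auto
    finally show ?thesis using close by simp
  qed
  note mup = matrix_unit_alg[OF n p p refl] and muq = matrix_unit_alg[OF n q q refl]
  have a': "a' = \<psi> n (elt_mult S n (elt_mult S n (matrix_unit S p p) f) (matrix_unit S q q))"
    using hom(2)[OF n mup f] hom(2)[OF n elt_mult_alg[OF mup f] muq]
    by (simp add: a'_def E_eq[OF p] E_eq[OF q])
  \<comment> \<open>Otherwise the corner of the approximant is zero, \<open>m'\<close> has norm at
    most \<open>\<epsilon>\<close>, and \<open>big\<close> fails.\<close>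
  have pq: "tgt p = tgt q"
  proof (rule ccontr)
    assume "tgt p \<noteq> tgt q"
    then have "a' = \<psi> n (elt_scale 0 (elt_unit S n))"
      unfolding a' matrix_unit_corner_zero[OF n p q \<open>tgt p \<noteq> tgt q\<close>] by (simp add: elt_scale_def)
    then have "a' = scaleC 0 un" using hom(3)[OF n elt_unit_alg] hom_unit[OF n] by simp
    then have "norm a' = 0" by (simp add: norm_scaleC)
    then have "norm m' \<le> \<epsilon>" using near by simp
    have "cmod (\<phi> (star m' * m')) \<le> norm (star m' * m')"
      by (rule char_norm_le[OF sp normaliserD(4)[OF m']])
    also have "\<dots> = (norm m')\<^sup>2" by (rule cstar_identity)
    also have "\<dots> \<le> \<epsilon>\<^sup>2" using \<open>norm m' \<le> \<epsilon>\<close> by (intro power_mono) auto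
    finally show False using big by simp
  qed
  have PP: "(p, q) \<in> PP" by (rule path_pairsI[OF n p q pq])
  have dE: "\<phi> \<in> ndom C (E p q)" using dq(1) PP qq by (simp add: ndom_E_iff)
  obtain g where g: "g \<in> dalg n" "elt_mult S n (elt_mult S n (matrix_unit S p p) f) (matrix_unit S q q) =
      elt_mult S n g (matrix_unit S p q)"
    by (rule matrix_unit_corner[OF n p q pq f])
  have a'_eq: "a' = \<psi> n g * E p q"
    using hom(2)[OF n dalgD(1)[OF g(1)] matrix_unit_alg[OF n p q pq]] by (simp add: a' g(2) E_eq[OF p])
  have gC: "\<psi> n g \<in> C" using in_C[OF n g(1)] .
  \<comment> \<open>Neither \<open>\<epsilon>\<close> nor \<open>a'\<close> depends on the
    character, so the contradiction below works at every point where the inequality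
    \<open>big\<close> persists.\<close>
  define U where "U = {\<theta> \<in> spectrum C. \<epsilon>\<^sup>2 < cmod (\<theta> (star m' * m'))} \<inter> ndom C (E p q)"
  have "openin (spectrum_top C) U"
    unfolding U_def by (intro openin_Int openin_char_norm_gt normaliserD(4)[OF m'] ndom_open[OF E_normaliser[OF PP]])
  moreover have "\<phi> \<in> U" using big sp dE by (simp add: U_def)
  moreover have "U \<subseteq> ndom C m' \<inter> ndom C (E p q)"
  proof -
    have "\<theta> (star m' * m') \<noteq> 0" if "\<epsilon>\<^sup>2 < cmod (\<theta> (star m' * m'))" for \<theta>
      using that by auto
    then show ?thesis by (auto simp: U_def ndom_def)
  qed
  moreover have "alpha C m' \<theta> = alpha C (E p q) \<theta>" if "\<theta> \<in> U" for \<theta>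
  proof (rule ccontr)
    assume ne: "alpha C m' \<theta> \<noteq> alpha C (E p q) \<theta>"
    have \<theta>: "\<theta> \<in> ndom C m'" "\<theta> \<in> ndom C (E p q)" "\<epsilon>\<^sup>2 < cmod (\<theta> (star m' * m'))"
      using that \<open>U \<subseteq> ndom C m' \<inter> ndom C (E p q)\<close> by (auto simp: U_def)
    note nE = E_normaliser[OF PP]
    obtain u where u: "u \<in> C" "star u \<in> C" "u * star u = un" "star u * u = un"
      "alpha C m' \<theta> u = 1" "alpha C m' \<theta> (star u) = 1"
      "alpha C (E p q) \<theta> u = - 1" "alpha C (E p q) \<theta> (star u) = - 1"
      using separating_unitary[OF alpha_in_nran(2)[OF m' \<theta>(1)] alpha_in_nran(2)[OF nE \<theta>(2)] ne] by blast
    have norm_u: "norm u \<le> 1"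
    proof -
      have "(norm un)\<^sup>2 = norm un"
        using cstar_identity[of un] star_unit unit_left[OF C_sub[OF unit_in]] by simp
      then have "norm un \<le> 1" by (cases "norm un = 0") (simp_all add: power2_eq_square)
      then have "(norm u)\<^sup>2 \<le> 1" using cstar_identity[of u] u(4) by simp
      then show ?thesis using power2_le_imp_le[of "norm u" 1] by simp
    qed
    let ?h = "star (E p q) * u * E p q"
    have norm_h: "norm ?h \<le> 1"
    proof -
      have "norm ?h \<le> norm (star (E p q)) * norm u * norm (E p q)"
        by (rule norm_mult3_le)
      also have "\<dots> \<le> 1 * 1 * 1"
        using norm_E_le_1[OF PP] norm_E_le_1[OF path_pairs_sym[OF PP]] E_star[OF PP] norm_u
        by (intro mult_mono) auto
      finally show ?thesis by simp
    qed
    \<comment> \<open>\<open>E p q * star (E p q)\<close> is the diagonal projection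
      \<open>E p p\<close>, so \<open>u\<close> can be moved to the left past it and past
      \<open>\<psi> n g\<close> within the commutative algebra \<open>C\<close>.\<close>
    have "a' * ?h = \<psi> n g * (E p p * u) * E p q"
    proof -
      have "E p q * (E q p * z) = E p p * z" for z
        using E_mult[OF PP path_pairs_sym[OF PP]] by (simp add: mult.assoc[symmetric])
      then show ?thesis using E_star[OF PP] by (simp add: a'_eq mult.assoc)
    qed
    also have "\<dots> = \<psi> n g * (u * E p p) * E p q"
      using C_comm[OF E_diag(1)[OF pp] u(1)] by simp
    also have "\<dots> = (\<psi> n g * u) * (E p p * E p q)" by (simp add: mult.assoc)
    also have "\<dots> = (u * \<psi> n g) * E p q"
      using C_comm[OF gC u(1)] E_mult[OF pp PP] by simp
    finally have inter: "a' * ?h = u * a'" by (simp add: a'_eq mult.assoc)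
    \<comment> \<open>As \<open>a'\<close> intertwines exactly, only \<open>m' - a'\<close>
      contributes, once on each side; this is the origin of \<open>2 * \<epsilon>\<close>.\<close>
    have "m' * ?h - u * m' = (m' - a') * ?h - u * (m' - a')"
      using inter by (simp add: algebra_simps)
    then have "norm (m' * ?h - u * m') \<le> norm ((m' - a') * ?h) + norm (u * (m' - a'))"
      using norm_triangle_ineq4 by metis
    also have "\<dots> \<le> norm (m' - a') * norm ?h + norm u * norm (m' - a')"
      by (intro add_mono norm_mult_ineq)
    also have "\<dots> \<le> \<epsilon> * 1 + 1 * \<epsilon>"
      using near norm_h norm_u \<epsilon>(1) by (intro add_mono mult_mono) auto
    finally have "norm (m' * ?h - u * m') \<le> 2 * \<epsilon>" by simp
    from almost_intertwiner_bound[OF m' \<theta>(1) nE _ u this]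
    show False using \<theta>(3) char_E_eq_1[OF PP \<theta>(2)] E_source[OF PP] by simp
  qed
  ultimately have "germ A C m' \<phi> = germ A C (E p q) \<phi>"
    using germ_eq_iff[of m' \<phi> "E p q" \<phi>] m' dm' dE germ_base_E[OF PP] by (auto simp: germ_base_def)
  then show thesis using that[OF PP dE] germ by simp
qed

section \<open>The isomorphism\<close>

lemma path_pairs_trans:
  assumes "(p, q) \<in> PP" "(q, r) \<in> PP" shows "(p, r) \<in> PP"
  using path_pairsD[OF assms(1)] path_pairsD[OF assms(2)] by (intro path_pairsI[of "length p"]) auto

abbreviation "TG \<equiv> transformation_groupoid S \<psi>"
abbreviation "WG \<equiv> weyl_groupoid A C"

lemma tail_arrow_cyl:
  assumes "(x, y) \<in> arrows (tail_groupoid S)"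
  obtains p q where "(p, q) \<in> PP" "(x, y) \<in> cyl S p q"
proof -
  obtain m where m: "x \<in> inf_paths S" "y \<in> inf_paths S" "\<forall>l\<ge>m. x l = y l"
    using assms by (auto simp: tail_groupoid_def)
  let ?n = "max 1 m"
  have "(initial ?n x, initial ?n y) \<in> PP" by (rule initial_path_pair) (use m in auto)
  moreover have "(x, y) \<in> cyl S (initial ?n x) (initial ?n y)" using m by (auto simp: cyl_def)
  ultimately show thesis using that by blast
qed

lemma cyl_tail_arrow: "(x, y) \<in> cyl S p q \<Longrightarrow> (x, y) \<in> arrows (tail_groupoid S)"
  by (auto simp: cyl_def tail_groupoid_def)

text \<open>The topology is only given as generated by the cylinders; they form a base because two
  cylinders around one pair contain a common smaller one.\<close>

lemma tail_open_cyl: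
  assumes "openin (gtop (tail_groupoid S)) U" "g \<in> U"
  obtains p q where "(p, q) \<in> PP" "g \<in> cyl S p q" "cyl S p q \<subseteq> U"
proof -
  have "generate_topology_on {cyl S p q | p q. (p, q) \<in> PP} U"
    using assms(1) by (simp add: tail_groupoid_def openin_topology_generated_by_iff)
  then have "g \<in> U \<Longrightarrow> \<exists>p q. (p, q) \<in> PP \<and> g \<in> cyl S p q \<and> cyl S p q \<subseteq> U"
  proof (induction U rule: generate_topology_on.induct)
    case (Int a b)
    then obtain p q p' q' where pq: "(p, q) \<in> PP" "g \<in> cyl S p q" "cyl S p q \<subseteq> a"
      "(p', q') \<in> PP" "g \<in> cyl S p' q'" "cyl S p' q' \<subseteq> b" by blast
    obtain x y where g: "g = (x, y)" by (cases g)
    let ?n = "max (length p) (length p')"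
    have "length p \<le> ?n" "length p' \<le> ?n" by simp_all
    from cyl_initial[OF pq(1) pq(2)[unfolded g] this(1)] cyl_initial[OF pq(4) pq(5)[unfolded g] this(2)]
    show ?case using pq(3,6) unfolding g by blast
  next
    case (UN K)
    then obtain k where k: "k \<in> K" "g \<in> k" by blast
    then obtain p q where "(p, q) \<in> PP" "g \<in> cyl S p q" "cyl S p q \<subseteq> k" using UN.IH by blast
    moreover have "k \<subseteq> \<Union> K" using k(1) by (rule Union_upper)
    ultimately show ?case by (meson subset_trans)
  next
    case (Basis b)
    then obtain p q where "(p, q) \<in> PP" "b = cyl S p q" by blast
    then show ?case using Basis.prems by (intro exI[of _ p] exI[of _ q]) simp
  qed simp
  then show thesis using assms(2) that by blast
qed

lemma TG_simps:
  "(g, \<theta>) \<in> arrows TG \<longleftrightarrow> g \<in> arrows (tail_groupoid S) \<and> \<theta> \<in> spectrum C \<and> snd g = anchor S \<psi> \<theta>"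
  "gsrc TG (g, \<theta>) = (snd g, \<theta>)"
  "grng TG (g, \<theta>) = (fst g, act S \<psi> g \<theta>)"
  "gcomp TG (h, \<omega>) (g, \<theta>) = ((fst h, snd g), \<theta>)"
  "gtop TG = subtopology (prod_topology (gtop (tail_groupoid S)) (spectrum_top C)) (arrows TG)"
  by (simp_all add: transformation_groupoid_def tail_groupoid_def Let_def)

lemma arrowE:
  assumes "((x, y), \<theta>) \<in> arrows TG"
  obtains p q where "(p, q) \<in> PP" "(x, y) \<in> cyl S p q" "\<theta> \<in> spectrum C" "y = anchor S \<psi> \<theta>"
    "\<theta> \<in> ndom C (E p q)"
proof -
  have \<theta>: "(x, y) \<in> arrows (tail_groupoid S)" "\<theta> \<in> spectrum C" "y = anchor S \<psi> \<theta>"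
    using assms unfolding TG_simps snd_conv by blast+
  obtain p q where "(p, q) \<in> PP" "(x, y) \<in> cyl S p q" using tail_arrow_cyl[OF \<theta>(1)] .
  then show thesis using that \<theta>(2,3) cyl_ndom by blast
qed

lemma cyl_arrow:
  assumes "(x, y) \<in> cyl S p q" "\<theta> \<in> spectrum C" "y = anchor S \<psi> \<theta>"
  shows "((x, y), \<theta>) \<in> arrows TG"
  using assms cyl_tail_arrow by (simp add: TG_simps)

text \<open>The anchor of \<open>\<theta>\<close> begins with \<open>q\<close>; exchanging this
  segment for \<open>p\<close> and keeping the tail gives the range path. Surjectivity and openness
  of \<open>weyl_iso\<close> both take their preimages from here.\<close>

lemma ndom_E_arrow:
  assumes pq: "(p, q) \<in> PP" and \<theta>: "\<theta> \<in> ndom C (E p q)"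
  obtains x where "(x, anchor S \<psi> \<theta>) \<in> cyl S p q" "((x, anchor S \<psi> \<theta>), \<theta>) \<in> arrows TG"
proof -
  let ?y = "anchor S \<psi> \<theta>" and ?n = "length p"
  note p = path_pairsD[OF pq]
  have sp: "\<theta> \<in> spectrum C" and q: "initial ?n ?y = q" using \<theta> p(5) by (auto simp: ndom_E_iff[OF pq])
  have y: "?y \<in> inf_paths S" using anchor(1)[OF sp] .
  define x where "x m = (if m < ?n then p ! m else ?y m)" for m
  have init: "initial ?n x = p" by (rule nth_equalityI) (simp_all add: initial_nth x_def)
  have "x m \<in> edges S m \<and> edge_tgt (x m) = edge_src (x (Suc m))" for m
  proof -
    consider "Suc m < ?n" | "Suc m = ?n" | "m \<ge> ?n" by linarith
    then show ?thesis
    proof cases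
      case 1
      then show ?thesis using p(2) by (simp add: x_def fin_paths_def)
    next
      \<comment> \<open>The seam: \<open>m\<close> is the last position of \<open>p\<close>, and the
        tail fits because \<open>p\<close> ends where \<open>q\<close> does.\<close>
      case 2
      have "p \<noteq> []" "q \<noteq> []" using p(1,5) by auto
      then have "last p = p ! m" "last q = ?y m"
        using 2 p(5) q by (auto simp: last_conv_nth initial_nth simp flip: 2)
      then have "edge_tgt (p ! m) = edge_tgt (?y m)" using p(4) by simp
      then show ?thesis using 2 p(2) y by (simp add: x_def fin_paths_def inf_paths_def)
    next
      case 3
      then show ?thesis using y by (simp add: x_def inf_paths_def)
    qed
  qed
  then have "x \<in> inf_paths S" by (simp add: inf_paths_def)
  then have "(x, ?y) \<in> cyl S p q"
    using y init q p(5) by (simp add: cyl_def x_def)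
  then show thesis using that cyl_arrow[OF _ sp refl] by blast
qed

text \<open>Quantifying over all segments avoids a choice; by \<open>germ_E_unique\<close> the
  description has exactly one solution on arrows.\<close>

definition weyl_iso ::
  "((nat \<Rightarrow> 'e edge) \<times> (nat \<Rightarrow> 'e edge)) \<times> ('a \<Rightarrow> complex) \<Rightarrow> ('a \<times> ('a \<Rightarrow> complex)) set" where
  "weyl_iso = (\<lambda>(g, \<theta>). THE k. \<exists>p q. (p, q) \<in> PP \<and> g \<in> cyl S p q \<and> k = germ A C (E p q) \<theta>)"

lemma weyl_iso_eq:
  assumes "(p, q) \<in> PP" "(x, y) \<in> cyl S p q" "((x, y), \<theta>) \<in> arrows TG"
  shows "weyl_iso ((x, y), \<theta>) = germ A C (E p q) \<theta>"
proof -
  have \<theta>: "\<theta> \<in> spectrum C" "y = anchor S \<psi> \<theta>" using assms(3) unfolding TG_simps snd_conv by blast+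
  show ?thesis
    unfolding weyl_iso_def prod.case
  proof (rule the_equality)
    show "\<exists>p' q'. (p', q') \<in> PP \<and> (x, y) \<in> cyl S p' q' \<and> germ A C (E p q) \<theta> = germ A C (E p' q') \<theta>"
      by (intro exI[of _ p] exI[of _ q] conjI assms(1,2) refl)
    show "k = germ A C (E p q) \<theta>"
      if ex: "\<exists>p' q'. (p', q') \<in> PP \<and> (x, y) \<in> cyl S p' q' \<and> k = germ A C (E p' q') \<theta>" for k
    proof -
      from ex obtain p' q' where "(p', q') \<in> PP" "(x, y) \<in> cyl S p' q'"
        and k: "k = germ A C (E p' q') \<theta>" by blast
      from germ_E_unique[OF this(1,2) assms(1,2) \<theta>] show ?thesis by (simp only: k)
    qed
  qed
qed

lemma weyl_iso_inj: "inj_on weyl_iso (arrows TG)"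
proof (rule inj_onI)
  fix a b assume "a \<in> arrows TG" "b \<in> arrows TG" "weyl_iso a = weyl_iso b"
  moreover obtain x y \<theta> x' y' \<theta>' where ab: "a = ((x, y), \<theta>)" "b = ((x', y'), \<theta>')"
    by (metis surj_pair)
  ultimately have g: "((x, y), \<theta>) \<in> arrows TG" and h: "((x', y'), \<theta>') \<in> arrows TG"
    and eq: "weyl_iso ((x, y), \<theta>) = weyl_iso ((x', y'), \<theta>')" by simp_all
  obtain p q where pq: "(p, q) \<in> PP" "(x, y) \<in> cyl S p q" "\<theta> \<in> spectrum C" "y = anchor S \<psi> \<theta>"
    "\<theta> \<in> ndom C (E p q)" using arrowE[OF g] .
  obtain p' q' where pq': "(p', q') \<in> PP" "(x', y') \<in> cyl S p' q'" "\<theta>' \<in> spectrum C"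
    "y' = anchor S \<psi> \<theta>'" "\<theta>' \<in> ndom C (E p' q')" using arrowE[OF h] .
  have gb: "(E p q, \<theta>) \<in> germ_base A C" "(E p' q', \<theta>') \<in> germ_base A C"
    using germ_base_E[OF pq(1)] germ_base_E[OF pq'(1)] pq(5) pq'(5) by blast+
  have eq': "germ A C (E p q) \<theta> = germ A C (E p' q') \<theta>'"
    using eq weyl_iso_eq[OF pq(1,2) g] weyl_iso_eq[OF pq'(1,2) h] by simp
  note e = germ_eqD[OF gb eq']
  have "x = x'" using anchor_alpha_E[OF pq(1-4)] anchor_alpha_E[OF pq'(1-4)] e(2) by simp
  then show "a = b" using e(1) pq(4) pq'(4) by (simp add: ab)
qed

lemma weyl_iso_image: "weyl_iso ` arrows TG = arrows WG"
proof
  show "weyl_iso ` arrows TG \<subseteq> arrows WG"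
  proof clarify
    fix x y \<theta> assume g: "((x, y), \<theta>) \<in> arrows TG"
    obtain p q where pq: "(p, q) \<in> PP" "(x, y) \<in> cyl S p q" "\<theta> \<in> ndom C (E p q)" using arrowE[OF g] .
    then show "weyl_iso ((x, y), \<theta>) \<in> arrows WG"
      using weyl_iso_eq[OF pq(1,2) g] germ_in_arrows germ_base_E[OF pq(1)] by simp
  qed
  show "arrows WG \<subseteq> weyl_iso ` arrows TG"
  proof
    fix k assume "k \<in> arrows WG"
    then obtain m \<phi> where m: "(m, \<phi>) \<in> germ_base A C" and k: "k = germ A C m \<phi>" by (rule weyl_arrowE)
    have "m \<in> normalisers A C" "\<phi> \<in> ndom C m" using m by (auto simp: germ_base_def)
    then obtain p q where pq: "(p, q) \<in> PP" "\<phi> \<in> ndom C (E p q)" "germ A C m \<phi> = germ A C (E p q) \<phi>"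
      by (rule normaliser_locally_E)
    obtain x where x: "(x, anchor S \<psi> \<phi>) \<in> cyl S p q" "((x, anchor S \<psi> \<phi>), \<phi>) \<in> arrows TG"
      using ndom_E_arrow[OF pq(1,2)] .
    show "k \<in> weyl_iso ` arrows TG"
      using weyl_iso_eq[OF pq(1) x] x(2) pq(3) k by (metis imageI)
  qed
qed

lemma gtop_WG: "gtop WG = topology_generated_by
    {{germ A C m \<phi> | \<phi>. \<phi> \<in> ndom C m \<inter> U} | m U. m \<in> normalisers A C \<and> openin (spectrum_top C) U}"
  by (simp only: weyl_groupoid_def top_groupoid.simps)

lemma topspace_WG: "topspace (gtop WG) = arrows WG"
proof -
  have "arrows WG \<subseteq> topspace (gtop WG)"
  proof
    fix k assume "k \<in> arrows WG"
    then obtain m \<phi> where m: "(m, \<phi>) \<in> germ_base A C" and k: "k = germ A C m \<phi>" by (rule weyl_arrowE)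
    have "openin (spectrum_top C) (spectrum C)"
      using openin_topspace[of "spectrum_top C"] by simp
    moreover have "\<phi> \<in> ndom C m \<inter> spectrum C" "m \<in> normalisers A C"
      using m by (auto simp: germ_base_def ndom_def)
    ultimately show "k \<in> topspace (gtop WG)"
      unfolding gtop_WG topology_generated_by_topspace k by blast
  qed
  moreover have "topspace (gtop WG) \<subseteq> arrows WG"
    unfolding gtop_WG topology_generated_by_topspace
    using germ_in_arrows by (auto simp: germ_base_def)
  ultimately show ?thesis by blast
qed

lemma openin_cyl: "(p, q) \<in> PP \<Longrightarrow> openin (gtop (tail_groupoid S)) (cyl S p q)"
  unfolding tail_groupoid_def top_groupoid.simps by (rule topology_generated_by_Basis) blast

lemma topspace_TG: "topspace (gtop TG) = arrows TG"
proof -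
  have "((x, y), \<theta>) \<in> topspace (prod_topology (gtop (tail_groupoid S)) (spectrum_top C))"
    if g: "((x, y), \<theta>) \<in> arrows TG" for x y \<theta>
  proof -
    obtain p q where "(p, q) \<in> PP" "(x, y) \<in> cyl S p q" "\<theta> \<in> spectrum C" using arrowE[OF g] .
    then show ?thesis using openin_subset[OF openin_cyl] by auto
  qed
  then show ?thesis unfolding TG_simps(5) topspace_subtopology by auto
qed

lemma weyl_iso_continuous: "continuous_map (gtop TG) (gtop WG) weyl_iso"
  unfolding gtop_WG
proof (rule continuous_on_generated_topo)
  show "weyl_iso ` topspace (gtop TG) \<subseteq> \<Union> {{germ A C m \<phi> | \<phi>. \<phi> \<in> ndom C m \<inter> U} | m U.
      m \<in> normalisers A C \<and> openin (spectrum_top C) U}"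
    using topspace_WG unfolding gtop_WG topology_generated_by_topspace topspace_TG weyl_iso_image by blast
  fix V assume "V \<in> {{germ A C m \<phi> | \<phi>. \<phi> \<in> ndom C m \<inter> U} | m U.
      m \<in> normalisers A C \<and> openin (spectrum_top C) U}"
  then obtain m U where m: "m \<in> normalisers A C" and U: "openin (spectrum_top C) U"
    and V: "V = {germ A C m \<phi> | \<phi>. \<phi> \<in> ndom C m \<inter> U}" by blast
  show "openin (gtop TG) (weyl_iso -` V \<inter> topspace (gtop TG))"
  proof (subst openin_subopen, clarify)
    fix x y \<theta> assume FV: "weyl_iso ((x, y), \<theta>) \<in> V" and "((x, y), \<theta>) \<in> topspace (gtop TG)"
    then have g: "((x, y), \<theta>) \<in> arrows TG" by (simp add: topspace_TG)
    obtain p q where pq: "(p, q) \<in> PP" "(x, y) \<in> cyl S p q" "\<theta> \<in> ndom C (E p q)" using arrowE[OF g] .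
    obtain \<phi> where \<phi>: "\<phi> \<in> ndom C m" "\<phi> \<in> U" "germ A C (E p q) \<theta> = germ A C m \<phi>"
      using FV unfolding V weyl_iso_eq[OF pq(1,2) g] by blast
    have gb: "(E p q, \<theta>') \<in> germ_base A C" "(m, \<theta>') \<in> germ_base A C"
      if "\<theta>' \<in> ndom C m" "\<theta>' \<in> ndom C (E p q)" for \<theta>'
      using that germ_base_E[OF pq(1)] m by (simp_all add: germ_base_def)
    have gb0: "(E p q, \<theta>) \<in> germ_base A C" "(m, \<phi>) \<in> germ_base A C"
      using germ_base_E[OF pq(1)] pq(3) m \<phi>(1) by (simp_all add: germ_base_def)
    obtain W where W: "openin (spectrum_top C) W" "\<theta> \<in> W" "W \<subseteq> ndom C (E p q) \<inter> ndom C m"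
      "\<forall>\<omega>\<in>W. alpha C (E p q) \<omega> = alpha C m \<omega>" and "\<theta> = \<phi>"
      using \<phi>(3) germ_eq_iff[OF gb0] by blast
    \<comment> \<open>The cylinder keeps the matrix unit fixed, on \<open>W\<close> its germs
      coincide with those of \<open>m\<close>, and \<open>U\<close> keeps the germs inside
      \<open>V\<close>.\<close>
    let ?T = "(cyl S p q \<times> (W \<inter> U)) \<inter> arrows TG"
    have "openin (gtop TG) ?T"
      unfolding TG_simps(5) openin_subtopology
      using openin_cyl[OF pq(1)] W(1) U by (intro exI[of _ "cyl S p q \<times> (W \<inter> U)"])
        (simp add: openin_prod_Times_iff openin_Int)
    moreover have "((x, y), \<theta>) \<in> ?T" using pq(2) W(2) \<phi>(2) \<open>\<theta> = \<phi>\<close> g by simp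
    moreover have "?T \<subseteq> weyl_iso -` V \<inter> topspace (gtop TG)"
    proof clarify
      fix x' y' \<theta>' assume c: "(x', y') \<in> cyl S p q" and \<theta>': "\<theta>' \<in> W" "\<theta>' \<in> U"
        and g': "((x', y'), \<theta>') \<in> arrows TG"
      have d: "\<theta>' \<in> ndom C m" "\<theta>' \<in> ndom C (E p q)" using W(3) \<theta>'(1) by auto
      have "germ A C (E p q) \<theta>' = germ A C m \<theta>'"
        using germ_eq_iff[OF gb[OF d]] W \<theta>'(1) by blast
      then have "weyl_iso ((x', y'), \<theta>') = germ A C m \<theta>'" using weyl_iso_eq[OF pq(1) c g'] by simp
      then show "((x', y'), \<theta>') \<in> weyl_iso -` V \<inter> topspace (gtop TG)"
        using d(1) \<theta>'(2) g' unfolding V topspace_TG by blast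
    qed
    ultimately show "\<exists>T. openin (gtop TG) T \<and> ((x, y), \<theta>) \<in> T \<and> T \<subseteq> weyl_iso -` V \<inter> topspace (gtop TG)"
      by blast
  qed
qed

text \<open>The germs of \<open>E p q\<close> over an open \<open>W\<close> form a generating open
  set, and \<open>ndom_E_arrow\<close> gives each of them a preimage in
  \<open>cyl S p q \<times> W\<close>.\<close>

lemma weyl_iso_open: "open_map (gtop TG) (gtop WG) weyl_iso"
  unfolding open_map_def
proof (intro allI impI)
  fix Q assume "openin (gtop TG) Q"
  then obtain Q' where Q': "openin (prod_topology (gtop (tail_groupoid S)) (spectrum_top C)) Q'"
    and Q: "Q = Q' \<inter> arrows TG"
    unfolding TG_simps(5) openin_subtopology by blast
  show "openin (gtop WG) (weyl_iso ` Q)"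
  proof (subst openin_subopen, clarify)
    fix x y \<theta> assume a: "((x, y), \<theta>) \<in> Q"
    then have g: "((x, y), \<theta>) \<in> arrows TG" by (simp add: Q)
    have "((x, y), \<theta>) \<in> Q'" using a by (simp add: Q)
    then obtain G W where GW: "openin (gtop (tail_groupoid S)) G" "openin (spectrum_top C) W"
      "(x, y) \<in> G" "\<theta> \<in> W" "G \<times> W \<subseteq> Q'"
      using Q' unfolding openin_prod_topology_alt by meson
    obtain p q where pq: "(p, q) \<in> PP" "(x, y) \<in> cyl S p q" "cyl S p q \<subseteq> G"
      using tail_open_cyl[OF GW(1,3)] .
    have dom: "\<theta> \<in> ndom C (E p q)" using cyl_ndom[OF pq(1,2)] g by (simp add: TG_simps)
    let ?T = "{germ A C (E p q) \<phi> | \<phi>. \<phi> \<in> ndom C (E p q) \<inter> W}"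
    have "openin (gtop WG) ?T"
      unfolding gtop_WG using E_normaliser[OF pq(1)] GW(2) by (intro topology_generated_by_Basis) blast
    moreover have "weyl_iso ((x, y), \<theta>) \<in> ?T" using weyl_iso_eq[OF pq(1,2) g] dom GW(4) by blast
    moreover have "?T \<subseteq> weyl_iso ` Q"
    proof clarify
      fix \<phi> assume \<phi>: "\<phi> \<in> ndom C (E p q)" "\<phi> \<in> W"
      obtain x' where x': "(x', anchor S \<psi> \<phi>) \<in> cyl S p q" "((x', anchor S \<psi> \<phi>), \<phi>) \<in> arrows TG"
        using ndom_E_arrow[OF pq(1) \<phi>(1)] .
      then have "((x', anchor S \<psi> \<phi>), \<phi>) \<in> Q" using pq(3) GW(5) \<phi>(2) by (auto simp: Q)
      then show "germ A C (E p q) \<phi> \<in> weyl_iso ` Q"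
        using weyl_iso_eq[OF pq(1) x'] by (metis imageI)
    qed
    ultimately show "\<exists>T. openin (gtop WG) T \<and> weyl_iso ((x, y), \<theta>) \<in> T \<and> T \<subseteq> weyl_iso ` Q" by blast
  qed
qed

lemma weyl_iso_functorial:
  assumes g: "((x, y), \<theta>) \<in> arrows TG" and h: "((x', y'), \<theta>') \<in> arrows TG"
  shows "gsrc TG ((x, y), \<theta>) = grng TG ((x', y'), \<theta>') \<longleftrightarrow>
      gsrc WG (weyl_iso ((x, y), \<theta>)) = grng WG (weyl_iso ((x', y'), \<theta>'))"
    and "gsrc TG ((x, y), \<theta>) = grng TG ((x', y'), \<theta>') \<Longrightarrow>
      weyl_iso (gcomp TG ((x, y), \<theta>) ((x', y'), \<theta>')) =
      gcomp WG (weyl_iso ((x, y), \<theta>)) (weyl_iso ((x', y'), \<theta>'))"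
proof -
  obtain p q where pq: "(p, q) \<in> PP" "(x, y) \<in> cyl S p q" "\<theta> \<in> spectrum C" "y = anchor S \<psi> \<theta>"
    "\<theta> \<in> ndom C (E p q)" using arrowE[OF g] .
  obtain p' q' where pq': "(p', q') \<in> PP" "(x', y') \<in> cyl S p' q'" "\<theta>' \<in> spectrum C"
    "y' = anchor S \<psi> \<theta>'" "\<theta>' \<in> ndom C (E p' q')" using arrowE[OF h] .
  have src: "gsrc WG (weyl_iso ((x, y), \<theta>)) = \<theta>"
    unfolding weyl_iso_eq[OF pq(1,2) g] using germ_base_E[OF pq(1)] pq(5) by (simp add: weyl_src)
  have rng: "grng WG (weyl_iso ((x', y'), \<theta>')) = act S \<psi> (x', y') \<theta>'"
    unfolding weyl_iso_eq[OF pq'(1,2) h] act_eq[OF pq'(1-4)]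
    using germ_base_E[OF pq'(1)] pq'(5) by (simp add: weyl_rng)
  \<comment> \<open>Composability in the Weyl groupoid compares characters only. Taking anchors of
    equal characters shows that the paths then match as well.\<close>
  have anchor_act: "anchor S \<psi> (act S \<psi> (x', y') \<theta>') = x'"
    unfolding act_eq[OF pq'(1-4)] by (rule anchor_alpha_E[OF pq'(1-4)])
  show "gsrc TG ((x, y), \<theta>) = grng TG ((x', y'), \<theta>') \<longleftrightarrow>
      gsrc WG (weyl_iso ((x, y), \<theta>)) = grng WG (weyl_iso ((x', y'), \<theta>'))"
    unfolding src rng TG_simps(2,3) using anchor_act pq(4) by auto
  assume "gsrc TG ((x, y), \<theta>) = grng TG ((x', y'), \<theta>')"
  then have x': "x' = y" and \<theta>: "\<theta> = act S \<psi> (x', y') \<theta>'" unfolding TG_simps(2,3) by auto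
  \<comment> \<open>At a common length the source segment of the left arrow is the range segment of
    the right one, so the matrix units multiply to the unit of the composite.\<close>
  let ?n = "max (length p) (length p')"
  let ?p = "initial ?n x" and ?q = "initial ?n y" and ?r = "initial ?n y'"
  have pq1: "(?p, ?q) \<in> PP" "(x, y) \<in> cyl S ?p ?q"
    by (rule cyl_initial[OF pq(1,2)], simp)+
  have qr1: "(?q, ?r) \<in> PP" "(x', y') \<in> cyl S ?q ?r"
    unfolding x'[symmetric] by (rule cyl_initial[OF pq'(1,2)], simp)+
  have pr1: "(?p, ?r) \<in> PP" "(x, y') \<in> cyl S ?p ?r"
    using path_pairs_trans[OF pq1(1) qr1(1)] pq1(2) qr1(2) x' by (auto simp: cyl_def)
  have \<alpha>: "alpha C (E ?q ?r) \<theta>' = \<theta>" using act_eq[OF qr1 pq'(3,4)] \<theta> by simp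
  have gb: "(E ?q ?r, \<theta>') \<in> germ_base A C" "(E ?p ?q, alpha C (E ?q ?r) \<theta>') \<in> germ_base A C"
    unfolding \<alpha> germ_base_E[OF pq1(1)] germ_base_E[OF qr1(1)]
    by (rule cyl_ndom[OF qr1 pq'(3,4)], rule cyl_ndom[OF pq1 pq(3,4)])
  have gh: "((x, y'), \<theta>') \<in> arrows TG" by (rule cyl_arrow[OF pr1(2) pq'(3,4)])
  have "weyl_iso (gcomp TG ((x, y), \<theta>) ((x', y'), \<theta>')) = germ A C (E ?p ?r) \<theta>'"
    using weyl_iso_eq[OF pr1 gh] by (simp add: TG_simps)
  also have "\<dots> = germ A C (E ?p ?q * E ?q ?r) \<theta>'" using E_mult[OF pq1(1) qr1(1)] by simp
  also have "\<dots> = gcomp WG (germ A C (E ?p ?q) (alpha C (E ?q ?r) \<theta>')) (germ A C (E ?q ?r) \<theta>')"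
    by (rule weyl_comp[OF gb, symmetric])
  also have "\<dots> = gcomp WG (weyl_iso ((x, y), \<theta>)) (weyl_iso ((x', y'), \<theta>'))"
    unfolding \<alpha> weyl_iso_eq[OF pq1 g] weyl_iso_eq[OF qr1 h] ..
  finally show "weyl_iso (gcomp TG ((x, y), \<theta>) ((x', y'), \<theta>')) =
      gcomp WG (weyl_iso ((x, y), \<theta>)) (weyl_iso ((x', y'), \<theta>'))" .
qed

lemma weyl_iso: "top_groupoid_iso TG WG weyl_iso"
  unfolding top_groupoid_iso_def
proof (intro conjI ballI)
  show "bij_betw weyl_iso (arrows TG) (arrows WG)"
    using weyl_iso_inj weyl_iso_image by (simp add: bij_betw_def)
  show "homeomorphic_map (gtop TG) (gtop WG) weyl_iso"
    using weyl_iso_inj weyl_iso_image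
    by (intro bijective_open_imp_homeomorphic_map weyl_iso_continuous weyl_iso_open)
      (simp_all add: topspace_TG topspace_WG)
  fix g h assume "g \<in> arrows TG" "h \<in> arrows TG"
  moreover obtain x y \<theta> x' y' \<theta>' where "g = ((x, y), \<theta>)" "h = ((x', y'), \<theta>')" by (metis surj_pair)
  ultimately show "gsrc TG g = grng TG h \<longleftrightarrow> gsrc WG (weyl_iso g) = grng WG (weyl_iso h)"
    "gsrc TG g = grng TG h \<longrightarrow> weyl_iso (gcomp TG g h) = gcomp WG (weyl_iso g) (weyl_iso h)"
    using weyl_iso_functorial by blast+
qed

end

theorem theorem3p2:
  fixes S :: "('x, 'e) ah_system"
    and \<psi> :: "nat \<Rightarrow> 'x elt \<Rightarrow> 'a::cstar_algebra"
  assumes "diagonal_ah_system S"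
    and "ah_embedding S \<psi>"
  shows "\<exists>F. top_groupoid_iso (transformation_groupoid S \<psi>)
               (weyl_groupoid (lim_alg S \<psi>) (lim_diag S \<psi>)) F \<and>
    (\<forall>x y \<phi> p q. ((x, y), \<phi>) \<in> arrows (transformation_groupoid S \<psi>) \<longrightarrow>
       (p, q) \<in> path_pairs S \<longrightarrow> (x, y) \<in> cyl S p q \<longrightarrow>
       F ((x, y), \<phi>) = germ (lim_alg S \<psi>) (lim_diag S \<psi>) (ind_cyl S \<psi> p q) \<phi>)"
proof -
  interpret ah_embed S \<psi> using assms by unfold_locales
  show ?thesis
  proof (intro exI[of _ weyl_iso] conjI allI impI)
    show "top_groupoid_iso TG WG weyl_iso" by (rule weyl_iso)
    show "weyl_iso ((x, y), \<phi>) = germ A C (E p q) \<phi>"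
      if "((x, y), \<phi>) \<in> arrows TG" "(p, q) \<in> PP" "(x, y) \<in> cyl S p q" for x y \<phi> p q
      by (rule weyl_iso_eq[OF that(2,3,1)])
  qed
qed

end
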